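(* Let $d\ge1$ and let $I_d\subset\mathbb{K}[x_{ij}\mid i=0,\dots,d,\ j=0,1,2]$ be the ideal generated by the $2\times2$ minors of the generic block Hankel matrix $X_{\lfloor d/2\rfloor}$. Then $I_d$ is differentially perfect. In particular, for all integers $r,s\ge1$ the set $$\Big\{\prod_{i=1}^{l}f_i\ \Big|\ f_i\in\mathcal{M}_{r+1}(X_{\lfloor d/2\rfloor}),\ \sum_{i=1}^{l}(\deg f_i-r)=s\Big\}$$ forms a Gröbner basis for the symbolic power $(I_d^{\{r\}})^{(s)}$ with respect to any diagonal term order.
   Context: $\mathbb{K}$ is an algebraically closed field and $R=\mathbb{K}[\mathbf{x}]$ is the polynomial ring in the $x_{ij}$. For $0\le i\le d$ let $A_i=\begin{pmatrix} x_{i0} & x_{i1} \\ x_{i1} & x_{i2} \end{pmatrix}$. For $0\le k\le d$, $X_k$ is the block Hankel matrix with $k+1$ block rows and $d-k+1$ block columns whose block in position $(a,b)$ ($0\le a\le k$, $0\le b\le d-k$) is $A_{a+b}$. $\mathcal{M}_k(X)$ is the set of all $t\times t$ minors of $X$ for all $t\ge k$; $l\ge1$ is arbitrary. A diagonal term order here is any term order that selects the product of the main diagonal entries as the leading monomial of any minor of any of the matrices $X_k$ (for instance the lexicographic order with $x_{i_1j_1}\prec x_{i_2j_2}$ if $i_1>i_2$, or $i_1=i_2$ and $j_1>j_2$). Symbolic power: $I^{(r)}=(R_I^{-1}I^r)\cap R$, where $R_I$ is the complement of the union of the minimal primes of $I$. Join and secant ideals: $I\ast J=\big(I(\mathbf{y})+J(\mathbf{z})+\langle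 x_a-y_a-z_a\mid a\rangle\big)\cap\mathbb{K}[\mathbf{x}]$ ($a$ running over the indices of the variables), where $I(\mathbf{y})$ is $I$ with $y_a$ substituted for $x_a$; the $r$-th secant ideal is the $r$-fold join $I^{\{r\}}=I\ast\cdots\ast I$ (so $I^{\{1\}}=I$). An ideal $I$ is $r$-differentially perfect if for all $s\ge1$, $(I^{\{r\}})^{(s)}=I^{\{r+s-1\}}+\sum_{i=1}^{s-1}(I^{\{r\}})^{(i)}(I^{\{r\}})^{(s-i)}$; it is differentially perfect if it is $r$-differentially perfect for all $r\ge1$. *)

theory Defs
  imports
    "HOL-Library.Poly_Mapping"
    "HOL-Computational_Algebra.Polynomial"
    "HOL-Algebra.Ideal_Product"
    "Jordan_Normal_Form.DL_Submatrix"
    "Jordan_Normal_Form.Determinant"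
begin

section \<open>Polynomial rings\<close>

type_synonym 'v pmonom = "'v \<Rightarrow>\<^sub>0 nat"
type_synonym ('v, 'k) mpoly = "'v pmonom \<Rightarrow>\<^sub>0 'k"

definition Var :: "'v \<Rightarrow> ('v, 'k::comm_ring_1) mpoly" where
  "Var v = Poly_Mapping.single (Poly_Mapping.single v 1) 1"

definition Const :: "'k::comm_ring_1 \<Rightarrow> ('v, 'k) mpoly" where
  "Const c = Poly_Mapping.single 0 c"

definition monoms_in :: "'v set \<Rightarrow> 'v pmonom set" where
  "monoms_in V = {m. Poly_Mapping.keys m \<subseteq> V}"

text \<open>The ring \<open>\<bbbK>[x\<^sub>v | v \<in> V]\<close>; only the variables in \<open>V\<close> belong to it, although the
  ambient type has a variable for every element of \<open>'v\<close>.\<close>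

definition poly_ring :: "'v set \<Rightarrow> ('v, 'k::comm_ring_1) mpoly ring" where
  "poly_ring V = \<lparr>carrier = {p. Poly_Mapping.keys p \<subseteq> monoms_in V},
     monoid.mult = (*), one = 1, ring.zero = 0, add = (+)\<rparr>"

definition subst_poly :: "('v \<Rightarrow> ('w, 'k) mpoly) \<Rightarrow> ('v, 'k::comm_ring_1) mpoly \<Rightarrow> ('w, 'k) mpoly" where
  "subst_poly \<sigma> p =
    (\<Sum>m\<in>Poly_Mapping.keys p. Const (Poly_Mapping.lookup p m) *
       (\<Prod>v\<in>Poly_Mapping.keys m. \<sigma> v ^ Poly_Mapping.lookup m v))"

definition total_degree :: "('v, 'k::comm_ring_1) mpoly \<Rightarrow> nat" where
  "total_degree p = Max (insert 0
     ((\<lambda>m. \<Sum>v\<in>Poly_Mapping.keys m. Poly_Mapping.lookup m v) ` Poly_Mapping.keys p))"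

lemma cring_poly_ring: "cring (poly_ring V :: ('v, 'k::comm_ring_1) mpoly ring)"
proof (rule cringI)
  have mult: "Poly_Mapping.keys (p * q) \<subseteq> monoms_in V"
    if "Poly_Mapping.keys p \<subseteq> monoms_in V" "Poly_Mapping.keys q \<subseteq> monoms_in V"
    for p q :: "('v, 'k) mpoly"
  proof
    fix m assume "m \<in> Poly_Mapping.keys (p * q)"
    then obtain a b where "m = a + b" "a \<in> Poly_Mapping.keys p" "b \<in> Poly_Mapping.keys q"
      using keys_mult by blast
    then show "m \<in> monoms_in V"
      using that keys_add[of a b] unfolding monoms_in_def by fastforce
  qed
  have add: "Poly_Mapping.keys (p + q) \<subseteq> monoms_in V"
    if "Poly_Mapping.keys p \<subseteq> monoms_in V" "Poly_Mapping.keys q \<subseteq> monoms_in V"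
    for p q :: "('v, 'k) mpoly"
    using that keys_add[of p q] by blast
  show "abelian_group (poly_ring V :: ('v, 'k) mpoly ring)"
  proof (rule abelian_groupI)
    fix p assume "p \<in> carrier (poly_ring V :: ('v, 'k) mpoly ring)"
    then show "\<exists>q\<in>carrier (poly_ring V). q \<oplus>\<^bsub>poly_ring V\<^esub> p = \<zero>\<^bsub>poly_ring V\<^esub>"
      by (intro bexI[of _ "- p"]) (auto simp: poly_ring_def subset_iff in_keys_iff)
  qed (use add in \<open>auto simp: poly_ring_def ac_simps\<close>)
  show "comm_monoid (poly_ring V :: ('v, 'k) mpoly ring)"
    by (rule comm_monoidI) (use mult in \<open>auto simp: poly_ring_def ac_simps monoms_in_def\<close>)
qed (auto simp: poly_ring_def algebra_simps)


section \<open>Symbolic powers\<close>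

definition minimal_primes :: "('a, 'b) ring_scheme \<Rightarrow> 'a set \<Rightarrow> 'a set set" where
  "minimal_primes R I = {P. primeideal P R \<and> I \<subseteq> P \<and>
     (\<forall>Q. primeideal Q R \<longrightarrow> I \<subseteq> Q \<longrightarrow> Q \<subseteq> P \<longrightarrow> Q = P)}"

text \<open>The fraction \<open>a/u\<close> in the localization \<open>S\<^sup>-\<^sup>1R\<close>, as an equivalence class of pairs.\<close>

definition loc_frac :: "('a, 'b) ring_scheme \<Rightarrow> 'a set \<Rightarrow> 'a \<Rightarrow> 'a \<Rightarrow> ('a \<times> 'a) set" where
  "loc_frac R S a u = {(b, w). b \<in> carrier R \<and> w \<in> S \<and>
     (\<exists>v\<in>S. v \<otimes>\<^bsub>R\<^esub> (w \<otimes>\<^bsub>R\<^esub> a) = v \<otimes>\<^bsub>R\<^esub> (u \<otimes>\<^bsub>R\<^esub> b))}"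

definition loc_ideal :: "('a, 'b) ring_scheme \<Rightarrow> 'a set \<Rightarrow> 'a set \<Rightarrow> ('a \<times> 'a) set set" where
  "loc_ideal R S J = {loc_frac R S a u | a u. a \<in> J \<and> u \<in> S}"

text \<open>\<open>ideals_set R\<close> is the semiring of ideals of \<open>R\<close>, so \<open>[^]\<close> below is the power of an ideal, and
  in \<open>r_diff_perfect\<close> the operations \<open>\<otimes>\<close>, \<open>\<oplus>\<close> and \<open>\<Oplus>\<close> are products and sums of ideals.
  Intersecting with \<open>R\<close> means taking the preimage under \<open>f \<mapsto> f/1\<close>.\<close>

definition symbolic_power :: "('a, 'b) ring_scheme \<Rightarrow> 'a set \<Rightarrow> nat \<Rightarrow> 'a set" where
  "symbolic_power R I r =
    (let S = carrier R - \<Union> (minimal_primes R I)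
     in {f \<in> carrier R. loc_frac R S f \<one>\<^bsub>R\<^esub> \<in> loc_ideal R S (I [^]\<^bsub>ideals_set R\<^esub> r)})"


section \<open>Joins, secant ideals and differential perfection\<close>

datatype 'v xyz = X_var 'v | Y_var 'v | Z_var 'v

definition join_ideal ::
  "'v set \<Rightarrow> ('v, 'k::comm_ring_1) mpoly set \<Rightarrow> ('v, 'k) mpoly set \<Rightarrow> ('v, 'k) mpoly set" where
  "join_ideal V I J = {p \<in> carrier (poly_ring V).
     subst_poly (\<lambda>a. Var (X_var a)) p \<in>
       genideal (poly_ring (X_var ` V \<union> Y_var ` V \<union> Z_var ` V))
         (subst_poly (\<lambda>a. Var (Y_var a)) ` I \<union>
          subst_poly (\<lambda>a. Var (Z_var a)) ` J \<union>
          {Var (X_var a) - Var (Y_var a) - Var (Z_var a) | a. a \<in> V})}"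

text \<open>The \<open>r\<close>-fold join of \<open>I\<close> with itself, for \<open>r \<ge> 1\<close>; the value at \<open>r = 0\<close> is irrelevant.\<close>

definition secant_ideal ::
  "'v set \<Rightarrow> ('v, 'k::comm_ring_1) mpoly set \<Rightarrow> nat \<Rightarrow> ('v, 'k) mpoly set" where
  "secant_ideal V I r = (join_ideal V I ^^ (r - 1)) I"

definition r_diff_perfect :: "'v set \<Rightarrow> ('v, 'k::comm_ring_1) mpoly set \<Rightarrow> nat \<Rightarrow> bool" where
  "r_diff_perfect V I r \<longleftrightarrow>
    (let R = poly_ring V; J = secant_ideal V I
     in \<forall>s\<ge>1. symbolic_power R (J r) s =
          J (r + s - 1) \<oplus>\<^bsub>ideals_set R\<^esub>
          (\<Oplus>\<^bsub>ideals_set R\<^esub>i\<in>{1..s-1}.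
             symbolic_power R (J r) i \<otimes>\<^bsub>ideals_set R\<^esub> symbolic_power R (J r) (s - i)))"

definition diff_perfect :: "'v set \<Rightarrow> ('v, 'k::comm_ring_1) mpoly set \<Rightarrow> bool" where
  "diff_perfect V I \<longleftrightarrow> (\<forall>r\<ge>1. r_diff_perfect V I r)"


section \<open>Term orders and Groebner bases\<close>

text \<open>A pair \<open>(m, n)\<close> in the order means \<open>m \<preceq> n\<close>. Monomials are written additively, so \<open>0\<close> is the
  monomial 1 and \<open>+\<close> is multiplication.\<close>

definition term_order :: "'v set \<Rightarrow> 'v pmonom rel \<Rightarrow> bool" where
  "term_order V ord \<longleftrightarrow> linear_order_on (monoms_in V) ord \<and>
     (\<forall>m\<in>monoms_in V. (0, m) \<in> ord) \<and>
     (\<forall>a\<in>monoms_in V. \<forall>b\<in>monoms_in V. \<forall>c\<in>monoms_in V.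
        (a, b) \<in> ord \<longrightarrow> (a + c, b + c) \<in> ord)"

text \<open>The leading monomial, as a polynomial with coefficient 1; only meaningful for \<open>p \<noteq> 0\<close>.\<close>

definition lead_monom :: "'v pmonom rel \<Rightarrow> ('v, 'k::comm_ring_1) mpoly \<Rightarrow> ('v, 'k) mpoly" where
  "lead_monom ord p =
     Poly_Mapping.single (THE m. m \<in> Poly_Mapping.keys p \<and>
       (\<forall>n\<in>Poly_Mapping.keys p. (n, m) \<in> ord)) 1"

definition groebner_basis ::
  "'v set \<Rightarrow> 'v pmonom rel \<Rightarrow> ('v, 'k::comm_ring_1) mpoly set \<Rightarrow> ('v, 'k) mpoly set \<Rightarrow> bool" where
  "groebner_basis V ord G I \<longleftrightarrow> finite G \<and> G \<subseteq> I \<and>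
     genideal (poly_ring V) (lead_monom ord ` (G - {0})) =
     genideal (poly_ring V) (lead_monom ord ` (I - {0}))"


section \<open>Block Hankel matrices and their minors\<close>

definition hankel_vars :: "nat \<Rightarrow> (nat \<times> nat) set" where
  "hankel_vars d = {0..d} \<times> {0..2}"

definition A_block :: "nat \<Rightarrow> (nat \<times> nat, 'k::comm_ring_1) mpoly mat" where
  "A_block i = mat_of_rows_list 2 [[Var (i, 0), Var (i, 1)], [Var (i, 1), Var (i, 2)]]"

text \<open>Row \<open>p\<close> is row \<open>p mod 2\<close> of block row \<open>p div 2\<close>; likewise for columns.\<close>

definition block_hankel :: "nat \<Rightarrow> nat \<Rightarrow> (nat \<times> nat, 'k::comm_ring_1) mpoly mat" where
  "block_hankel d k = mat (2 * (k + 1)) (2 * (d - k + 1))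
     (\<lambda>(p, q). A_block (p div 2 + q div 2) $$ (p mod 2, q mod 2))"

definition square_submatrices :: "nat \<Rightarrow> 'a mat \<Rightarrow> 'a mat set" where
  "square_submatrices t M = {submatrix M I J | I J.
     I \<subseteq> {..<dim_row M} \<and> J \<subseteq> {..<dim_col M} \<and> card I = t \<and> card J = t}"

definition minors_ge :: "nat \<Rightarrow> 'a::comm_ring_1 mat \<Rightarrow> 'a set" where
  "minors_ge k M = {det N | N t. t \<ge> k \<and> N \<in> square_submatrices t M}"

definition hankel_ideal :: "nat \<Rightarrow> (nat \<times> nat, 'k::comm_ring_1) mpoly set" where
  "hankel_ideal d = genideal (poly_ring (hankel_vars d))
     (det ` square_submatrices 2 (block_hankel d (d div 2)))"

text \<open>The coefficient field is passed as a type argument, since the order itself only concerns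
  monomials.\<close>

definition diagonal_term_order :: "'k::comm_ring_1 itself \<Rightarrow> nat \<Rightarrow> (nat \<times> nat) pmonom rel \<Rightarrow> bool" where
  "diagonal_term_order _ d ord \<longleftrightarrow> term_order (hankel_vars d) ord \<and>
     (\<forall>k\<le>d. \<forall>t\<ge>1. \<forall>N \<in> square_submatrices t (block_hankel d k :: (nat \<times> nat, 'k) mpoly mat).
        lead_monom ord (det N) = prod_list (diag_mat N))"

text \<open>The differences \<open>deg f\<^sub>i - r\<close> are taken in the integers.\<close>

definition minor_products ::
  "nat \<Rightarrow> nat \<Rightarrow> nat \<Rightarrow> (nat \<times> nat, 'k::comm_ring_1) mpoly set" where
  "minor_products d r s = {(\<Prod>i=1..l. f i) | (l::nat) f. l \<ge> 1 \<and>
     (\<forall>i\<in>{1..l}. f i \<in> minors_ge (r + 1) (block_hankel d (d div 2))) \<and>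
     (\<Sum>i=1..l. int (total_degree (f i)) - int r) = int s}"

end

theory Submission
  imports Defs "HOL-Library.Product_Lexorder"
begin

text \<open>
  The variety of \<open>I\<^sub>d\<close> is the closure of a torus orbit, the image of \<open>x\<^sub>i\<^sub>j \<mapsto> w t\<^sup>i v\<^sup>j\<close>. Let \<open>H\<^sub>r\<^sup>s\<close> be the
  ideal of polynomials vanishing to order \<open>s\<close> along the \<open>r\<close>-fold sums of points of this orbit. Then
  \<open>H\<^sub>r\<^sup>1\<close> is the \<open>r\<close>-th secant ideal, and minors of size \<open>r + t\<close> lie in \<open>H\<^sub>r\<^sup>t\<close>.

  The variables form a poset whose chains are the main diagonals of minors, and a monomial supported on
  an antichain is the least one with its image in the torus. Taking derivatives along the orbit, this
  shows that the leading monomial of an element of \<open>H\<^sub>r\<^sup>s\<close> has degree at least \<open>s\<close> outside every set of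
  variables without chains of length \<open>r + 1\<close>. By Greene--Kleitman duality it is divisible by a product
  of chains \<open>C\<close> with \<open>\<Sum>(|C| - r) \<ge> s\<close>, that is, by the leading monomial of a product of minors. So
  products of minors are a Groebner basis of \<open>H\<^sub>r\<^sup>s\<close>. Sylvester's identity places minors of size \<open>r + t\<close> in
  the \<open>t\<close>-th symbolic power of \<open>H\<^sub>r\<^sup>1\<close>, which therefore equals \<open>H\<^sub>r\<^sup>t\<close>; the factorization of the
  generators into minors is differential perfection.
\<close>

text \<open>A set of variables without chains of length \<open>r + 1\<close> is a union of
  \<open>r\<close> antichains, one for each orbit point in the sum: every derivative along the orbit
  removes one antichain from the leading monomial. The derivatives are Hasse coefficients, which
  remove it with coefficient 1 in every characteristic. They also replace evaluation at points, so
  that joins, orders of vanishing and primality are treated by formal expansions.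

  Why antichain monomials are least in their fibre: every other monomial contains the diagonal of a
  two-minor; exchanging it for the antidiagonal stays in the fibre and goes down in any diagonal
  order, and a fibre holds only one antichain monomial.

  Two term orders occur. The Groebner statement compares leading ideals for an arbitrary diagonal
  order. Showing that products of minors generate an ideal takes a terminating division, and this is
  done with one concrete diagonal order whose initial segments are finite. Symbolic powers and
  differential perfection do not mention an order and rest on that one.\<close>

abbreviation (input) lookup :: "('a \<Rightarrow>\<^sub>0 'b::zero) \<Rightarrow> 'a \<Rightarrow> 'b" where "lookup \<equiv> Poly_Mapping.lookup"
abbreviation (input) keys :: "('a \<Rightarrow>\<^sub>0 'b::zero) \<Rightarrow> 'a set" where "keys \<equiv> Poly_Mapping.keys"
abbreviation (input) single :: "'a \<Rightarrow> 'b::zero \<Rightarrow> 'a \<Rightarrow>\<^sub>0 'b" where "single \<equiv> Poly_Mapping.single"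

type_synonym 'k hpoly = "(nat \<times> nat, 'k) mpoly"

section \<open>Greene--Kleitman duality\<close>

text \<open>Induction of Halmos and Vaughan: a nonempty proper subset without spare neighbours is
  matched separately from its complement; if there is none, every nonempty proper subset has a
  neighbour to spare and any one edge may be fixed.\<close>

lemma hall_marriage:
  assumes "finite L" "\<And>x. x \<in> L \<Longrightarrow> finite (N x)"
    and "\<And>S. S \<subseteq> L \<Longrightarrow> card S \<le> card (\<Union>(N ` S))"
  shows "\<exists>f. inj_on f L \<and> (\<forall>x\<in>L. f x \<in> N x)"
  using assms
proof (induction "card L" arbitrary: L N rule: less_induct)
  case less
  note fin = less.prems(1,2) and hall = less.prems(3)
  have finU: "finite (\<Union>(N ` S))" if "S \<subseteq> L" for S
    using that fin finite_subset[OF that fin(1)] by auto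
  show ?case
  proof (cases "L = {}")
    case False
    then obtain x where x: "x \<in> L" by auto
    show ?thesis
    proof (cases "\<exists>S. S \<subset> L \<and> S \<noteq> {} \<and> card (\<Union>(N ` S)) \<le> card S")
      case True
      then obtain S where S: "S \<subset> L" "S \<noteq> {}" "card (\<Union>(N ` S)) \<le> card S" by blast
      let ?T = "\<Union>(N ` S)"
      have finS: "finite S" using S fin(1) finite_subset by blast
      obtain f where f: "inj_on f S" "\<forall>x\<in>S. f x \<in> N x"
        using less.hyps[of S N] S fin hall psubset_card_mono[OF fin(1) S(1)] finS by blast
      \<comment> \<open>The neighbours of \<open>S\<close> are withdrawn. Hall's condition survives
        for \<open>S'\<close> because it holds for \<open>S' \<union> S\<close>, and
        \<open>S\<close> accounts for at most \<open>card S\<close> of the neighbours.\<close>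
      have "\<exists>g. inj_on g (L - S) \<and> (\<forall>x\<in>L - S. g x \<in> N x - ?T)"
      proof (rule less.hyps)
        show "card (L - S) < card L"
          using S fin(1) by (intro psubset_card_mono) auto
        fix S' assume S': "S' \<subseteq> L - S"
        have "card S' + card S = card (S' \<union> S)"
          using S' finS fin(1) finite_subset[of S' L] by (subst card_Un_disjoint) auto
        also have "\<dots> \<le> card (\<Union>(N ` (S' \<union> S)))" using S' S by (intro hall) auto
        also have "\<Union>(N ` (S' \<union> S)) = \<Union>((\<lambda>x. N x - ?T) ` S') \<union> ?T" by auto
        also have "card \<dots> \<le> card (\<Union>((\<lambda>x. N x - ?T) ` S')) + card ?T" by (rule card_Un_le)
        finally show "card S' \<le> card (\<Union>((\<lambda>x. N x - ?T) ` S'))" using S(3) by linarith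
      qed (use fin in auto)
      then obtain g where g: "inj_on g (L - S)" "\<forall>x\<in>L - S. g x \<in> N x - ?T" by blast
      show ?thesis
      proof (intro exI conjI)
        show "inj_on (\<lambda>x. if x \<in> S then f x else g x) L"
        proof (rule inj_onI)
          fix u v assume uv: "u \<in> L" "v \<in> L"
            "(if u \<in> S then f u else g u) = (if v \<in> S then f v else g v)"
          consider "u \<in> S" "v \<in> S" | "u \<notin> S" "v \<notin> S" | "u \<in> S" "v \<notin> S" | "u \<notin> S" "v \<in> S"
            by blast
          then show "u = v"
          proof cases
            case 1
            then show ?thesis using uv f(1) by (simp add: inj_on_def)
          next
            case 2
            then show ?thesis using uv g(1) by (simp add: inj_on_def)
          next
            case 3
            then have "f u \<in> ?T" "g v \<notin> ?T" using uv f(2) g(2) by blast+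
            then show ?thesis using 3 uv by simp
          next
            case 4
            then have "f v \<in> ?T" "g u \<notin> ?T" using uv f(2) g(2) by blast+
            then show ?thesis using 4 uv by simp
          qed
        qed
      qed (use f g in auto)
    next
      case False
      have "N x \<noteq> {}" using hall[of "{x}"] x by auto
      then obtain y where y: "y \<in> N x" by auto
      have "\<exists>g. inj_on g (L - {x}) \<and> (\<forall>z\<in>L - {x}. g z \<in> N z - {y})"
      proof (rule less.hyps)
        show "card (L - {x}) < card L" using x fin(1) by (metis card_Diff1_less)
        fix S assume S: "S \<subseteq> L - {x}"
        show "card S \<le> card (\<Union>((\<lambda>z. N z - {y}) ` S))"
        proof (cases "S = {}")
          case nonempty: False
          have "S \<subset> L" using S x by auto
          then have "card S < card (\<Union>(N ` S))" using False nonempty by (meson not_le)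
          moreover have "\<Union>((\<lambda>z. N z - {y}) ` S) = \<Union>(N ` S) - {y}" by auto
          moreover have "finite (\<Union>(N ` S))" using finU S by blast
          ultimately show ?thesis by (auto simp: card_Diff_singleton_if)
        qed simp
      qed (use fin in auto)
      then obtain g where g: "inj_on g (L - {x})" "\<forall>z\<in>L - {x}. g z \<in> N z - {y}" by blast
      show ?thesis
      proof (intro exI conjI)
        show "inj_on (g(x := y)) L"
        proof (rule inj_onI)
          fix u v assume uv: "u \<in> L" "v \<in> L" "(g(x := y)) u = (g(x := y)) v"
          have ne: "g z \<noteq> y" if "z \<in> L" "z \<noteq> x" for z using g(2) that by blast
          show "u = v"
          proof (cases "u = x \<or> v = x")
            case True
            then show ?thesis using uv ne[of u] ne[of v] by (auto split: if_splits)
          next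
            case False
            then show ?thesis using uv by (intro inj_onD[OF g(1)]) auto
          qed
        qed
      qed (use g y in auto)
    qed
  qed auto
qed

text \<open>Integral potentials of least total value satisfy Hall's condition on their tight edges.\<close>

lemma assignment_duality:
  fixes w :: "'a \<Rightarrow> 'b \<Rightarrow> int"
  assumes fin: "finite L" "finite R" and g: "bij_betw g L R" "\<And>x. x \<in> L \<Longrightarrow> A x (g x)"
  obtains f a b where "bij_betw f L R" "\<And>x. x \<in> L \<Longrightarrow> A x (f x)"
    "\<And>x y. x \<in> L \<Longrightarrow> y \<in> R \<Longrightarrow> A x y \<Longrightarrow> w x y \<le> a x + b y"
    "(\<Sum>x\<in>L. w x (f x)) = sum a L + sum b R"
proof -
  define feas :: "('a \<Rightarrow> int) \<times> ('b \<Rightarrow> int) \<Rightarrow> bool" where "feas = (\<lambda>(a, b). \<forall>x\<in>L. \<forall>y\<in>R. A x y \<longrightarrow> w x y \<le> a x + b y)"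
  define val :: "('a \<Rightarrow> int) \<times> ('b \<Rightarrow> int) \<Rightarrow> int" where "val = (\<lambda>(a, b). sum a L + sum b R)"
  \<comment> \<open>Weak duality: the given matching bounds every feasible total from below, so
    shifting by \<open>low\<close> to the naturals yields a least one.\<close>
  define low where "low = (\<Sum>x\<in>L. w x (g x))"
  have low: "low \<le> val p" if feas: "feas p" for p
  proof -
    obtain a b where p: "p = (a, b)" by force
    have "low \<le> (\<Sum>x\<in>L. a x + b (g x))"
      unfolding low_def using feas g bij_betwE[OF g(1)] by (intro sum_mono) (auto simp: feas_def p)
    also have "\<dots> = val p"
      using sum.reindex_bij_betw[OF g(1), of b] by (simp add: val_def p sum.distrib)
    finally show ?thesis .
  qed
  have "feas (\<lambda>x. Max (w x ` R), \<lambda>_. 0)" using fin by (auto simp: feas_def)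
  from ex_has_least_nat[of feas, OF this, of "\<lambda>p. nat (val p - low)"]
  obtain a b where ab: "feas (a, b)" and
    least: "\<And>p. feas p \<Longrightarrow> nat (val (a, b) - low) \<le> nat (val p - low)" by force
  have least: "val (a, b) \<le> val p" if "feas p" for p
    using least[OF that] low[OF that] low[OF ab] by linarith
  define N where "N x = {y \<in> R. A x y \<and> w x y = a x + b y}" for x
  have "\<exists>f. inj_on f L \<and> (\<forall>x\<in>L. f x \<in> N x)"
  proof (rule hall_marriage)
    fix S assume S: "S \<subseteq> L"
    let ?T = "\<Union>(N ` S)"
    \<comment> \<open>Lower \<open>a\<close> by one on \<open>S\<close> and raise \<open>b\<close>
      by one on its tight neighbours. By integrality an edge from \<open>S\<close> to any other
      point has slack at least one, so this stays feasible, and minimality gives Hall's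
      condition.\<close>
    define a' where "a' x = a x - of_bool (x \<in> S)" for x
    define b' where "b' y = b y + of_bool (y \<in> ?T)" for y
    have "feas (a', b')"
      unfolding feas_def
    proof (clarify)
      fix x y assume xy: "x \<in> L" "y \<in> R" "A x y"
      have "w x y \<le> a x + b y" using ab xy by (auto simp: feas_def)
      moreover have "w x y < a x + b y" if "x \<in> S" "y \<notin> ?T"
        using that xy calculation by (auto simp: N_def)
      ultimately show "w x y \<le> a' x + b' y" by (auto simp: a'_def b'_def of_bool_def)
    qed
    then have "val (a, b) \<le> val (a', b')" by (rule least)
    moreover have "sum a' L = sum a L - card S" "sum b' R = sum b R + card ?T"
      unfolding a'_def b'_def using fin S
      by (auto simp: sum_subtractf sum.distrib Int_absorb1 N_def intro!: arg_cong[of _ _ card])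
    ultimately show "card S \<le> card ?T" by (simp add: val_def)
  qed (use fin in \<open>auto simp: N_def\<close>)
  then obtain f where f: "inj_on f L" "\<forall>x\<in>L. f x \<in> N x" by blast
  have "f ` L \<subseteq> R" using f by (auto simp: N_def)
  moreover have "card (f ` L) = card R" using card_image[OF f(1)] bij_betw_same_card[OF g(1)] by simp
  ultimately have bij: "bij_betw f L R"
    using f fin by (auto simp: bij_betw_def card_subset_eq)
  have "(\<Sum>x\<in>L. w x (f x)) = (\<Sum>x\<in>L. a x + b (f x))"
    using f by (intro sum.cong) (auto simp: N_def)
  also have "\<dots> = sum a L + sum b R"
    using sum.reindex_bij_betw[OF bij, of b] by (simp add: sum.distrib)
  finally show thesis
    using that[of f a b] bij f ab by (auto simp: N_def feas_def)
qed

text \<open>In- and out-degrees at most one make \<open>E\<close> a union of disjoint increasing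
  paths, and every edge merges two of the \<open>card W\<close> trivial ones. The clause on
  \<open>tl c\<close> carries the induction: the successor of the removed minimal element has no
  other predecessor, so it heads its chain and the removed element can be put in front.\<close>

lemma chain_partition:
  fixes less :: "'u \<Rightarrow> 'u \<Rightarrow> bool"
  assumes "finite W" "E \<subseteq> W \<times> W" "\<And>u v. (u, v) \<in> E \<Longrightarrow> less u v"
    and "\<And>u v v'. (u, v) \<in> E \<Longrightarrow> (u, v') \<in> E \<Longrightarrow> v = v'"
    and "\<And>u u' v. (u, v) \<in> E \<Longrightarrow> (u', v) \<in> E \<Longrightarrow> u = u'"
    and less: "\<And>u. \<not> less u u" "\<And>u v z. less u v \<Longrightarrow> less v z \<Longrightarrow> less u z"
  shows "\<exists>cs. (\<forall>c\<in>set cs. c \<noteq> [] \<and> sorted_wrt less c \<and> (\<forall>z\<in>set (tl c). \<exists>u. (u, z) \<in> E)) \<and>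
    distinct (concat cs) \<and> set (concat cs) = W \<and> length cs + card E = card W"
  using assms(1-5)
proof (induction "card W" arbitrary: W E)
  case 0
  then show ?case by (intro exI[of _ "[]"]) auto
next
  case (Suc n)
  have "\<exists>x\<in>W. \<forall>y\<in>W. \<not> less y x"
  proof -
    have "\<exists>x\<in>W. \<forall>y\<in>W. card {z \<in> W. less z x} \<le> card {z \<in> W. less z y}"
      using ex_has_least_nat[of "\<lambda>x. x \<in> W" _ "\<lambda>x. card {z \<in> W. less z x}"] Suc(2)
      by (metis card.empty ex_in_conv nat.distinct(1))
    then obtain x where x: "x \<in> W" "\<And>y. y \<in> W \<Longrightarrow> card {z \<in> W. less z x} \<le> card {z \<in> W. less z y}"
      by blast
    have "\<not> less y x" if y: "y \<in> W" for y
    proof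
      assume "less y x"
      then have "{z \<in> W. less z y} \<subset> {z \<in> W. less z x}" using less y by blast
      then have "card {z \<in> W. less z y} < card {z \<in> W. less z x}"
        using Suc(3) by (intro psubset_card_mono) auto
      with x(2)[OF y] show False by simp
    qed
    with x show ?thesis by blast
  qed
  then obtain x where x: "x \<in> W" "\<And>y. y \<in> W \<Longrightarrow> \<not> less y x" by blast
  define E' where "E' = E - {x} \<times> UNIV"
  have nopred: "(u, x) \<notin> E" for u using x(2) Suc.prems(2,3) by blast
  have finE: "finite E" using Suc(3,4) finite_subset by blast
  have "\<exists>cs. (\<forall>c\<in>set cs. c \<noteq> [] \<and> sorted_wrt less c \<and> (\<forall>z\<in>set (tl c). \<exists>u. (u, z) \<in> E')) \<and>
    distinct (concat cs) \<and> set (concat cs) = W - {x} \<and> length cs + card E' = card (W - {x})"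
  proof (rule Suc.hyps(1))
    show "n = card (W - {x})" using Suc.hyps(2) Suc.prems(1) x by simp
    show "E' \<subseteq> (W - {x}) \<times> (W - {x})" using Suc.prems(2) nopred by (auto simp: E'_def)
    show "u = u'" if "(u, v) \<in> E'" "(u', v) \<in> E'" for u u' v
      using that Suc.prems(5)[of u v u'] by (simp add: E'_def)
    show "v = v'" if "(u, v) \<in> E'" "(u, v') \<in> E'" for u v v'
      using that Suc.prems(4)[of u v v'] by (simp add: E'_def)
    show "less u v" if "(u, v) \<in> E'" for u v using that Suc.prems(3) by (simp add: E'_def)
  qed (use Suc.prems(1) in simp)
  then obtain cs where cs: "\<forall>c\<in>set cs. c \<noteq> [] \<and> sorted_wrt less c \<and> (\<forall>z\<in>set (tl c). \<exists>u. (u, z) \<in> E')"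
    "distinct (concat cs)" "set (concat cs) = W - {x}" "length cs + card E' = card (W - {x})" by blast
  have cW: "card W = Suc (card (W - {x}))" using x Suc(3) by (metis card.remove)
  show ?case
  proof (cases "\<exists>y. (x, y) \<in> E")
    case False
    then have "E' = E" by (auto simp: E'_def)
    show ?thesis
    proof (intro exI[of _ "[x] # cs"] conjI)
      show "set (concat ([x] # cs)) = W" "distinct (concat ([x] # cs))" using cs(2,3) x(1) by auto
      show "length ([x] # cs) + card E = card W" using cs(4) cW \<open>E' = E\<close> by simp
    qed (use cs(1) \<open>E' = E\<close> in simp)
  next
    case True
    then obtain y where y: "(x, y) \<in> E" by blast
    have "v = y" if "(x, v) \<in> E" for v using Suc.prems(4)[OF y that] by simp
    then have E: "E = insert (x, y) E'" unfolding E'_def using y by blast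
    have "(x, y) \<notin> E'" by (auto simp: E'_def)
    then have cE: "card E = Suc (card E')" using E finE by simp
    have "y \<in> W - {x}" using y nopred Suc(4) by auto
    then obtain c where c: "c \<in> set cs" "y \<in> set c" using cs(3) by auto
    have "y \<notin> set (tl c)"
    proof
      assume "y \<in> set (tl c)"
      then obtain u where "(u, y) \<in> E'" using cs(1) c by blast
      then show False using Suc.prems(5)[OF y, of u] by (simp add: E'_def)
    qed
    then have hd: "hd c = y" using c by (cases c) auto
    obtain as bs where ab: "cs = as @ c # bs" using c by (meson split_list)
    have "sorted_wrt less (x # c)"
    proof -
      have "less x z" if "z \<in> set c" for z
        using that cs(1) c(1) hd Suc.prems(3)[OF y] less(2) by (cases c) auto
      then show ?thesis using cs(1) c by simp
    qed
    moreover have "x \<notin> set (concat cs)" using cs by auto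
    moreover have "\<exists>u. (u, z) \<in> E" if "z \<in> set c" for z
    proof (cases "z = y")
      case False
      then have "z \<in> set (tl c)" using that hd by (cases c) auto
      then have "\<exists>u. (u, z) \<in> E'" using cs(1) c(1) by blast
      then show ?thesis using E by blast
    qed (use y in blast)
    moreover have "\<exists>u. (u, z) \<in> E" if "z \<in> set (tl c')" "c' \<in> set cs" for z c'
    proof -
      have "\<exists>u. (u, z) \<in> E'" using that cs(1) by blast
      then show ?thesis using E by blast
    qed
    ultimately have chains: "\<forall>c\<in>set (as @ (x # c) # bs). c \<noteq> [] \<and> sorted_wrt less c \<and>
        (\<forall>z\<in>set (tl c). \<exists>u. (u, z) \<in> E)"
      and x': "x \<notin> set (concat cs)"
      using cs(1) unfolding ab by auto
    show ?thesis
    proof (intro exI conjI)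
      show "distinct (concat (as @ (x # c) # bs))" using cs(2) x' by (auto simp: ab)
      have "set (concat (as @ (x # c) # bs)) = insert x (set (concat cs))" by (auto simp: ab)
      then show "set (concat (as @ (x # c) # bs)) = W" using cs(3) x(1) by auto
      show "length (as @ (x # c) # bs) + card E = card W" using cs(4) cW cE by (simp add: ab)
    qed (fact chains)
  qed
qed

text \<open>Chain families of \<open>U\<close> are the perfect matchings between two copies of \<open>U\<close> enlarged by
  \<open>card U\<close> dummies: an element matched to itself is unused, one matched to a dummy starts or ends a
  chain. The elements on which the optimal potentials cancel have no long chains, since the
  potential decreases by at least one along a chain.\<close>

lemma chain_family_duality:
  fixes less :: "'u \<Rightarrow> 'u \<Rightarrow> bool"
  assumes fin: "finite U"
    and less: "\<And>u. \<not> less u u" "\<And>u v z. less u v \<Longrightarrow> less v z \<Longrightarrow> less u z"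
  obtains X cs where "X \<subseteq> U" "\<And>c. set c \<subseteq> X \<Longrightarrow> sorted_wrt less c \<Longrightarrow> length c \<le> r"
    "\<And>c. c \<in> set cs \<Longrightarrow> sorted_wrt less c" "distinct (concat cs)" "set (concat cs) \<subseteq> U"
    "int (card (U - X)) \<le> (\<Sum>c\<leftarrow>cs. int (length c) - int r)"
proof -
  define L where "L = U <+> {..<card U}"
  define A where "A x y = (case (x, y) of (Inl u, Inl v) \<Rightarrow> u = v \<or> less u v | _ \<Rightarrow> True)"
    for x y :: "'u + nat"
  \<comment> \<open>A chain of \<open>n\<close> elements uses \<open>n - 1\<close> edges of weight
    1, one start of weight \<open>1 - r\<close> and one end of weight 0, so its weight is
    \<open>n - r\<close>.\<close>
  define w where "w x y = (case (x, y) of (Inl u, Inl v) \<Rightarrow> if u = v then 0 else 1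
      | (Inr _, Inl _) \<Rightarrow> 1 - int r | _ \<Rightarrow> 0)" for x y :: "'u + nat"
  have finL: "finite L" unfolding L_def using fin by auto
  have "A x (id x)" for x by (cases x) (auto simp: A_def)
  then obtain f a b where f: "bij_betw f L L" "\<And>x. x \<in> L \<Longrightarrow> A x (f x)"
    and ab: "\<And>x y. x \<in> L \<Longrightarrow> y \<in> L \<Longrightarrow> A x y \<Longrightarrow> w x y \<le> a x + b y"
    and opt: "(\<Sum>x\<in>L. w x (f x)) = sum a L + sum b L"
    using assignment_duality[OF finL finL bij_betw_id, where A = A and w = w] by blast
  have sumL: "sum h L = (\<Sum>u\<in>U. h (Inl u)) + (\<Sum>i<card U. h (Inr i))" for h :: "_ \<Rightarrow> int"
    unfolding L_def using fin by (subst sum.Plus) auto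
  define E where "E = {(u, v). u \<in> U \<and> v \<in> U \<and> f (Inl u) = Inl v \<and> u \<noteq> v}"
  define W where "W = {v \<in> U. f (Inl v) \<noteq> Inl v}"
  define B where "B = {i \<in> {..<card U}. f (Inr i) \<in> range (Inl :: 'u \<Rightarrow> 'u + nat)}"
  have inj: "f x = f y \<Longrightarrow> x \<in> L \<Longrightarrow> y \<in> L \<Longrightarrow> x = y" for x y
    using f(1) by (auto simp: bij_betw_def inj_on_def)
  have E_W: "E \<subseteq> W \<times> W"
  proof
    fix e assume "e \<in> E"
    then obtain u v where e: "e = (u, v)" "u \<in> U" "v \<in> U" "f (Inl u) = Inl v" "u \<noteq> v"
      by (auto simp: E_def)
    have "f (Inl v) \<noteq> Inl v" using inj[of "Inl u" "Inl v"] e unfolding L_def by (metis InlI sum.inject(1))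
    then show "e \<in> W \<times> W" using e by (simp add: W_def)
  qed
  have finE: "finite E" by (rule finite_subset[of _ "U \<times> U"]) (use fin in \<open>auto simp: E_def\<close>)
  have "\<exists>cs. (\<forall>c\<in>set cs. c \<noteq> [] \<and> sorted_wrt less c \<and> (\<forall>z\<in>set (tl c). \<exists>u. (u, z) \<in> E)) \<and>
    distinct (concat cs) \<and> set (concat cs) = W \<and> length cs + card E = card W"
  proof (rule chain_partition[OF _ E_W])
    show "finite W" using fin by (auto simp: W_def)
    show "less u v" if "(u, v) \<in> E" for u v
      using that f(2)[of "Inl u"] by (auto simp: E_def A_def L_def)
    show "u = u'" if "(u, v) \<in> E" "(u', v) \<in> E" for u u' v
      using that inj[of "Inl u" "Inl u'"] by (auto simp: E_def L_def)
  qed (use less in \<open>auto simp: E_def\<close>)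
  then obtain cs where cs: "\<And>c. c \<in> set cs \<Longrightarrow> sorted_wrt less c"
    "distinct (concat cs)" "set (concat cs) = W" "length cs + card E = card W" by blast
  \<comment> \<open>Every used element is entered exactly once, by a chain edge or from a dummy.
    Hence \<open>card B\<close> is the number of chains.\<close>
  have img: "f ` (Inl ` fst ` E \<union> Inr ` B) = (Inl ` W :: ('u + nat) set)"
  proof (intro equalityI subsetI)
    fix y assume "y \<in> f ` (Inl ` fst ` E \<union> Inr ` B)"
    then consider u v where "(u, v) \<in> E" "y = f (Inl u)" | i where "i \<in> B" "y = f (Inr i)" by auto
    then show "y \<in> Inl ` W"
    proof cases
      case 1
      then show ?thesis using E_W by (auto simp: E_def)
    next
      case 2
      then have "f (Inr i) \<in> L" "Inr i \<in> L" using bij_betwE[OF f(1)] by (auto simp: B_def L_def)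
      then obtain v where v: "f (Inr i) = Inl v" "v \<in> U" using 2 by (auto simp: B_def L_def)
      then have "f (Inl v) \<noteq> Inl v"
        using inj[of "Inr i" "Inl v"] \<open>Inr i \<in> L\<close> unfolding L_def by (metis InlI sum.distinct(1))
      then show ?thesis using 2 v by (auto simp: W_def)
    qed
  next
    fix y :: "'u + nat" assume "y \<in> Inl ` W"
    then obtain v where v: "y = Inl v" "v \<in> W" by auto
    then have "Inl v \<in> f ` L" using f(1) by (auto simp: bij_betw_def W_def L_def)
    then obtain x where x: "x \<in> L" "f x = Inl v" by auto
    show "y \<in> f ` (Inl ` fst ` E \<union> Inr ` B)"
    proof (cases x)
      case (Inl u)
      then have "(u, v) \<in> E" using x v by (auto simp: E_def W_def L_def)
      then show ?thesis using x v Inl by force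
    next
      case (Inr i)
      then have "i \<in> B" using x by (auto simp: B_def L_def)
      then show ?thesis using x(2) v(1) Inr by (auto intro!: image_eqI[of _ f "Inr i"])
    qed
  qed
  have "inj_on f (Inl ` fst ` E \<union> Inr ` B)"
  proof (rule inj_on_subset)
    show "inj_on f L" using f(1) by (simp add: bij_betw_def)
    show "Inl ` fst ` E \<union> Inr ` B \<subseteq> L" by (auto simp: L_def E_def B_def)
  qed
  from card_image[OF this]
  have "card (Inl ` W :: ('u + nat) set) = card (Inl ` fst ` E \<union> Inr ` B :: ('u + nat) set)"
    by (simp only: img)
  also have "\<dots> = card (fst ` E) + card B"
    using finE by (subst card_Un_disjoint) (auto simp: card_image B_def)
  also have "card (fst ` E) = card E"
    by (rule card_image) (auto simp: inj_on_def E_def)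
  finally have cardW: "card W = card E + card B" by (simp add: card_image)
  have E_sum: "(\<Sum>u\<in>U. w (Inl u) (f (Inl u))) = card E"
  proof -
    have "(\<Sum>u\<in>U. w (Inl u) (f (Inl u))) = (\<Sum>u\<in>U. of_bool (u \<in> fst ` E))"
    proof (rule sum.cong)
      fix u assume u: "u \<in> U"
      have "f (Inl u) \<in> L" using u bij_betwE[OF f(1)] by (auto simp: L_def)
      then show "w (Inl u) (f (Inl u)) = of_bool (u \<in> fst ` E)"
        using u by (auto simp: w_def E_def L_def image_iff)
    qed simp
    also have "\<dots> = card (fst ` E)" using fin
      by (simp add: Int_absorb1 subset_iff) (metis (no_types, lifting) E_def Int_absorb1 case_prodD fst_eqD
        image_subset_iff mem_Collect_eq prod.collapse)
    also have "card (fst ` E) = card E"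
      by (rule card_image) (auto simp: inj_on_def E_def)
    finally show ?thesis .
  qed
  have B_sum: "(\<Sum>i<card U. w (Inr i) (f (Inr i))) = (1 - int r) * card B"
  proof -
    have "w (Inr i) (f (Inr i)) = (1 - int r) * of_bool (f (Inr i) \<in> range Inl)" for i
      by (cases "f (Inr i)") (auto simp: w_def)
    then have "(\<Sum>i<card U. w (Inr i) (f (Inr i))) = (1 - int r) * (\<Sum>i<card U. of_bool (f (Inr i) \<in> range Inl))"
      by (simp add: sum_distrib_left)
    also have "(\<Sum>i<card U. of_bool (f (Inr i) \<in> range Inl)) = int (card B)"
      unfolding B_def by (simp add: Collect_conj_eq lessThan_def)
    finally show ?thesis .
  qed
  have len: "length cs = card B" using cs cardW by simp
  have "(\<Sum>c\<leftarrow>cs. int (length c) - int r) = int (length (concat cs)) - int r * length cs"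
    by (induction cs) (auto simp: algebra_simps)
  also have "length (concat cs) = card W" using cs by (metis distinct_card)
  finally have val: "(\<Sum>c\<leftarrow>cs. int (length c) - int r) = sum a L + sum b L"
    unfolding opt[symmetric] using sumL[of "\<lambda>x. w x (f x)"] E_sum B_sum
    by (simp add: cardW len algebra_simps)
  show thesis
  proof (cases "U = {}")
    case True
    then show ?thesis using that[of "{}" "[]"] by auto
  next
    case False
    define n where "n = card U"
    have n: "n > 0" using False fin by (auto simp: n_def card_gt_0_iff)
    \<comment> \<open>All dummies on one side have the same edges and weights, so the least
      potential among them gives the sharpest bounds for starts and ends of chains.\<close>
    define \<sigma> where "\<sigma> = Min ((\<lambda>i. a (Inr i)) ` {..<n})"
    define \<tau> where "\<tau> = Min ((\<lambda>i. b (Inr i)) ` {..<n})"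
    have "\<sigma> \<in> (\<lambda>i. a (Inr i)) ` {..<n}" "\<tau> \<in> (\<lambda>i. b (Inr i)) ` {..<n}"
      unfolding \<sigma>_def \<tau>_def using n by (intro Min_in; auto)+
    then obtain i j where ij: "i < n" "\<sigma> = a (Inr i)" "j < n" "\<tau> = b (Inr j)" by blast
    have "(\<Sum>i<n. \<sigma>) \<le> (\<Sum>i<n. a (Inr i))" "(\<Sum>i<n. \<tau>) \<le> (\<Sum>i<n. b (Inr i))"
      unfolding \<sigma>_def \<tau>_def by (intro sum_mono Min_le; auto)+
    then have dummies: "int n * (\<sigma> + \<tau>) \<le> (\<Sum>i<n. a (Inr i)) + (\<Sum>i<n. b (Inr i))"
      by (simp add: algebra_simps)
    have inL: "Inl u \<in> L" if "u \<in> U" for u using that by (auto simp: L_def)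
    have inR: "Inr k \<in> L" if "k < n" for k using that by (auto simp: L_def n_def)
    have ab0: "0 \<le> a (Inl u) + b (Inl u)" if "u \<in> U" for u
      using ab[of "Inl u" "Inl u"] that inL by (auto simp: A_def w_def)
    have ab1: "1 \<le> a (Inl u) + b (Inl v)" if "u \<in> U" "v \<in> U" "less u v" for u v
      using ab[of "Inl u" "Inl v"] that inL less(1) by (auto simp: A_def w_def split: if_splits)
    have ab2: "1 - int r \<le> \<sigma> + b (Inl u)" "0 \<le> a (Inl u) + \<tau>" if "u \<in> U" for u
      using ab[of "Inr i" "Inl u"] ab[of "Inl u" "Inr j"] that inL inR ij by (auto simp: A_def w_def)
    have st: "0 \<le> \<sigma> + \<tau>" using ab[of "Inr i" "Inr j"] inR ij by (auto simp: A_def w_def)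
    have val': "(\<Sum>u\<in>U. a (Inl u) + b (Inl u)) + int n * (\<sigma> + \<tau>) \<le> (\<Sum>c\<leftarrow>cs. int (length c) - int r)"
      unfolding val sumL using dummies by (simp add: sum.distrib n_def)
    \<comment> \<open>If \<open>\<sigma> + \<tau>\<close> is positive, the \<open>card U\<close>
      dummies alone force the value up to \<open>card U\<close>, and the empty set serves as
      \<open>X\<close>.\<close>
    show thesis
    proof (cases "\<sigma> + \<tau> = 0")
      case False
      have "int n * 1 \<le> int n * (\<sigma> + \<tau>)" using st False by (intro mult_left_mono) auto
      moreover have "0 \<le> (\<Sum>u\<in>U. a (Inl u) + b (Inl u))" by (intro sum_nonneg ab0)
      ultimately have "int n \<le> (\<Sum>c\<leftarrow>cs. int (length c) - int r)" using val' by linarith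
      then show ?thesis using that[of "{}" cs] cs by (auto simp: n_def W_def)
    next
      case True
      define X where "X = {u \<in> U. a (Inl u) + b (Inl u) = 0}"
      have "int (card (U - X)) = (\<Sum>u\<in>U - X. 1)" by simp
      also have "\<dots> \<le> (\<Sum>u\<in>U - X. a (Inl u) + b (Inl u))"
        using ab0 by (intro sum_mono) (force simp: X_def)
      also have "\<dots> \<le> (\<Sum>u\<in>U. a (Inl u) + b (Inl u))"
        using fin ab0 by (intro sum_mono2) auto
      finally have "int (card (U - X)) \<le> (\<Sum>c\<leftarrow>cs. int (length c) - int r)" using val' True by simp
      moreover have "length c \<le> r" if c: "set c \<subseteq> X" "sorted_wrt less c" for c
      proof (cases c)
        case (Cons u c')
        \<comment> \<open>On \<open>X\<close> the potentials are opposite, so \<open>a\<close> falls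
          by at least one per step, from at most \<open>r - 1 + \<sigma>\<close> at the bottom to at
          least \<open>- \<tau>\<close> at the top. With \<open>\<sigma> + \<tau> = 0\<close> this
          leaves room for \<open>r\<close> elements.\<close>
        have "int (length c') - \<tau> \<le> a (Inl u)" if "set (u # c') \<subseteq> X" "sorted_wrt less (u # c')" for u
          using that
        proof (induction c' arbitrary: u)
          case Nil
          then show ?case using ab2(2)[of u] by (auto simp: X_def)
        next
          case (Cons v c')
          have "int (length c') - \<tau> \<le> a (Inl v)" using Cons.prems by (intro Cons.IH) auto
          then show ?case using ab1[of u v] Cons.prems by (auto simp: X_def)
        qed
        from this[of u] have "int (length c') - \<tau> \<le> a (Inl u)" using c Cons by auto
        moreover have "1 - int r \<le> \<sigma> + b (Inl u)" "a (Inl u) + b (Inl u) = 0"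
          using c Cons ab2(1)[of u] by (auto simp: X_def)
        ultimately show ?thesis using True Cons by simp
      qed simp
      ultimately show ?thesis using that[of X cs] cs by (auto simp: X_def W_def)
    qed
  qed
qed

text \<open>An optimal family may overshoot \<open>s\<close> and may contain chains of length at
  most \<open>r\<close>. A chain is dropped if the later ones suffice without it; otherwise the
  prefix that supplies the missing amount is kept, and prefixes of chains are chains.\<close>

lemma trim_chain_family:
  assumes "int s \<le> (\<Sum>c\<leftarrow>cs. int (length c) - int r)"
  shows "\<exists>ds. (\<forall>c\<in>set ds. r < length c \<and> (\<exists>c'\<in>set cs. \<exists>n. c = take n c')) \<and>
    (\<forall>v. count_list (concat ds) v \<le> count_list (concat cs) v) \<and> (\<Sum>c\<leftarrow>ds. length c - r) = s"
  using assms
proof (induction cs arbitrary: s)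
  case (Cons c cs)
  consider "s = 0" | "int s \<le> (\<Sum>c\<leftarrow>cs. int (length c) - int r)"
    | "s > 0" "\<not> int s \<le> (\<Sum>c\<leftarrow>cs. int (length c) - int r)" by blast
  then show ?case
  proof cases
    case 1
    then show ?thesis by (intro exI[of _ "[]"]) auto
  next
    case 2
    then obtain ds where "(\<forall>c\<in>set ds. r < length c \<and> (\<exists>c'\<in>set cs. \<exists>n. c = take n c')) \<and>
      (\<forall>v. count_list (concat ds) v \<le> count_list (concat cs) v) \<and> (\<Sum>c\<leftarrow>ds. length c - r) = s"
      using Cons.IH by blast
    then show ?thesis by (intro exI[of _ ds]) (auto simp: trans_le_add2)
  next
    case 3
    let ?t = "\<Sum>c\<leftarrow>cs. int (length c) - int r"
    define t where "t = nat ?t"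
    obtain ds where ds: "(\<forall>c\<in>set ds. r < length c \<and> (\<exists>c'\<in>set cs. \<exists>n. c = take n c')) \<and>
      (\<forall>v. count_list (concat ds) v \<le> count_list (concat cs) v) \<and> (\<Sum>c\<leftarrow>ds. length c - r) = t"
      if "?t \<ge> 0"
    proof (cases "?t \<ge> 0")
      case True
      then have "int t \<le> ?t" by (simp add: t_def)
      from Cons.IH[OF this] show thesis using that by blast
    qed (use that in blast)
    \<comment> \<open>If the remaining chains have negative total, nothing is taken from them;
      \<open>nat\<close> makes \<open>t\<close> zero in that case.\<close>
    define es where "es = (if ?t \<ge> 0 then ds else [])"
    have es: "(\<forall>c\<in>set es. r < length c \<and> (\<exists>c'\<in>set cs. \<exists>n. c = take n c')) \<and>
      (\<forall>v. count_list (concat es) v \<le> count_list (concat cs) v) \<and> (\<Sum>c\<leftarrow>es. length c - r) = t"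
      using ds by (auto simp: es_def t_def)
    define k where "k = s - t"
    have k: "s = k + t" "0 < k" "r + k \<le> length c"
      using 3 Cons.prems by (auto simp: k_def t_def split: if_splits)
    have take_count: "count_list (take n c) v \<le> count_list c v" for n v
      by (metis append_take_drop_id count_list_append le_add1)
    show ?thesis
    proof (intro exI[of _ "take (r + k) c # es"] conjI allI)
      show "count_list (concat (take (r + k) c # es)) v \<le> count_list (concat (c # cs)) v" for v
        using es take_count[of "r + k" v] by (auto intro: add_mono)
    qed (use es k in auto)
  qed
qed (auto intro: exI[of _ "[]"])

text \<open>Weights are traded for copies: \<open>v\<close> is replaced by \<open>m v\<close>
  mutually incomparable copies, so that disjointness of chains upstairs becomes the multiplicity
  bound \<open>m\<close> downstairs.\<close>

theorem greene_kleitman: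
  fixes less :: "'v \<Rightarrow> 'v \<Rightarrow> bool" and m :: "'v \<Rightarrow> nat"
  assumes fin: "finite V"
    and less: "\<And>u. \<not> less u u" "\<And>u v z. less u v \<Longrightarrow> less v z \<Longrightarrow> less u z"
    and outside: "\<And>X. X \<subseteq> V \<Longrightarrow> (\<And>c. set c \<subseteq> X \<Longrightarrow> sorted_wrt less c \<Longrightarrow> length c \<le> r) \<Longrightarrow>
      s \<le> (\<Sum>v\<in>V - X. m v)"
  obtains cs where "\<And>c. c \<in> set cs \<Longrightarrow> sorted_wrt less c \<and> set c \<subseteq> V \<and> r < length c"
    "\<And>v. v \<in> V \<Longrightarrow> count_list (concat cs) v \<le> m v" "(\<Sum>c\<leftarrow>cs. length c - r) = s"
proof -
  define U where "U = Sigma V (\<lambda>v. {..<m v})"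
  define ls where "ls u v = less (fst u) (fst v)" for u v :: "'v \<times> nat"
  have finU: "finite U" using fin by (auto simp: U_def)
  obtain X cs where X: "X \<subseteq> U" "\<And>c. set c \<subseteq> X \<Longrightarrow> sorted_wrt ls c \<Longrightarrow> length c \<le> r"
    and cs: "\<And>c. c \<in> set cs \<Longrightarrow> sorted_wrt ls c" "distinct (concat cs)" "set (concat cs) \<subseteq> U"
    and val: "int (card (U - X)) \<le> (\<Sum>c\<leftarrow>cs. int (length c) - int r)"
    by (rule chain_family_duality[of U ls r, OF finU]) (use less in \<open>auto simp: ls_def\<close>)
  have "s \<le> (\<Sum>v\<in>V - fst ` X. m v)"
  proof (rule outside)
    show "fst ` X \<subseteq> V" using X by (auto simp: U_def)
    fix c assume c: "set c \<subseteq> fst ` X" "sorted_wrt less c"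
    \<comment> \<open>A chain in the projection lifts to a chain of copies in \<open>X\<close>, so
      the projection inherits the bound on lengths.\<close>
    define g where "g v = (SOME u. u \<in> X \<and> fst u = v)" for v
    have g: "g v \<in> X" "fst (g v) = v" if "v \<in> set c" for v
      using someI_ex[of "\<lambda>u. u \<in> X \<and> fst u = v"] that c unfolding g_def by blast+
    have "sorted_wrt ls (map g c)"
      unfolding sorted_wrt_map by (rule sorted_wrt_mono_rel[OF _ c(2)]) (simp add: ls_def g)
    then show "length c \<le> r" using X(2)[of "map g c"] g by auto
  qed
  also have "\<dots> = card (Sigma (V - fst ` X) (\<lambda>v. {..<m v}))" using fin by simp
  also have "\<dots> \<le> card (U - X)"
    using finU by (intro card_mono) (force simp: U_def)+
  finally have "int s \<le> (\<Sum>c\<leftarrow>map (map fst) cs. int (length c) - int r)"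
    using val by (simp add: o_def)
  from trim_chain_family[OF this] obtain ds where
    ds: "\<forall>c\<in>set ds. r < length c \<and> (\<exists>c'\<in>set (map (map fst) cs). \<exists>n. c = take n c')"
      "\<forall>v. count_list (concat ds) v \<le> count_list (concat (map (map fst) cs)) v"
      "(\<Sum>c\<leftarrow>ds. length c - r) = s" by blast
  show thesis
  proof (rule that[of ds])
    fix c assume "c \<in> set ds"
    then obtain c' n where c': "c' \<in> set cs" "c = take n (map fst c')" "r < length c" using ds by auto
    have "sorted_wrt less (map fst c')"
      using cs(1)[OF c'(1)] by (simp add: sorted_wrt_map ls_def[abs_def])
    moreover have "set (take n (map fst c')) \<subseteq> V"
    proof -
      have "set c' \<subseteq> U" using c'(1) cs(3) by auto
      then have "fst ` set c' \<subseteq> V" by (auto simp: U_def)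
      then show ?thesis using set_take_subset[of n "map fst c'"] by (metis set_map subset_trans)
    qed
    ultimately show "sorted_wrt less c \<and> set c \<subseteq> V \<and> r < length c"
      using c' sorted_wrt_take by auto
  next
    fix v
    have "count_list (concat (map (map fst) cs)) v = count_list (map fst (concat cs)) v"
      by (simp add: map_concat)
    also have "\<dots> = length (filter (\<lambda>u. fst u = v) (concat cs))"
      by (simp add: count_list_eq_length_filter filter_map o_def eq_commute)
    also have "\<dots> = card (set (filter (\<lambda>u. fst u = v) (concat cs)))"
      using cs(2) distinct_filter distinct_card by metis
    also have "\<dots> \<le> card ({v} \<times> {..<m v})"
      using cs(3) by (intro card_mono) (auto simp: U_def)
    finally show "count_list (concat ds) v \<le> m v"
      using ds(2) le_trans by fastforce
  qed (use ds in auto)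
qed

section \<open>Polynomials\<close>

lemma poly_mapping_sum_singles: "p = (\<Sum>m\<in>keys p. single m (lookup p m))"
proof (rule poly_mapping_eqI)
  fix k
  have "(\<Sum>m\<in>keys p. lookup (single m (lookup p m)) k) =
    (\<Sum>m\<in>keys p. if m = k then lookup p m else 0)"
    by (intro sum.cong) (auto simp: lookup_single when_def)
  also have "\<dots> = lookup p k" by (simp add: in_keys_iff)
  finally show "lookup p k =
    lookup (\<Sum>m\<in>keys p. single m (lookup p m)) k"
    by (simp add: lookup_sum)
qed

lemma poly_mapping_mult_singles:
  fixes p q :: "'t::monoid_add \<Rightarrow>\<^sub>0 'r::semiring_0"
  shows "p * q = (\<Sum>a\<in>keys p. \<Sum>b\<in>keys q.
    single (a + b) (lookup p a * lookup q b))"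
  by (subst poly_mapping_sum_singles[of p], subst poly_mapping_sum_singles[of q])
    (simp add: sum_product mult_single)

lemma lookup_mult_expand:
  fixes p q :: "'t::monoid_add \<Rightarrow>\<^sub>0 'r::semiring_0"
  shows "lookup (p * q) t =
    (\<Sum>(a, b)\<in>{(a, b) \<in> keys p \<times> keys q. a + b = t}.
      lookup p a * lookup q b)"
proof -
  have "lookup (p * q) t = (\<Sum>(a, b)\<in>keys p \<times> keys q.
      if a + b = t then lookup p a * lookup q b else 0)"
    by (subst poly_mapping_mult_singles)
      (simp add: lookup_sum lookup_single when_def sum.cartesian_product case_prod_beta)
  also have "\<dots> = (\<Sum>ab\<in>{ab \<in> keys p \<times> keys q. fst ab + snd ab = t}.
      lookup p (fst ab) * lookup q (snd ab))"
    by (subst sum.inter_filter) (auto simp: case_prod_beta)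
  also have "{ab \<in> keys p \<times> keys q. fst ab + snd ab = t} =
      {(a, b) \<in> keys p \<times> keys q. a + b = t}"
    by auto
  finally show ?thesis by (simp add: case_prod_beta)
qed

lemma lookup_single_times:
  fixes p :: "'t::cancel_comm_monoid_add \<Rightarrow>\<^sub>0 'r::semiring_1"
  shows "lookup (single a 1 * p) (a + t) = lookup p t"
proof (cases "(1::'r) = 0")
  case True
  then show ?thesis by (metis mult_1 mult_zero_left)
next
  case False
  have "{(a', b) \<in> keys (single a (1::'r)) \<times> keys p. a' + b = a + t} =
      (if t \<in> keys p then {(a, t)} else {})"
    using False by auto
  then show ?thesis unfolding lookup_mult_expand by (auto simp: in_keys_iff)
qed

lemma lookup_single_0_times:
  fixes p :: "'t::monoid_add \<Rightarrow>\<^sub>0 'r::semiring_0"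
  shows "lookup (single 0 c * p) t = c * lookup p t"
proof (cases "c = 0")
  case False
  have "{(a, b) \<in> keys (single (0::'t) c) \<times> keys p. a + b = t} =
      (if t \<in> keys p then {(0, t)} else {})"
    using False by auto
  then show ?thesis unfolding lookup_mult_expand by (auto simp: in_keys_iff)
qed simp

lemma lookup_single_times_keys:
  fixes p :: "'t::monoid_add \<Rightarrow>\<^sub>0 'r::semiring_1"
  assumes "lookup (single a 1 * p) t \<noteq> 0"
  obtains s where "t = a + s" "s \<in> keys p"
  using assms keys_mult[of "single a (1::'r)" p]
  by (auto simp: in_keys_iff[symmetric] simp del: in_keys_iff split: if_splits)

section \<open>Degrees of monomials and induction on monomials\<close>

definition pmdegree :: "'v pmonom \<Rightarrow> nat" where
  "pmdegree m = (\<Sum>v\<in>keys m. lookup m v)"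

lemma pmdegree_superset:
  "finite S \<Longrightarrow> keys m \<subseteq> S \<Longrightarrow> pmdegree m = (\<Sum>v\<in>S. lookup m v)"
  unfolding pmdegree_def by (rule sum.mono_neutral_left) (auto simp: in_keys_iff)

lemma keys_add_nat: "keys (m + n) = keys m \<union> keys (n :: 'v pmonom)"
  by (auto simp: in_keys_iff lookup_add)

lemma pmdegree_add: "pmdegree (m + n) = pmdegree m + pmdegree n"
proof -
  let ?S = "keys m \<union> keys n"
  have "pmdegree (m + n) = (\<Sum>v\<in>?S. lookup (m + n) v)"
    by (intro pmdegree_superset) (auto simp: keys_add_nat)
  then show ?thesis
    using pmdegree_superset[of ?S m] pmdegree_superset[of ?S n] by (simp add: lookup_add sum.distrib)
qed

lemma pmdegree_zero [simp]: "pmdegree 0 = 0"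
  by (simp add: pmdegree_def)

lemma pmdegree_single [simp]: "pmdegree (single v n) = n"
  by (simp add: pmdegree_def)

lemma pmdegree_eq_0_iff: "pmdegree m = 0 \<longleftrightarrow> m = 0"
  by (auto simp: pmdegree_def in_keys_iff intro!: poly_mapping_eqI)

definition pmono :: "'v pmonom \<Rightarrow> ('v, 'k::comm_ring_1) mpoly" where
  "pmono m = single m 1"

lemma pmono_add: "pmono (m + n) = pmono m * pmono n"
  by (simp add: pmono_def mult_single)

lemma pmono_zero [simp]: "pmono 0 = 1"
  by (simp add: pmono_def)

lemma keys_pmono [simp]: "keys (pmono m :: ('v, 'k::{comm_ring_1}) mpoly) = {m}"
  by (simp add: pmono_def)

lemma Var_pmono: "Var v = pmono (single v 1)"
  by (simp add: Var_def pmono_def)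

lemma Const_times_pmono: "Const c * pmono m = single m c"
  by (simp add: Const_def pmono_def mult_single)

lemma lookup_Const_times: "lookup (Const c * p) m = c * lookup p m"
  unfolding Const_def by (rule lookup_single_0_times)

lemma Const_add: "Const (a + b) = Const a + Const b"
  by (simp add: Const_def single_add)

lemma Const_mult: "Const (a * b) = Const a * Const b"
  by (simp add: Const_def mult_single)

lemma Const_simps [simp]: "Const 0 = 0" "Const 1 = 1"
  by (simp_all add: Const_def)

lemma mpoly_sum_monomials: "p = (\<Sum>m\<in>keys p. Const (lookup p m) * pmono m)"
  using poly_mapping_sum_singles[of p] by (simp add: Const_times_pmono)

lemma pmonom_induct [consumes 1, case_names zero add]:
  assumes "m \<in> monoms_in V" "P 0"
    and "\<And>v m. v \<in> V \<Longrightarrow> m \<in> monoms_in V \<Longrightarrow> P m \<Longrightarrow> P (single v 1 + m)"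
  shows "P m"
  using assms(1)
proof (induction "pmdegree m" arbitrary: m)
  case 0
  then show ?case using assms(2) pmdegree_eq_0_iff[of m] by simp
next
  case (Suc n)
  then have "m \<noteq> 0" by auto
  then obtain v where v: "v \<in> keys m" using keys_eq_empty by blast
  define m' where "m' = m - single v 1"
  have m: "m = single v 1 + m'"
    using v by (intro poly_mapping_eqI) (auto simp: m'_def lookup_add lookup_minus lookup_single when_def in_keys_iff)
  moreover have "n = pmdegree m'"
    using Suc.hyps(2) unfolding m by (simp add: pmdegree_add)
  moreover have "m' \<in> monoms_in V" "v \<in> V"
    using Suc.prems v unfolding m by (auto simp: monoms_in_def keys_add_nat)
  ultimately show ?case using assms(3)[of v m'] Suc.hyps(1) by simp
qed

section \<open>The ring of polynomials in given variables\<close>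

lemma in_poly_ring: "p \<in> carrier (poly_ring V) \<longleftrightarrow> keys p \<subseteq> monoms_in V"
  by (simp add: poly_ring_def)

lemma poly_ring_ops [simp]:
  "x \<otimes>\<^bsub>poly_ring V\<^esub> y = x * y" "x \<oplus>\<^bsub>poly_ring V\<^esub> y = x + y"
  "\<one>\<^bsub>poly_ring V\<^esub> = 1" "\<zero>\<^bsub>poly_ring V\<^esub> = 0"
  by (simp_all add: poly_ring_def)

lemma poly_ring_closed:
  fixes p q :: "('a, 'b::comm_ring_1) mpoly"
  shows
  "p \<in> carrier (poly_ring V) \<Longrightarrow> q \<in> carrier (poly_ring V) \<Longrightarrow> p * q \<in> carrier (poly_ring V)"
  "p \<in> carrier (poly_ring V) \<Longrightarrow> q \<in> carrier (poly_ring V) \<Longrightarrow> p + q \<in> carrier (poly_ring V)"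
  "p \<in> carrier (poly_ring V) \<Longrightarrow> q \<in> carrier (poly_ring V) \<Longrightarrow> p - q \<in> carrier (poly_ring V)"
  "p \<in> carrier (poly_ring V) \<Longrightarrow> - p \<in> carrier (poly_ring V)"
  "1 \<in> carrier (poly_ring V :: ('a, 'b) mpoly ring)"
  "0 \<in> carrier (poly_ring V :: ('a, 'b) mpoly ring)"
  "Const c \<in> carrier (poly_ring V :: ('a, 'b) mpoly ring)"
  "m \<in> monoms_in V \<Longrightarrow> pmono m \<in> carrier (poly_ring V :: ('a, 'b) mpoly ring)"
  "v \<in> V \<Longrightarrow> Var v \<in> carrier (poly_ring V :: ('a, 'b) mpoly ring)"
proof -
  interpret cring "poly_ring V :: ('a, 'b) mpoly ring" by (rule cring_poly_ring)
  show mult: "p * q \<in> carrier (poly_ring V)"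
    if "p \<in> carrier (poly_ring V)" "q \<in> carrier (poly_ring V)" for p q :: "('a, 'b) mpoly"
    using m_closed[OF that] by simp
  show add: "p + q \<in> carrier (poly_ring V)"
    if "p \<in> carrier (poly_ring V)" "q \<in> carrier (poly_ring V)" for p q :: "('a, 'b) mpoly"
    using a_closed[OF that] by simp
  show "1 \<in> carrier (poly_ring V :: ('a, 'b) mpoly ring)" "0 \<in> carrier (poly_ring V :: ('a, 'b) mpoly ring)"
    using one_closed zero_closed by simp_all
  show uminus: "- p \<in> carrier (poly_ring V)" if "p \<in> carrier (poly_ring V)" for p :: "('a, 'b) mpoly"
    using that by (simp add: in_poly_ring)
  show "p - q \<in> carrier (poly_ring V)"
    if "p \<in> carrier (poly_ring V)" "q \<in> carrier (poly_ring V)" for p q :: "('a, 'b) mpoly"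
    using add[OF that(1) uminus[OF that(2)]] by simp
qed (auto simp: in_poly_ring Const_def monoms_in_def Var_def)

lemma poly_ring_sum:
  "(\<And>x. x \<in> A \<Longrightarrow> f x \<in> carrier (poly_ring V)) \<Longrightarrow> sum f A \<in> carrier (poly_ring V)"
  by (induction A rule: infinite_finite_induct) (auto intro: poly_ring_closed)

lemma poly_ring_prod:
  "(\<And>x. x \<in> A \<Longrightarrow> f x \<in> carrier (poly_ring V)) \<Longrightarrow> prod f A \<in> carrier (poly_ring V)"
  by (induction A rule: infinite_finite_induct) (auto intro: poly_ring_closed)

lemma mpoly_induct [consumes 1, case_names const add var]:
  assumes "p \<in> carrier (poly_ring V)"
    and "\<And>c. P (Const c)" "\<And>p q. p \<in> carrier (poly_ring V) \<Longrightarrow> q \<in> carrier (poly_ring V) \<Longrightarrow> P p \<Longrightarrow> P q \<Longrightarrow> P (p + q)"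
    and "\<And>v p. v \<in> V \<Longrightarrow> p \<in> carrier (poly_ring V) \<Longrightarrow> P p \<Longrightarrow> P (Var v * p)"
  shows "P p"
proof -
  have mono: "Const c * pmono m \<in> carrier (poly_ring V) \<and> P (Const c * pmono m)" if "m \<in> monoms_in V" for c m
    using that
  proof (induction rule: pmonom_induct)
    case zero
    then show ?case using assms(2) by (simp add: poly_ring_closed)
  next
    case (add v m)
    then show ?case
      using assms(4)[of v "Const c * pmono m"] poly_ring_closed(1)[OF poly_ring_closed(9)[of v V], of "Const c * pmono m"]
      unfolding pmono_add Var_pmono[symmetric] by (simp add: mult.left_commute)
  qed
  have "(\<Sum>m\<in>A. Const (lookup p m) * pmono m) \<in> carrier (poly_ring V) \<and>
      P (\<Sum>m\<in>A. Const (lookup p m) * pmono m)" if "finite A" "A \<subseteq> monoms_in V" for A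
    using that
  proof (induction A)
    case empty
    then show ?case using assms(2)[of 0] by (simp add: poly_ring_closed)
  next
    case (insert m A)
    then show ?case using mono[of m "lookup p m"] assms(3) by (auto intro: poly_ring_closed)
  qed
  from this[of "keys p"] show ?thesis
    using assms(1) mpoly_sum_monomials[of p] by (simp add: in_poly_ring)
qed

lemma in_poly_ring_UNIV: "p \<in> carrier (poly_ring UNIV)"
  by (simp add: in_poly_ring monoms_in_def)

section \<open>Evaluation homomorphisms\<close>

definition pmeval :: "('v \<Rightarrow> 'r::comm_monoid_mult) \<Rightarrow> 'v pmonom \<Rightarrow> 'r" where
  "pmeval \<sigma> m = (\<Prod>v\<in>keys m. \<sigma> v ^ lookup m v)"

lemma pmeval_superset:
  "finite S \<Longrightarrow> keys m \<subseteq> S \<Longrightarrow> pmeval \<sigma> m = (\<Prod>v\<in>S. \<sigma> v ^ lookup m v)"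
  unfolding pmeval_def by (rule prod.mono_neutral_left) (auto simp: in_keys_iff)

lemma pmeval_add: "pmeval \<sigma> (m + n) = pmeval \<sigma> m * pmeval \<sigma> n"
proof -
  let ?S = "keys m \<union> keys n"
  have "pmeval \<sigma> (m + n) = (\<Prod>v\<in>?S. \<sigma> v ^ lookup (m + n) v)"
    by (intro pmeval_superset) (auto simp: keys_add_nat)
  then show ?thesis
    using pmeval_superset[of ?S m \<sigma>] pmeval_superset[of ?S n \<sigma>]
    by (simp add: lookup_add power_add prod.distrib)
qed

lemma pmeval_zero [simp]: "pmeval \<sigma> 0 = 1"
  by (simp add: pmeval_def)

lemma pmeval_single [simp]: "pmeval \<sigma> (single v 1) = \<sigma> v"
  by (simp add: pmeval_def)

text \<open>The coefficient map is a parameter because three kinds of substitution are needed: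
  \<open>subst_poly\<close>, the expansion at an orbit point, and the specialization of joins, the
  latter two with values in polynomials over polynomials.\<close>

definition mpeval :: "('k::comm_ring_1 \<Rightarrow> 'r::comm_ring_1) \<Rightarrow> ('v \<Rightarrow> 'r) \<Rightarrow> ('v, 'k) mpoly \<Rightarrow> 'r" where
  "mpeval c \<sigma> p = (\<Sum>m\<in>keys p. c (lookup p m) * pmeval \<sigma> m)"

locale coeff_map =
  fixes c :: "'k::comm_ring_1 \<Rightarrow> 'r::comm_ring_1"
  assumes c_add: "c (a + b) = c a + c b" and c_mult: "c (a * b) = c a * c b" and c_one: "c 1 = 1"
begin

lemma c_zero [simp]: "c 0 = 0"
  using c_add[of 0 0] by simp

lemma mpeval_superset:
  "finite S \<Longrightarrow> keys p \<subseteq> S \<Longrightarrow>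
    mpeval c \<sigma> p = (\<Sum>m\<in>S. c (lookup p m) * pmeval \<sigma> m)"
  unfolding mpeval_def by (rule sum.mono_neutral_left) (auto simp: in_keys_iff)

lemma mpeval_add: "mpeval c \<sigma> (p + q) = mpeval c \<sigma> p + mpeval c \<sigma> q"
proof -
  let ?S = "keys p \<union> keys q"
  have "mpeval c \<sigma> (p + q) = (\<Sum>m\<in>?S. c (lookup (p + q) m) * pmeval \<sigma> m)"
    using keys_add[of p q] by (intro mpeval_superset) auto
  then show ?thesis
    using mpeval_superset[of ?S p \<sigma>] mpeval_superset[of ?S q \<sigma>]
    by (simp add: lookup_add c_add distrib_right sum.distrib)
qed

lemma mpeval_zero [simp]: "mpeval c \<sigma> 0 = 0"
  by (simp add: mpeval_def)

lemma mpeval_sum: "mpeval c \<sigma> (sum f A) = (\<Sum>x\<in>A. mpeval c \<sigma> (f x))"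
  by (induction A rule: infinite_finite_induct) (auto simp: mpeval_add)

lemma mpeval_uminus: "mpeval c \<sigma> (- p) = - mpeval c \<sigma> p"
  using mpeval_add[of \<sigma> p "- p"] by (simp add: eq_neg_iff_add_eq_0 add.commute)

lemma mpeval_diff: "mpeval c \<sigma> (p - q) = mpeval c \<sigma> p - mpeval c \<sigma> q"
  using mpeval_add[of \<sigma> p "- q"] by (simp add: mpeval_uminus)

lemma mpeval_monomial: "mpeval c \<sigma> (single m a) = c a * pmeval \<sigma> m"
  by (cases "a = 0") (auto simp: mpeval_def)

lemma mpeval_pmono: "mpeval c \<sigma> (pmono m) = pmeval \<sigma> m"
  by (simp add: pmono_def mpeval_monomial c_one)

lemma mpeval_Const [simp]: "mpeval c \<sigma> (Const a) = c a"
  by (simp add: Const_def mpeval_monomial)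

lemma mpeval_Var [simp]: "mpeval c \<sigma> (Var v) = \<sigma> v"
  by (simp add: Var_pmono mpeval_pmono del: One_nat_def)

lemma mpeval_mult: "mpeval c \<sigma> (p * q) = mpeval c \<sigma> p * mpeval c \<sigma> q"
proof -
  have "mpeval c \<sigma> (p * q) = (\<Sum>a\<in>keys p. \<Sum>b\<in>keys q.
      (c (lookup p a) * pmeval \<sigma> a) * (c (lookup q b) * pmeval \<sigma> b))"
    unfolding poly_mapping_mult_singles mpeval_sum mpeval_monomial pmeval_add c_mult
    by (simp add: ac_simps)
  then show ?thesis by (simp add: mpeval_def sum_product)
qed

lemma mpeval_one [simp]: "mpeval c \<sigma> 1 = 1"
  using mpeval_Const[of \<sigma> 1] by (simp add: c_one)

end

interpretation Const: coeff_map Const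
  by standard (simp_all add: Const_add Const_mult)

lemma subst_poly_mpeval: "subst_poly \<sigma> p = mpeval Const \<sigma> p"
  by (simp add: subst_poly_def mpeval_def pmeval_def)

lemma subst_poly_closed:
  assumes "p \<in> carrier (poly_ring V)" "\<And>v. v \<in> V \<Longrightarrow> \<sigma> v \<in> carrier (poly_ring W)"
  shows "subst_poly \<sigma> p \<in> carrier (poly_ring W)"
  unfolding subst_poly_mpeval using assms(1)
  by (induction rule: mpoly_induct) (auto simp: Const.mpeval_add Const.mpeval_mult intro: poly_ring_closed assms(2))

section \<open>Ideals of polynomial rings\<close>

lemma ideal_poly_ringI:
  assumes "I \<subseteq> carrier (poly_ring V)" "0 \<in> I" "\<And>p q. p \<in> I \<Longrightarrow> q \<in> I \<Longrightarrow> p + q \<in> I"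
    and mult: "\<And>p q. p \<in> I \<Longrightarrow> q \<in> carrier (poly_ring V) \<Longrightarrow> q * p \<in> I"
  shows "ideal I (poly_ring V :: ('v, 'k::comm_ring_1) mpoly ring)"
proof -
  interpret cring "poly_ring V :: ('v, 'k) mpoly ring" by (rule cring_poly_ring)
  show ?thesis
  proof (rule idealI[OF ring_axioms])
    show "subgroup I (add_monoid (poly_ring V))"
    proof (rule add.subgroupI)
      show "\<ominus>\<^bsub>poly_ring V\<^esub> p \<in> I" if p: "p \<in> I" for p
      proof -
        have "- p \<oplus>\<^bsub>poly_ring V\<^esub> p = \<zero>\<^bsub>poly_ring V\<^esub>" by simp
        moreover have "p \<in> carrier (poly_ring V)" using p assms(1) by blast
        ultimately have "\<ominus>\<^bsub>poly_ring V\<^esub> p = - p"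
          by (intro minus_equality poly_ring_closed(4)) auto
        then show ?thesis
          using mult[OF p, OF poly_ring_closed(4)[OF poly_ring_closed(5)]] by simp
      qed
      show "I \<noteq> {}" using assms(2) by blast
      show "p \<oplus>\<^bsub>poly_ring V\<^esub> q \<in> I" if "p \<in> I" "q \<in> I" for p q
        using assms(3)[OF that] by simp
    qed (rule assms(1))
    fix p q assume pq: "p \<in> I" "q \<in> carrier (poly_ring V :: ('v, 'k) mpoly ring)"
    show "q \<otimes>\<^bsub>poly_ring V\<^esub> p \<in> I" using mult[OF pq] by simp
    then show "p \<otimes>\<^bsub>poly_ring V\<^esub> q \<in> I" by (simp add: mult.commute)
  qed
qed

lemma ideal_poly_ringD:
  assumes "ideal I (poly_ring V :: ('v, 'k::comm_ring_1) mpoly ring)"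
  shows "I \<subseteq> carrier (poly_ring V)" "0 \<in> I" "\<And>p q. p \<in> I \<Longrightarrow> q \<in> I \<Longrightarrow> p + q \<in> I"
    "\<And>p q. p \<in> I \<Longrightarrow> q \<in> carrier (poly_ring V) \<Longrightarrow> q * p \<in> I"
    "\<And>p q. p \<in> I \<Longrightarrow> q \<in> I \<Longrightarrow> p - q \<in> I" "\<And>p. p \<in> I \<Longrightarrow> - p \<in> I"
proof -
  interpret ideal I "poly_ring V :: ('v, 'k) mpoly ring" by fact
  show sub: "I \<subseteq> carrier (poly_ring V)" using a_subset .
  show zero: "0 \<in> I" using additive_subgroup.zero_closed[OF is_additive_subgroup] by simp
  show add: "p + q \<in> I" if "p \<in> I" "q \<in> I" for p q
    using additive_subgroup.a_closed[OF is_additive_subgroup that] by simp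
  show mult: "q * p \<in> I" if "p \<in> I" "q \<in> carrier (poly_ring V)" for p q
    using I_l_closed[OF that] by simp
  show uminus: "- p \<in> I" if "p \<in> I" for p
    using mult[OF that, of "- 1"] by (auto intro: poly_ring_closed)
  show "p - q \<in> I" if "p \<in> I" "q \<in> I" for p q
    using add[OF that(1) uminus[OF that(2)]] by simp
qed

lemma ideal_poly_ring_sum:
  assumes "ideal I (poly_ring V :: ('v, 'k::comm_ring_1) mpoly ring)" "\<And>x. x \<in> A \<Longrightarrow> f x \<in> I"
  shows "sum f A \<in> I"
  using assms(2) by (induction A rule: infinite_finite_induct) (auto intro: ideal_poly_ringD[OF assms(1)])

lemma genideal_poly_ring:
  fixes S :: "('v, 'k::comm_ring_1) mpoly set"
  assumes "S \<subseteq> carrier (poly_ring V)"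
  shows "ideal (genideal (poly_ring V) S) (poly_ring V)" "S \<subseteq> genideal (poly_ring V) S"
    "\<And>I. ideal I (poly_ring V) \<Longrightarrow> S \<subseteq> I \<Longrightarrow> genideal (poly_ring V) S \<subseteq> I"
proof -
  interpret cring "poly_ring V :: ('v, 'k) mpoly ring" by (rule cring_poly_ring)
  show "ideal (genideal (poly_ring V) S) (poly_ring V)" "S \<subseteq> genideal (poly_ring V) S"
    "\<And>I. ideal I (poly_ring V) \<Longrightarrow> S \<subseteq> I \<Longrightarrow> genideal (poly_ring V) S \<subseteq> I"
    using genideal_ideal[OF assms] genideal_self[OF assms] genideal_minimal by auto
qed

section \<open>Vanishing along the secant cones of a torus orbit\<close>

text \<open>\<open>vanishing r s\<close> below consists of the polynomials that vanish to order \<open>s\<close> at sums of \<open>r\<close> generic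
  points of the orbit \<open>x\<^sub>v = X ^ phi v\<close>; one such point is added to the argument by \<open>expand\<close>, and \<open>hasse t\<close> is
  the coefficient of \<open>X ^ t\<close>.\<close>

locale grading =
  fixes phi :: "'v \<Rightarrow> 't::{ordered_cancel_comm_monoid_add, cancel_comm_monoid_add, linorder}"
begin

text \<open>The exponent of the image of a monomial under the torus parametrization. Multiples are
  iterated sums because the exponents form an arbitrary ordered monoid.\<close>

definition gr :: "'v pmonom \<Rightarrow> 't" where
  "gr m = (\<Sum>v\<in>keys m. \<Sum>i<lookup m v. phi v)"

lemma gr_superset:
  "finite S \<Longrightarrow> keys m \<subseteq> S \<Longrightarrow> gr m = (\<Sum>v\<in>S. \<Sum>i<lookup m v. phi v)"
  unfolding gr_def by (rule sum.mono_neutral_left) (auto simp: in_keys_iff)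

lemma sum_replicate_add: "(\<Sum>i<(a + b :: nat). x :: 't) = (\<Sum>i<a. x) + (\<Sum>i<b. x)"
  by (induction b) (auto simp: ac_simps)

lemma gr_add: "gr (m + n) = gr m + gr n"
proof -
  let ?S = "keys m \<union> keys n"
  have "gr (m + n) = (\<Sum>v\<in>?S. \<Sum>i<lookup (m + n) v. phi v)"
    by (intro gr_superset) (auto simp: keys_add_nat)
  then show ?thesis
    using gr_superset[of ?S m] gr_superset[of ?S n] by (simp add: lookup_add sum_replicate_add sum.distrib)
qed

lemma gr_zero [simp]: "gr 0 = 0"
  by (simp add: gr_def)

lemma gr_single [simp]: "gr (single v 1) = phi v"
  by (simp add: gr_def)

section \<open>Expansion at an orbit point and its coefficients\<close>

definition expand :: "('v, 'k::comm_ring_1) mpoly \<Rightarrow> 't \<Rightarrow>\<^sub>0 ('v, 'k) mpoly" where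
  "expand = mpeval (\<lambda>c. single 0 (Const c))
    (\<lambda>v. single 0 (Var v) + single (phi v) 1)"

definition hasse :: "'t \<Rightarrow> ('v, 'k::comm_ring_1) mpoly \<Rightarrow> ('v, 'k) mpoly" where
  "hasse t p = lookup (expand p) t"

lemma coeff_map_constant: "coeff_map (\<lambda>c. single (0::'t) (Const c :: ('w, 'k::comm_ring_1) mpoly))"
  by standard (simp_all add: Const_add Const_mult single_add mult_single)

lemma expand_simps:
  fixes p q :: "('v, 'k::comm_ring_1) mpoly" and c :: 'k and f :: "'a \<Rightarrow> ('v, 'k) mpoly"
  shows "expand (p + q) = expand p + expand q" "expand (p * q) = expand p * expand q"
  "expand (Const c) = single 0 (Const c :: ('v, 'k) mpoly)"
  "expand (Var v) = single 0 (Var v) + single (phi v) (1 :: ('v, 'k) mpoly)"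
  "expand (sum f A) = (\<Sum>x\<in>A. expand (f x))"
  "expand 0 = (0 :: 't \<Rightarrow>\<^sub>0 ('v, 'k) mpoly)" "expand 1 = (1 :: 't \<Rightarrow>\<^sub>0 ('v, 'k) mpoly)"
proof -
  interpret coeff_map "\<lambda>c. single (0::'t) (Const c :: ('v, 'k) mpoly)"
    by (rule coeff_map_constant)
  show "expand (p + q) = expand p + expand q" "expand (p * q) = expand p * expand q"
    "expand (Const c) = single 0 (Const c :: ('v, 'k) mpoly)"
    "expand (Var v) = single 0 (Var v) + single (phi v) (1 :: ('v, 'k) mpoly)"
    "expand (sum f A) = (\<Sum>x\<in>A. expand (f x) :: 't \<Rightarrow>\<^sub>0 ('v, 'k) mpoly)"
    "expand 0 = (0 :: 't \<Rightarrow>\<^sub>0 ('v, 'k) mpoly)" "expand 1 = (1 :: 't \<Rightarrow>\<^sub>0 ('v, 'k) mpoly)"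
    unfolding expand_def by (simp_all add: mpeval_add mpeval_mult mpeval_sum)
qed

lemma hasse_add: "hasse t (p + q) = hasse t p + hasse t q"
  by (simp add: hasse_def expand_simps lookup_add)

lemma hasse_zero [simp]: "hasse t 0 = 0"
  by (simp add: hasse_def expand_simps)

lemma hasse_sum: "hasse t (sum f A) = (\<Sum>x\<in>A. hasse t (f x))"
  by (simp add: hasse_def expand_simps lookup_sum)

lemma hasse_Const_times: "hasse t (Const c * p) = Const c * hasse t p"
  by (simp add: hasse_def expand_simps expand_simps lookup_single_0_times)

lemma hasse_Const: "hasse t (Const c) = (if t = 0 then Const c else 0)"
  by (simp add: hasse_def expand_simps lookup_single when_def)

lemma hasse_Var_times:
  "hasse t (Var v * p) = Var v * hasse t p + lookup (single (phi v) 1 * expand p) t"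
  by (simp add: hasse_def expand_simps expand_simps distrib_right lookup_add lookup_single_0_times)

lemma hasse_shift: "lookup (single (phi v) 1 * expand p) (phi v + t) = hasse t p"
  by (simp add: hasse_def lookup_single_times)

text \<open>Exponents cannot be subtracted. Either \<open>t\<close> is a shift of some
  \<open>s\<close>, which then gives the coefficient, or the coefficient vanishes together with
  every \<open>hasse s p\<close> that could give it.\<close>

lemma hasse_shift_cases:
  obtains "lookup (single (phi v) 1 * expand p) t = 0" "\<And>s. t = phi v + s \<Longrightarrow> hasse s p = 0"
  | s where "t = phi v + s" "lookup (single (phi v) 1 * expand p) t = hasse s p"
proof (cases "lookup (single (phi v) 1 * expand p) t = 0")
  case True
  then show thesis using that(1) hasse_shift[of v p] by metis
next
  case False
  then show thesis using that(2) hasse_shift[of v p] lookup_single_times_keys[OF False] by metis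
qed

lemma hasse_closed:
  assumes "p \<in> carrier (poly_ring V)"
  shows "hasse t p \<in> carrier (poly_ring V)"
  using assms
proof (induction arbitrary: t rule: mpoly_induct)
  case (const c)
  then show ?case by (auto simp: hasse_Const intro: poly_ring_closed)
next
  case (add p q)
  then show ?case by (auto simp: hasse_add intro: poly_ring_closed)
next
  case (var v p)
  show ?case
    unfolding hasse_Var_times
    by (cases rule: hasse_shift_cases[where v = v and p = p and t = t]) (use var in \<open>auto intro!: poly_ring_closed\<close>)
qed

text \<open>Supplies, for every exponent of an expansion, a monomial of that degree; the join
  argument lifts exponents back to such monomials.\<close>

lemma keys_expand:
  assumes "p \<in> carrier (poly_ring V)" "hasse t p \<noteq> 0"
  obtains m where "m \<in> monoms_in V" "gr m = t"
proof -
  have "\<forall>t. hasse t p \<noteq> 0 \<longrightarrow> (\<exists>m\<in>monoms_in V. gr m = t)"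
    using assms(1)
  proof (induction rule: mpoly_induct)
    case (const c)
    then show ?case by (auto simp: hasse_Const monoms_in_def intro!: exI[of _ 0])
  next
    case (add p q)
    then show ?case by (metis hasse_add add_0)
  next
    case (var v p)
    show ?case
    proof (intro allI impI)
      fix t assume t: "hasse t (Var v * p) \<noteq> 0"
      show "\<exists>m\<in>monoms_in V. gr m = t"
      proof (cases rule: hasse_shift_cases[where v = v and p = p and t = t])
        case 1
        then have "hasse t p \<noteq> 0" using t by (metis hasse_Var_times add_0_right mult_zero_right)
        then show ?thesis using var.IH by blast
      next
        case (2 s)
        show ?thesis
        proof (cases "hasse s p = 0")
          case True
          then have "hasse t p \<noteq> 0" using t 2 by (metis hasse_Var_times add_0_right mult_zero_right)
          then show ?thesis using var.IH by blast
        next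
          case False
          then obtain m where "m \<in> monoms_in V" "gr m = s" using var.IH by blast
          then show ?thesis using 2 var.hyps
            by (intro bexI[of _ "single v 1 + m"])
              (auto simp: gr_add monoms_in_def keys_add_nat simp del: One_nat_def)
        qed
      qed
    qed
  qed
  then show thesis using assms(2) that by blast
qed

text \<open>Multiplying out chooses, in each factor of \<open>m\<close>, the variable or the orbit
  coordinate; \<open>n\<close> collects the factors of the second kind.\<close>

lemma keys_hasse_pmono:
  fixes m :: "'v pmonom"
  assumes "k \<in> keys (hasse t (pmono m :: ('v, 'k::comm_ring_1) mpoly))"
  obtains n where "k + n = m" "gr n = t"
proof -
  have "m \<in> monoms_in UNIV" by (simp add: monoms_in_def)
  then have "\<forall>t. k \<in> keys (hasse t (pmono m :: ('v, 'k) mpoly)) \<longrightarrow> (\<exists>n. k + n = m \<and> gr n = t)"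
  proof (induction arbitrary: k rule: pmonom_induct)
    case zero
    have "(pmono 0 :: ('v, 'k) mpoly) = Const 1" by simp
    then show ?case unfolding \<open>(pmono 0 :: ('v, 'k) mpoly) = Const 1\<close> hasse_Const by auto
  next
    case (add v m)
    show ?case
    proof (intro allI impI)
      fix t assume "k \<in> keys (hasse t (pmono (single v 1 + m) :: ('v, 'k) mpoly))"
      then have "k \<in> keys (Var v * hasse t (pmono m) :: ('v, 'k) mpoly) \<or>
          k \<in> keys (lookup (single (phi v) 1 * expand (pmono m :: ('v, 'k) mpoly)) t)"
        unfolding pmono_add Var_pmono[symmetric] hasse_Var_times by (meson UnE keys_add subsetD)
      then show "\<exists>n. k + n = single v 1 + m \<and> gr n = t"
      proof
        assume "k \<in> keys (Var v * hasse t (pmono m) :: ('v, 'k) mpoly)"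
        then obtain k' where k': "k = single v 1 + k'"
          "k' \<in> keys (hasse t (pmono m :: ('v, 'k) mpoly))"
          using keys_mult[of "Var v" "hasse t (pmono m) :: ('v, 'k) mpoly"]
          unfolding Var_pmono by auto
        then obtain n where "k' + n = m" "gr n = t" using add.IH by blast
        then show ?thesis using k' by (auto simp: ac_simps)
      next
        assume *: "k \<in> keys (lookup (single (phi v) 1 * expand (pmono m :: ('v, 'k) mpoly)) t)"
        show ?thesis
        proof (cases rule: hasse_shift_cases[where v = v and p = "pmono m :: ('v, 'k) mpoly" and t = t])
          case 1
          then show ?thesis using * by simp
        next
          case (2 s)
          then obtain n where "k + n = m" "gr n = s" using add.IH * by auto
          then show ?thesis using 2
            by (intro exI[of _ "single v 1 + n"]) (auto simp: gr_add ac_simps simp del: One_nat_def)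
        qed
      qed
    qed
  qed
  then show thesis using assms that by blast
qed

lemma lookup_Var_times_notin:
  assumes "v \<notin> keys k"
  shows "lookup (Var v * p :: ('v, 'k::comm_ring_1) mpoly) k = 0"
proof (rule ccontr)
  assume "\<not> ?thesis"
  then have "k \<in> keys (Var v * p)" by (simp add: in_keys_iff)
  then obtain k' where "k = single v 1 + k'"
    using keys_mult[of "Var v" p] unfolding Var_pmono by auto
  then show False using assms by (simp add: keys_add_nat)
qed

text \<open>In general this coefficient involves binomial coefficients. Disjoint supports make all
  of them 1, so nothing is lost in positive characteristic.\<close>

lemma lookup_hasse_disjoint:
  fixes m n :: "'v pmonom"
  assumes "keys m \<inter> keys n = {}"
  shows "lookup (hasse (gr m) (pmono (m + n) :: ('v, 'k::comm_ring_1) mpoly)) n = 1"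
proof -
  have "n \<in> monoms_in UNIV" by (simp add: monoms_in_def)
  then have base: "lookup (hasse 0 (pmono n :: ('v, 'k) mpoly)) n = 1"
  proof (induction rule: pmonom_induct)
    case zero
    have "(pmono 0 :: ('v, 'k) mpoly) = Const 1" by simp
    show ?case unfolding \<open>(pmono 0 :: ('v, 'k) mpoly) = Const 1\<close> hasse_Const by (simp add: lookup_one)
  next
    case (add v n)
    let ?n = "single v 1 + n"
    have "lookup (Var v * hasse 0 (pmono n) :: ('v, 'k) mpoly) ?n = 1"
      using add.IH unfolding Var_def by (simp add: lookup_single_times)
    moreover have "lookup (lookup
        (single (phi v) 1 * expand (pmono n :: ('v, 'k) mpoly)) 0) ?n = 0"
    proof (cases rule: hasse_shift_cases[where v = v and p = "pmono n :: ('v, 'k) mpoly" and t = "0 :: 't"])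
      case 1
      then show ?thesis by simp
    next
      case (2 s)
      have "?n \<notin> keys (hasse s (pmono n :: ('v, 'k) mpoly))"
      proof
        assume "?n \<in> keys (hasse s (pmono n :: ('v, 'k) mpoly))"
        then obtain k where "?n + k = n" using keys_hasse_pmono by blast
        then have "pmdegree (?n + k) = pmdegree n" by simp
        then show False by (simp add: pmdegree_add del: One_nat_def)
      qed
      then show ?thesis using 2 by (simp add: in_keys_iff)
    qed
    ultimately show ?case
      unfolding pmono_add Var_pmono[symmetric] hasse_Var_times by (simp add: lookup_add)
  qed
  have "m \<in> monoms_in (- keys n)" using assms by (auto simp: monoms_in_def)
  then show ?thesis
  proof (induction rule: pmonom_induct)
    case (add v m)
    then show ?case
      unfolding add.assoc pmono_add[of "single v 1"] Var_pmono[symmetric] hasse_Var_times gr_add gr_single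
      by (simp add: lookup_add lookup_Var_times_notin hasse_shift)
  qed (use base in simp)
qed

lemma lookup_hasse_0:
  "lookup (hasse t (pmono m :: ('v, 'k::comm_ring_1) mpoly)) 0 = (if gr m = t then 1 else 0)"
proof (cases "gr m = t")
  case True
  then show ?thesis using lookup_hasse_disjoint[of m 0] by simp
next
  case False
  have "0 \<notin> keys (hasse t (pmono m :: ('v, 'k) mpoly))"
  proof
    assume "0 \<in> keys (hasse t (pmono m :: ('v, 'k) mpoly))"
    then obtain n where "0 + n = m" "gr n = t" using keys_hasse_pmono by blast
    then show False using False by simp
  qed
  then show ?thesis using False by (simp add: in_keys_iff)
qed

lemma hasse_monomials:
  "hasse t p = (\<Sum>m\<in>keys p. Const (lookup p m) * hasse t (pmono m))"
  by (subst mpoly_sum_monomials[of p]) (simp add: hasse_sum hasse_Const_times)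

lemma hasse_mult:
  "hasse t (p * q) = (\<Sum>(a, b)\<in>{(a, b) \<in> keys (expand p) \<times> keys (expand q). a + b = t}.
    hasse a p * hasse b q)"
  unfolding hasse_def expand_simps by (rule lookup_mult_expand)

section \<open>Orders of vanishing\<close>

primrec vanishing :: "nat \<Rightarrow> nat \<Rightarrow> ('v, 'k::comm_ring_1) mpoly set" where
  "vanishing 0 s = {p. \<forall>m\<in>keys p. s \<le> pmdegree m}"
| "vanishing (Suc r) s = {p. \<forall>t. hasse t p \<in> vanishing r s}"

lemma vanishing_zero [simp]: "0 \<in> vanishing r s"
  by (induction r) auto

lemma vanishing_add: "p \<in> vanishing r s \<Longrightarrow> q \<in> vanishing r s \<Longrightarrow> p + q \<in> vanishing r s"
proof (induction r arbitrary: p q)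
  case 0
  then show ?case using keys_add[of p q] by auto
qed (auto simp: hasse_add)

lemma vanishing_sum: "(\<And>x. x \<in> A \<Longrightarrow> f x \<in> vanishing r s) \<Longrightarrow> sum f A \<in> vanishing r s"
  by (induction A rule: infinite_finite_induct) (auto intro: vanishing_add)

lemma vanishing_order_0 [simp]: "p \<in> vanishing r 0"
  by (induction r arbitrary: p) auto

lemma vanishing_antimono: "s \<le> s' \<Longrightarrow> p \<in> vanishing r s' \<Longrightarrow> p \<in> vanishing r s"
  by (induction r arbitrary: p) auto

text \<open>Hasse coefficients of a product are convolutions, so orders add as degrees do in the
  base case.\<close>

lemma vanishing_mult: "p \<in> vanishing r a \<Longrightarrow> q \<in> vanishing r b \<Longrightarrow> p * q \<in> vanishing r (a + b)"
proof (induction r arbitrary: p q)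
  case 0
  then show ?case using keys_mult[of p q] by (force simp: pmdegree_add intro: add_mono)
next
  case (Suc r)
  then show ?case by (auto simp: hasse_mult intro!: vanishing_sum)
qed

lemma vanishing_mult_left: "p \<in> vanishing r s \<Longrightarrow> q * p \<in> vanishing r s"
  using vanishing_mult[of q r 0 p s] by simp

lemma vanishing_uminus: "p \<in> vanishing r s \<Longrightarrow> - p \<in> vanishing r s"
  using vanishing_mult_left[of p r s "- 1"] by simp

lemma vanishing_diff: "p \<in> vanishing r s \<Longrightarrow> q \<in> vanishing r s \<Longrightarrow> p - q \<in> vanishing r s"
  using vanishing_add[of p r s "- q"] vanishing_uminus[of q r s] by simp

lemma one_notin_vanishing: "1 \<notin> vanishing r 1"
proof (induction r)
  case (Suc r)
  have "hasse 0 1 = 1" by (simp add: hasse_def expand_simps lookup_one)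
  with Suc show ?case unfolding vanishing.simps mem_Collect_eq by metis
qed simp

lemma vanishing_order:
  assumes "f \<notin> vanishing r s"
  obtains e where "e < s" "f \<in> vanishing r e" "f \<notin> vanishing r (Suc e)"
  using assms
proof (induction s)
  case (Suc s)
  then show ?case by (cases "f \<in> vanishing r s") (auto intro: less_SucI)
qed simp

text \<open>Only finitely many coefficients lie outside the ideal, and the linear order on exponents
  singles out a top one. It acts as a leading term when cancelling factors.\<close>

lemma vanishing_max_hasse:
  assumes "\<exists>t. hasse t f \<notin> vanishing r s"
  obtains t where "hasse t f \<notin> vanishing r s" "\<And>t'. t < t' \<Longrightarrow> hasse t' f \<in> vanishing r s"
proof -
  define A where "A = {t. hasse t f \<notin> vanishing r s}"
  have "A \<subseteq> keys (expand f)"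
  proof
    fix t assume "t \<in> A"
    then have "hasse t f \<noteq> 0" unfolding A_def by (metis mem_Collect_eq vanishing_zero)
    then show "t \<in> keys (expand f)" by (simp add: in_keys_iff hasse_def)
  qed
  then have fin: "finite A" by (rule finite_subset) simp
  have "A \<noteq> {}" using assms by (simp add: A_def)
  with fin have "Max A \<in> A" by (rule Max_in)
  moreover have "t \<notin> A" if "Max A < t" for t using Max_ge[OF fin, of t] that by auto
  ultimately show thesis using that[of "Max A"] unfolding A_def by blast
qed

text \<open>The coefficient of \<open>u * f\<close> at the sum of the top degrees \<open>a\<close> and \<open>b\<close> of \<open>u\<close> modulo
  \<open>vanishing r 1\<close> and of \<open>f\<close> modulo \<open>vanishing r (Suc e)\<close> is a product modulo
  \<open>vanishing r (Suc e)\<close>, where \<open>e\<close> is the exact order of vanishing of \<open>f\<close>.\<close>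

lemma vanishing_cancel:
  fixes u f :: "('v, 'k::field) mpoly"
  shows "u \<notin> vanishing r 1 \<Longrightarrow> f \<notin> vanishing r s \<Longrightarrow> u * f \<notin> vanishing r s"
proof (induction r arbitrary: u f s)
  case 0
  obtain e where e: "e < s" "f \<in> vanishing 0 e" "f \<notin> vanishing 0 (Suc e)"
    using vanishing_order[OF 0(2)] .
  \<comment> \<open>Modulo terms of positive degree \<open>u\<close> is its constant term, which is
    nonzero and hence invertible.\<close>
  let ?c = "lookup u 0"
  have c: "?c \<noteq> 0" using 0(1) by (auto simp: in_keys_iff Suc_le_eq pmdegree_eq_0_iff)
  have "u - Const ?c \<in> vanishing 0 1"
    by (auto simp: in_keys_iff Suc_le_eq lookup_minus Const_def lookup_single when_def
        dest: pmdegree_eq_0_iff[THEN iffD1] intro!: gr0I)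
  then have *: "(u - Const ?c) * f \<in> vanishing 0 (Suc e)" using vanishing_mult[OF _ e(2)] by fastforce
  show ?case
  proof
    assume "u * f \<in> vanishing 0 s"
    then have "u * f \<in> vanishing 0 (Suc e)" using e(1) by (auto intro: vanishing_antimono[of "Suc e" s])
    from vanishing_diff[OF this *] have "Const ?c * f \<in> vanishing 0 (Suc e)" by (simp add: algebra_simps)
    from vanishing_mult_left[OF this, of "Const (inverse ?c)"] have "f \<in> vanishing 0 (Suc e)"
      using c by (simp add: mult.assoc[symmetric] Const_mult[symmetric] del: vanishing.simps)
    then show False using e by blast
  qed
next
  case (Suc r)
  obtain e where e: "e < s" "f \<in> vanishing (Suc r) e" "f \<notin> vanishing (Suc r) (Suc e)"
    using vanishing_order[OF Suc.prems(2)] .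
  obtain a where a: "hasse a u \<notin> vanishing r 1" "\<And>t. a < t \<Longrightarrow> hasse t u \<in> vanishing r 1"
    using vanishing_max_hasse[of u r 1] Suc.prems(1) by auto
  obtain b where b: "hasse b f \<notin> vanishing r (Suc e)" "\<And>t. b < t \<Longrightarrow> hasse t f \<in> vanishing r (Suc e)"
    using vanishing_max_hasse[of f r "Suc e"] e(3) by auto
  let ?P = "{(a', b') \<in> keys (expand u) \<times> keys (expand f). a' + b' = a + b}"
  have fin: "finite ?P"
    by (rule finite_subset[of _ "keys (expand u) \<times> keys (expand f)"]) auto
  have ab: "(a, b) \<in> ?P"
    using a(1) b(1) by (auto simp: in_keys_iff hasse_def[symmetric])
  have rest: "(\<Sum>(a', b')\<in>?P - {(a, b)}. hasse a' u * hasse b' f) \<in> vanishing r (Suc e)"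
  proof (rule vanishing_sum)
    fix ab' assume "ab' \<in> ?P - {(a, b)}"
    then obtain a' b' where ab': "ab' = (a', b')" "a' + b' = a + b" "(a', b') \<noteq> (a, b)" by auto
    \<comment> \<open>Two different pairs with the same sum: one component must exceed its top
      degree, so that factor vanishes to a higher order.\<close>
    consider "a < a'" | "b < b'"
    proof (cases "a' < a")
      case True
      then have "b < b'"
        using ab'(2) by (metis add_le_less_mono add.commute leI less_irrefl)
      then show thesis using that by blast
    next
      case False
      then show thesis using that ab' by (cases "a' = a") auto
    qed
    then have "hasse a' u * hasse b' f \<in> vanishing r (Suc e)"
    proof cases
      case 1
      then have "hasse a' u * hasse b' f \<in> vanishing r (1 + e)"
        using a(2) e(2) by (intro vanishing_mult) auto
      then show ?thesis by simp
    next
      case 2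
      then show ?thesis using b(2) by (intro vanishing_mult_left)
    qed
    then show "(case ab' of (a', b') \<Rightarrow> hasse a' u * hasse b' f) \<in> vanishing r (Suc e)"
      by (simp add: ab')
  qed
  have "hasse (a + b) (u * f) = hasse a u * hasse b f + (\<Sum>(a', b')\<in>?P - {(a, b)}. hasse a' u * hasse b' f)"
    unfolding hasse_mult by (subst sum.remove[OF fin ab]) auto
  moreover have "hasse a u * hasse b f \<notin> vanishing r (Suc e)" using Suc.IH a(1) b(1) by blast
  ultimately have "hasse (a + b) (u * f) \<notin> vanishing r (Suc e)"
    using vanishing_diff[OF _ rest, of "hasse (a + b) (u * f)"] by auto
  then have "u * f \<notin> vanishing (Suc r) (Suc e)" by auto
  then show ?case using vanishing_antimono[of "Suc e" s "u * f" "Suc r"] e(1) by auto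
qed

lemma vanishing_ideal:
  "ideal (carrier (poly_ring V) \<inter> vanishing r s) (poly_ring V :: ('v, 'k::comm_ring_1) mpoly ring)"
  by (rule ideal_poly_ringI) (auto intro: poly_ring_closed vanishing_add vanishing_mult_left)

end

section \<open>Leading monomials\<close>

text \<open>Relational form of \<open>lead_monom\<close> that names the exponent itself and fails
  for the zero polynomial, which avoids definite descriptions.\<close>

definition is_lm :: "'v pmonom rel \<Rightarrow> ('v, 'k::comm_ring_1) mpoly \<Rightarrow> 'v pmonom \<Rightarrow> bool" where
  "is_lm ord p m \<longleftrightarrow> m \<in> keys p \<and> (\<forall>n\<in>keys p. (n, m) \<in> ord)"

locale monomial_order =
  fixes V :: "'v set" and ord :: "'v pmonom rel"
  assumes term_order: "term_order V ord"
begin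

lemma ord_refl: "m \<in> monoms_in V \<Longrightarrow> (m, m) \<in> ord"
  and ord_trans: "(a, b) \<in> ord \<Longrightarrow> (b, c) \<in> ord \<Longrightarrow> (a, c) \<in> ord"
  and ord_antisym: "(a, b) \<in> ord \<Longrightarrow> (b, a) \<in> ord \<Longrightarrow> a = b"
  and ord_total: "a \<in> monoms_in V \<Longrightarrow> b \<in> monoms_in V \<Longrightarrow> (a, b) \<in> ord \<or> (b, a) \<in> ord"
  using term_order
  unfolding term_order_def linear_order_on_def partial_order_on_def preorder_on_def
  by (auto simp: refl_on_def dest: transD antisymD) (metis total_on_def)

lemma ord_add:
  "a \<in> monoms_in V \<Longrightarrow> b \<in> monoms_in V \<Longrightarrow> c \<in> monoms_in V \<Longrightarrow> (a, b) \<in> ord \<Longrightarrow> (a + c, b + c) \<in> ord"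
  using term_order unfolding term_order_def by blast

lemma monoms_in_add: "a + b \<in> monoms_in V \<longleftrightarrow> a \<in> monoms_in V \<and> b \<in> monoms_in V"
  by (auto simp: monoms_in_def keys_add_nat)

lemma ord_add_cancel:
  assumes "a \<in> monoms_in V" "b \<in> monoms_in V" "c \<in> monoms_in V" "(a + c, b + c) \<in> ord"
  shows "(a, b) \<in> ord"
proof (rule ccontr)
  assume *: "(a, b) \<notin> ord"
  then have "(b + c, a + c) \<in> ord" using ord_total ord_add assms by blast
  then have "a = b" using ord_antisym assms(4) by (metis add_right_cancel)
  then show False using * ord_refl assms by blast
qed

lemma finite_has_max:
  assumes "finite A" "A \<noteq> {}" "A \<subseteq> monoms_in V"
  shows "\<exists>m\<in>A. \<forall>n\<in>A. (n, m) \<in> ord"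
  using assms
proof (induction A rule: finite_ne_induct)
  case (singleton x)
  then show ?case using ord_refl by auto
next
  case (insert x A)
  then obtain m where m: "m \<in> A" "\<forall>n\<in>A. (n, m) \<in> ord" by auto
  show ?case
  proof (cases "(x, m) \<in> ord")
    case True
    then show ?thesis using m by auto
  next
    case False
    then have "(m, x) \<in> ord" using ord_total insert.prems m(1) by blast
    then show ?thesis using m ord_trans ord_refl insert.prems by (intro bexI[of _ x]) blast+
  qed
qed

lemma finite_has_min:
  assumes "finite A" "A \<noteq> {}" "A \<subseteq> monoms_in V"
  shows "\<exists>m\<in>A. \<forall>n\<in>A. (m, n) \<in> ord"
  using assms
proof (induction A rule: finite_ne_induct)
  case (singleton x)
  then show ?case using ord_refl by auto
next
  case (insert x A)
  then obtain m where m: "m \<in> A" "\<forall>n\<in>A. (m, n) \<in> ord" by auto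
  show ?case
  proof (cases "(m, x) \<in> ord")
    case True
    then show ?thesis using m by auto
  next
    case False
    then have "(x, m) \<in> ord" using ord_total insert.prems m(1) by blast
    then show ?thesis using m ord_trans ord_refl insert.prems by (intro bexI[of _ x]) blast+
  qed
qed

lemma is_lm_exists:
  assumes "p \<in> carrier (poly_ring V)" "p \<noteq> 0"
  obtains m where "is_lm ord p m" "m \<in> monoms_in V"
  using finite_has_max[of "keys p"] assms unfolding is_lm_def in_poly_ring by auto

lemma lead_monom_eq: "is_lm ord p m \<Longrightarrow> lead_monom ord p = pmono m"
  unfolding lead_monom_def pmono_def is_lm_def
  by (rule arg_cong[of _ _ "\<lambda>m. single m 1"], rule the_equality) (auto dest: ord_antisym)

lemma is_lm_mult:
  fixes p q :: "('v, 'k::field) mpoly"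
  assumes "p \<in> carrier (poly_ring V)" "q \<in> carrier (poly_ring V)" "is_lm ord p m" "is_lm ord q n"
  shows "is_lm ord (p * q) (m + n)"
proof -
  have keys: "keys p \<subseteq> monoms_in V" "keys q \<subseteq> monoms_in V"
    "m \<in> keys p" "n \<in> keys q"
    using assms by (auto simp: in_poly_ring is_lm_def)
  have le: "(a + b, m + n) \<in> ord" "(a + b, m + b) \<in> ord" "(m + b, m + n) \<in> ord"
    if "a \<in> keys p" "b \<in> keys q" for a b
  proof -
    have ab: "a \<in> monoms_in V" "b \<in> monoms_in V" "m \<in> monoms_in V" "n \<in> monoms_in V" using that keys by auto
    show *: "(a + b, m + b) \<in> ord" using ab that assms(3) by (auto simp: is_lm_def intro: ord_add)
    show "(m + b, m + n) \<in> ord"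
      using ord_add[of b n m] ab that assms(4) by (auto simp: is_lm_def add.commute)
    with * show "(a + b, m + n) \<in> ord" by (rule ord_trans)
  qed
  have "{(a, b) \<in> keys p \<times> keys q. a + b = m + n} = {(m, n)}"
  proof (intro equalityI subsetI)
    fix ab assume "ab \<in> {(a, b) \<in> keys p \<times> keys q. a + b = m + n}"
    then obtain a b where ab: "ab = (a, b)" "a \<in> keys p" "b \<in> keys q" "a + b = m + n"
      by auto
    then have "m + b = m + n" using le[OF ab(2,3)] ord_antisym by metis
    then show "ab \<in> {(m, n)}" using ab by simp
  qed (use keys in auto)
  then have "lookup (p * q) (m + n) = lookup p m * lookup q n"
    unfolding lookup_mult_expand by simp
  then have "m + n \<in> keys (p * q)" using keys by (auto simp: in_keys_iff)
  moreover have "(k, m + n) \<in> ord" if "k \<in> keys (p * q)" for k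
    using that keys_mult[of p q] le by blast
  ultimately show ?thesis by (simp add: is_lm_def)
qed

end

section \<open>Leading monomials of vanishing polynomials\<close>

definition pmrestrict :: "'v set \<Rightarrow> 'v pmonom \<Rightarrow> 'v pmonom" where
  "pmrestrict A m = (\<Sum>v\<in>keys m \<inter> A. single v (lookup m v))"

lemma lookup_pmrestrict: "lookup (pmrestrict A m) v = (if v \<in> A then lookup m v else 0)"
proof -
  have "lookup (pmrestrict A m) v =
      (\<Sum>u\<in>keys m \<inter> A. if u = v then lookup m u else 0)"
    unfolding pmrestrict_def lookup_sum by (intro sum.cong) (auto simp: lookup_single when_def)
  also have "\<dots> = (if v \<in> A then lookup m v else 0)" by (auto simp: in_keys_iff)
  finally show ?thesis .
qed

lemma keys_pmrestrict: "keys (pmrestrict A m) = keys m \<inter> A"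
  by (auto simp: in_keys_iff lookup_pmrestrict split: if_splits)

lemma pmrestrict_split: "m = pmrestrict A m + pmrestrict (- A) m"
  by (rule poly_mapping_eqI) (simp add: lookup_add lookup_pmrestrict)

text \<open>The assumption \<open>fibre_least\<close> links the term order to the poset; it is what
  controls leading monomials under Hasse coefficients.\<close>

locale ordered_grading = grading phi + monomial_order V ord
  for phi :: "'v \<Rightarrow> 't::{ordered_cancel_comm_monoid_add, cancel_comm_monoid_add, linorder}" and V ord +
  fixes less :: "'v \<Rightarrow> 'v \<Rightarrow> bool"
  assumes finV: "finite V"
    and less_irrefl: "\<not> less u u" and less_trans: "less u v \<Longrightarrow> less v w \<Longrightarrow> less u w"
    and fibre_least: "A \<subseteq> V \<Longrightarrow> (\<And>u v. u \<in> A \<Longrightarrow> v \<in> A \<Longrightarrow> \<not> less u v) \<Longrightarrow> m \<in> monoms_in A \<Longrightarrow>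
      n \<in> monoms_in V \<Longrightarrow> gr n = gr m \<Longrightarrow> (m, n) \<in> ord"
begin

text \<open>A derivative in degree \<open>gr m\<^sub>1\<close> removes from every monomial of \<open>p\<close> a divisor in the fibre of \<open>m\<^sub>1\<close>,
  hence, up to the order, at least the monomial \<open>m\<^sub>1\<close>.\<close>

lemma is_lm_hasse:
  fixes p :: "('v, 'k::field) mpoly"
  assumes p: "p \<in> carrier (poly_ring V)" "is_lm ord p m"
    and A: "A \<subseteq> V" "\<And>u v. u \<in> A \<Longrightarrow> v \<in> A \<Longrightarrow> \<not> less u v"
  shows "is_lm ord (hasse (gr (pmrestrict A m)) p) (pmrestrict (- A) m)"
proof -
  let ?a = "pmrestrict A m" and ?b = "pmrestrict (- A) m"
  have m: "m \<in> monoms_in V" "m = ?a + ?b" using p pmrestrict_split by (auto simp: is_lm_def in_poly_ring)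
  have ab: "?a \<in> monoms_in A" "?a \<in> monoms_in V" "?b \<in> monoms_in V"
    using m(1) by (auto simp: monoms_in_def keys_pmrestrict)
  have le: "(k + ?a, n) \<in> ord"
    if n: "n \<in> keys p" "k \<in> keys (hasse (gr ?a) (pmono n :: ('v, 'k) mpoly))" for k n
  proof -
    obtain n' where n': "k + n' = n" "gr n' = gr ?a" using keys_hasse_pmono[OF n(2)] .
    have "k \<in> monoms_in V" "n' \<in> monoms_in V" using n(1) n'(1) p(1) monoms_in_add by (auto simp: in_poly_ring)
    moreover from this have "(?a, n') \<in> ord" using fibre_least[OF A ab(1)] n'(2) by blast
    ultimately show ?thesis using ord_add[of ?a n' k] ab n'(1) by (simp add: add.commute)
  qed
  have coeff: "lookup (hasse (gr ?a) p) k = (\<Sum>n\<in>keys p.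
      lookup p n * lookup (hasse (gr ?a) (pmono n)) k)" for k
    by (subst hasse_monomials) (simp add: lookup_sum lookup_Const_times)
  \<comment> \<open>A monomial that contributes to \<open>?b\<close> is at least
    \<open>?b + ?a = m\<close>, so \<open>m\<close> alone does, and by disjointness of supports with
    factor 1.\<close>
  have "lookup (hasse (gr ?a) (pmono n :: ('v, 'k) mpoly)) ?b = 0"
    if "n \<in> keys p" "n \<noteq> m" for n
  proof (rule ccontr)
    assume "lookup (hasse (gr ?a) (pmono n :: ('v, 'k) mpoly)) ?b \<noteq> 0"
    then have "(?b + ?a, n) \<in> ord" using le that by (simp add: in_keys_iff)
    then have "(m, n) \<in> ord" using m(2) by (simp add: add.commute)
    then show False using p(2) that ord_antisym by (auto simp: is_lm_def)
  qed
  then have "lookup (hasse (gr ?a) p) ?b = (\<Sum>n\<in>{m}.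
      lookup p n * lookup (hasse (gr ?a) (pmono n)) ?b)"
    unfolding coeff using p(2) by (intro sum.mono_neutral_right) (auto simp: is_lm_def)
  moreover have "lookup (hasse (gr ?a) (pmono (?a + ?b) :: ('v, 'k) mpoly)) ?b = 1"
    by (rule lookup_hasse_disjoint) (auto simp: keys_pmrestrict)
  then have "lookup (hasse (gr ?a) (pmono m :: ('v, 'k) mpoly)) ?b = 1"
    by (subst m(2))
  ultimately have "?b \<in> keys (hasse (gr ?a) p)" using p(2) by (simp add: is_lm_def in_keys_iff)
  moreover have "(k, ?b) \<in> ord" if k: "k \<in> keys (hasse (gr ?a) p)" for k
  proof -
    obtain n where n: "n \<in> keys p" "k \<in> keys (hasse (gr ?a) (pmono n :: ('v, 'k) mpoly))"
      using k unfolding in_keys_iff coeff by (metis (no_types, lifting) mult_zero_right sum.neutral in_keys_iff)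
    have "k \<in> monoms_in V" using k hasse_closed[OF p(1)] by (auto simp: in_poly_ring)
    moreover have "(n, m) \<in> ord" using n(1) p(2) by (simp add: is_lm_def)
    then have "(k + ?a, ?b + ?a) \<in> ord" using ord_trans[OF le[OF n]] m(2) by (metis add.commute)
    ultimately show ?thesis using ord_add_cancel ab by blast
  qed
  ultimately show ?thesis by (simp add: is_lm_def)
qed

text \<open>Induction on \<open>r\<close>. The minimal elements of \<open>X\<close> form an
  antichain; a Hasse coefficient deletes their part of \<open>m\<close> and costs one orbit point,
  while the longest chains of \<open>X\<close> lose their first element.\<close>

lemma lm_vanishing:
  fixes p :: "('v, 'k::field) mpoly"
  assumes "p \<in> carrier (poly_ring V)" "p \<in> vanishing r s" "is_lm ord p m"
    and "X \<subseteq> V" "\<And>c. set c \<subseteq> X \<Longrightarrow> sorted_wrt less c \<Longrightarrow> length c \<le> r"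
  shows "s \<le> (\<Sum>v\<in>V - X. lookup m v)"
  using assms
proof (induction r arbitrary: p m X)
  case 0
  have "X = {}" using "0.prems"(5)[of "[x]" for x] by auto
  moreover have "keys m \<subseteq> V" using 0 by (auto simp: is_lm_def in_poly_ring monoms_in_def)
  then have "pmdegree m = (\<Sum>v\<in>V. lookup m v)" by (rule pmdegree_superset[OF finV])
  moreover have "s \<le> pmdegree m" using 0 by (simp add: is_lm_def)
  ultimately show ?case by simp
next
  case (Suc r)
  define A where "A = {v \<in> X. \<forall>u\<in>X. \<not> less u v}"
  have A: "A \<subseteq> V" "A \<subseteq> X" "\<And>u v. u \<in> A \<Longrightarrow> v \<in> A \<Longrightarrow> \<not> less u v" using Suc.prems(4) by (auto simp: A_def)
  have "s \<le> (\<Sum>v\<in>V - (X - A). lookup (pmrestrict (- A) m) v)"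
  proof (rule Suc.IH)
    show "hasse (gr (pmrestrict A m)) p \<in> carrier (poly_ring V)" using Suc.prems(1) by (rule hasse_closed)
    show "hasse (gr (pmrestrict A m)) p \<in> vanishing r s" using Suc.prems(2) by simp
    show "is_lm ord (hasse (gr (pmrestrict A m)) p) (pmrestrict (- A) m)"
      using Suc.prems(1,3) A by (intro is_lm_hasse)
    fix c assume c: "set c \<subseteq> X - A" "sorted_wrt less c"
    show "length c \<le> r"
    proof (cases c)
      \<comment> \<open>The first element of a chain in \<open>X - A\<close> is not minimal, so the
        chain extends downwards inside \<open>X\<close>.\<close>
      case (Cons v c')
      then obtain u where u: "u \<in> X" "less u v" using c by (auto simp: A_def)
      then have "\<forall>w\<in>set c. less u w" using c(2) Cons less_trans by auto
      then have "sorted_wrt less (u # c)" using c(2) by simp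
      then show ?thesis using Suc.prems(5)[of "u # c"] u c by auto
    qed simp
  qed (use Suc.prems(4) in auto)
  also have "\<dots> = (\<Sum>v\<in>V - X. lookup m v)"
    using finV A by (intro sum.mono_neutral_cong_right) (auto simp: lookup_pmrestrict)
  finally show ?case .
qed

lemma vanishing_lm_chains:
  fixes p :: "('v, 'k::field) mpoly"
  assumes "p \<in> carrier (poly_ring V)" "p \<in> vanishing r s" "is_lm ord p m"
  obtains cs where "\<And>c. c \<in> set cs \<Longrightarrow> sorted_wrt less c \<and> set c \<subseteq> V \<and> r < length c"
    "\<And>v. v \<in> V \<Longrightarrow> count_list (concat cs) v \<le> lookup m v" "(\<Sum>c\<leftarrow>cs. length c - r) = s"
proof (rule greene_kleitman[OF finV, of less r s "lookup m"])
  show "s \<le> (\<Sum>v\<in>V - X. lookup m v)"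
    if "X \<subseteq> V" "\<And>c. set c \<subseteq> X \<Longrightarrow> sorted_wrt less c \<Longrightarrow> length c \<le> r" for X
    using lm_vanishing[OF assms that] .
qed (use less_irrefl less_trans that in blast)+

end

section \<open>Joins with the toric ideal\<close>

lemma mpeval_subst_poly:
  assumes "coeff_map c"
  shows "mpeval c \<tau> (subst_poly \<sigma> p) = mpeval c (\<lambda>v. mpeval c \<tau> (\<sigma> v)) p"
  using in_poly_ring_UNIV[of p] unfolding subst_poly_mpeval
  by (induction rule: mpoly_induct)
    (simp_all add: Const.mpeval_add Const.mpeval_mult coeff_map.mpeval_add[OF assms] coeff_map.mpeval_mult[OF assms]
      coeff_map.mpeval_Const[OF assms] coeff_map.mpeval_Var[OF assms])

context grading
begin

abbreviation (input) subX :: "('v, 'k::comm_ring_1) mpoly \<Rightarrow> ('v xyz, 'k) mpoly" where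
  "subX \<equiv> subst_poly (\<lambda>a. Var (X_var a))"
abbreviation (input) subY :: "('v, 'k::comm_ring_1) mpoly \<Rightarrow> ('v xyz, 'k) mpoly" where
  "subY \<equiv> subst_poly (\<lambda>a. Var (Y_var a))"
abbreviation (input) subZ :: "('v, 'k::comm_ring_1) mpoly \<Rightarrow> ('v xyz, 'k) mpoly" where
  "subZ \<equiv> subst_poly (\<lambda>a. Var (Z_var a))"

text \<open>Setting the variables to zero in the expansion leaves the parametrization of the orbit
  itself.\<close>

lemma lookup_toric:
  "lookup (mpeval (\<lambda>c. single 0 (Const c)) (\<lambda>v. single (phi v) 1) f) t =
    (Const (lookup (hasse t f) 0) :: ('v, 'k::comm_ring_1) mpoly)"
proof -
  interpret coeff_map "\<lambda>c. single (0::'t) (Const c :: ('v, 'k) mpoly)"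
    by (rule coeff_map_constant)
  let ?h = "mpeval (\<lambda>c. single 0 (Const c :: ('v, 'k) mpoly)) (\<lambda>v. single (phi v) 1)"
  have "\<forall>t. lookup (?h f) t = Const (lookup (hasse t f) 0)"
    using in_poly_ring_UNIV[of f]
  proof (induction rule: mpoly_induct)
    case (const c)
    then show ?case by (simp add: lookup_single when_def hasse_Const) (simp add: Const_def)
  next
    case (add p q)
    then show ?case by (simp add: mpeval_add lookup_add hasse_add Const_add)
  next
    case (var v p)
    show ?case
    proof
      fix t
      let ?l = "lookup (single (phi v) 1 * ?h p) t"
      have "?l = Const (lookup (lookup (single (phi v) 1 * expand p) t) 0)"
      proof (cases rule: hasse_shift_cases[where v = v and p = p and t = t])
        case 1
        have "?l = 0"
        proof (rule ccontr)
          assume l: "?l \<noteq> 0"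
          then obtain s where s: "t = phi v + s" by (rule lookup_single_times_keys)
          then show False using l 1(2)[OF s] var.IH lookup_single_times[of "phi v" "?h p" s] by simp
        qed
        then show ?thesis using 1 by simp
      next
        case (2 s)
        then show ?thesis using var.IH by (simp add: lookup_single_times)
      qed
      then show "lookup (?h (Var v * p)) t = Const (lookup (hasse t (Var v * p)) 0)"
        by (simp add: mpeval_mult hasse_Var_times lookup_add Const_add lookup_Var_times_notin)
    qed
  qed
  then show ?thesis by blast
qed

text \<open>Order one at the origin tests the constant term. Together with
  \<open>lookup_toric\<close> this makes \<open>vanishing 1 1\<close> the kernel of the monomial
  parametrization.\<close>

lemma vanishing_1_1_iff: "f \<in> vanishing 1 1 \<longleftrightarrow> (\<forall>t. lookup (hasse t f) 0 = 0)"
proof -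
  have "(\<forall>m\<in>keys g. 1 \<le> pmdegree m) \<longleftrightarrow> lookup g 0 = 0" for g :: "('v, 'a) mpoly"
    by (metis in_keys_iff less_one not_le pmdegree_eq_0_iff)
  then show ?thesis by simp
qed

lemma binomial_vanishing:
  assumes "gr m = gr n"
  shows "pmono m - pmono n \<in> (vanishing 1 1 :: ('v, 'a::comm_ring_1) mpoly set)"
proof -
  have "hasse t (pmono m - pmono n) + hasse t (pmono n) = hasse t (pmono m :: ('v, 'a) mpoly)"
    for t using hasse_add[of t "pmono m - pmono n" "pmono n"] unfolding diff_add_cancel by (rule sym)
  then have "hasse t (pmono m - pmono n) = hasse t (pmono m) - hasse t (pmono n :: ('v, 'a) mpoly)" for t
    by (metis add_diff_cancel_right')
  then show ?thesis unfolding vanishing_1_1_iff by (simp add: lookup_minus lookup_hasse_0 assms)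
qed

context
  fixes V :: "'v set" and r :: nat
begin

abbreviation (input) big :: "('v xyz, 'k::comm_ring_1) mpoly ring" where
  "big \<equiv> poly_ring (X_var ` V \<union> Y_var ` V \<union> Z_var ` V)"

definition join_gens :: "('v xyz, 'k::comm_ring_1) mpoly set" where
  "join_gens = subY ` (carrier (poly_ring V) \<inter> vanishing 1 1) \<union>
    subZ ` (carrier (poly_ring V) \<inter> vanishing r 1) \<union>
    {Var (X_var a) - Var (Y_var a) - Var (Z_var a) | a. a \<in> V}"

lemma join_gens_closed: "join_gens \<subseteq> carrier (big :: ('v xyz, 'k::comm_ring_1) mpoly ring)"
  by (auto simp: join_gens_def intro!: subst_poly_closed poly_ring_closed)

lemma join_ideal_vanishing:
  "join_ideal V (carrier (poly_ring V) \<inter> vanishing 1 1) (carrier (poly_ring V) \<inter> vanishing r 1) =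
    {p \<in> carrier (poly_ring V). subX p \<in> genideal big join_gens}"
  by (simp add: join_ideal_def join_gens_def)

text \<open>The substitution \<open>\<tau>\<close> sends the Y variables to an orbit point, the Z
  variables to a free point and the X variables to their sum. It kills the linear and the Y
  generators, sends the Z generators to constants in \<open>vanishing r 1\<close>, and turns
  \<open>subX p\<close> into \<open>expand p\<close>.\<close>

lemma join_subset:
  fixes p :: "('v, 'k::comm_ring_1) mpoly"
  assumes "p \<in> carrier (poly_ring V)" "subX p \<in> genideal big join_gens"
  shows "p \<in> vanishing (Suc r) 1"
proof -
  interpret coeff_map "\<lambda>c. single (0::'t) (Const c :: ('v, 'k) mpoly)"
    by (rule coeff_map_constant)
  define \<tau> :: "'v xyz \<Rightarrow> 't \<Rightarrow>\<^sub>0 ('v, 'k) mpoly" where "\<tau> w = (case w of X_var v \<Rightarrow> single 0 (Var v) + single (phi v) 1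
      | Y_var v \<Rightarrow> single (phi v) 1 | Z_var v \<Rightarrow> single 0 (Var v))"
    for w :: "'v xyz"
  define h where "h = mpeval (\<lambda>c. single 0 (Const c :: ('v, 'k) mpoly)) \<tau>"
  define Q where "Q = {q \<in> carrier big. \<forall>t. lookup (h q) t \<in> vanishing r 1}"
  have "ideal Q big"
  proof (rule ideal_poly_ringI)
    fix p q :: "('v xyz, 'k) mpoly" assume pq: "p \<in> Q" "q \<in> carrier big"
    have "lookup (h (q * p)) t \<in> vanishing r 1" for t
      unfolding h_def mpeval_mult lookup_mult_expand using pq(1)
      by (intro vanishing_sum) (auto simp: Q_def h_def intro!: vanishing_mult_left)
    then show "q * p \<in> Q" using pq by (auto simp: Q_def intro: poly_ring_closed)
  qed (auto simp: Q_def h_def mpeval_add lookup_add intro: poly_ring_closed vanishing_add)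
  moreover have "join_gens \<subseteq> Q"
  proof
    fix g :: "('v xyz, 'k) mpoly" assume g: "g \<in> join_gens"
    then have "g \<in> carrier big" using join_gens_closed by blast
    moreover have "\<forall>t. lookup (h g) t \<in> vanishing r 1"
    proof -
      consider f where "g = subY f" "f \<in> vanishing 1 1" | f where "g = subZ f" "f \<in> vanishing r 1"
        | a where "g = Var (X_var a) - Var (Y_var a) - Var (Z_var a)"
        using g by (auto simp: join_gens_def simp del: vanishing.simps)
      then show ?thesis
      proof cases
        case 1
        then have "h g = mpeval (\<lambda>c. single 0 (Const c)) (\<lambda>v. single (phi v) 1) f"
          by (simp add: h_def mpeval_subst_poly[OF coeff_map_axioms] \<tau>_def)
        then show ?thesis using 1(2) by (simp only: lookup_toric vanishing_1_1_iff) simp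
      next
        case 2
        then have "h g = mpeval (\<lambda>c. single 0 (Const c)) (\<lambda>v. single 0 (Var v)) f"
          by (simp add: h_def mpeval_subst_poly[OF coeff_map_axioms] \<tau>_def)
        also have "\<dots> = single 0 f"
          using in_poly_ring_UNIV[of f]
          by (induction rule: mpoly_induct) (simp_all add: mpeval_add mpeval_mult single_add mult_single)
        finally show ?thesis using 2(2) by (simp add: lookup_single when_def)
      next
        case 3
        then show ?thesis by (simp add: h_def mpeval_diff \<tau>_def)
      qed
    qed
    ultimately show "g \<in> Q" by (simp add: Q_def)
  qed
  ultimately have "subX p \<in> Q" using genideal_poly_ring(3)[OF join_gens_closed] assms(2) by blast
  moreover have "h (subX p) = expand p"
    by (simp add: h_def mpeval_subst_poly[OF coeff_map_axioms] \<tau>_def expand_def)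
  ultimately show ?thesis by (simp add: Q_def hasse_def)
qed

text \<open>Inverts the substitution modulo the join ideal: \<open>F\<close> replaces an exponent
  \<open>t\<close> by a monomial of degree \<open>t\<close> in the Y variables and writes the
  coefficients in the Z variables. Then \<open>F (expand p)\<close> is congruent to
  \<open>subX p\<close>, and it lies in the ideal because the coefficients of
  \<open>expand p\<close> do after passing to Z.\<close>

lemma join_supset:
  fixes p :: "('v, 'k::comm_ring_1) mpoly"
  assumes p: "p \<in> carrier (poly_ring V)" "p \<in> vanishing (Suc r) 1"
  shows "subX p \<in> genideal big join_gens"
proof -
  let ?L = "genideal big (join_gens :: ('v xyz, 'k) mpoly set)"
  have idL: "ideal ?L big" by (rule genideal_poly_ring(1)[OF join_gens_closed])
  note L = ideal_poly_ringD[OF idL]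
  have gen: "g \<in> ?L" if "g \<in> join_gens" for g
    using genideal_poly_ring(2)[OF join_gens_closed] that by blast
  \<comment> \<open>Any choice will do, since two monomials of the same degree differ by a binomial
    in \<open>vanishing 1 1\<close>.\<close>
  define nf where "nf t = (SOME m. m \<in> monoms_in V \<and> gr m = t)" for t
  have nf: "nf t \<in> monoms_in V" "gr (nf t) = t" if "m \<in> monoms_in V" "gr m = t" for m t
    using someI[of "\<lambda>m. m \<in> monoms_in V \<and> gr m = t" m] that by (auto simp: nf_def)
  define F where "F e = (\<Sum>t\<in>keys e. subY (pmono (nf t)) * subZ (lookup e t))"
    for e :: "'t \<Rightarrow>\<^sub>0 ('v, 'k) mpoly"
  have F_superset: "F e = (\<Sum>t\<in>S. subY (pmono (nf t)) * subZ (lookup e t))"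
    if "finite S" "keys e \<subseteq> S" for e S
    unfolding F_def using that
    by (intro sum.mono_neutral_left) (auto simp: in_keys_iff subst_poly_mpeval)
  have F_add: "F (e + e') = F e + F e'" for e e'
  proof -
    let ?S = "keys e \<union> keys e'"
    have "keys (e + e') \<subseteq> ?S" by (rule keys_add)
    then show ?thesis
      using F_superset[of ?S e] F_superset[of ?S e'] F_superset[of ?S "e + e'"]
      by (simp add: lookup_add subst_poly_mpeval Const.mpeval_add distrib_left sum.distrib)
  qed
  have F_zero: "F 0 = 0" by (simp add: F_def)
  have F_sum: "F (\<Sum>x\<in>B. g x) = (\<Sum>x\<in>B. F (g x))" for g and B :: "'t set"
    by (induction B rule: infinite_finite_induct) (auto simp: F_add F_zero)
  have F_single: "F (single t q) = subY (pmono (nf t)) * subZ q" for t q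
    using F_superset[of "{t}" "single t q"] by simp
  have F_scale: "F (single 0 q * e) = subZ q * F e" for q e
  proof -
    have "keys (single 0 q * e) \<subseteq> keys e"
      by (auto simp: in_keys_iff lookup_single_0_times)
    then have "F (single 0 q * e) = (\<Sum>t\<in>keys e.
        subY (pmono (nf t)) * subZ (lookup (single 0 q * e) t))"
      by (intro F_superset) auto
    then show ?thesis
      unfolding F_def lookup_single_0_times subst_poly_mpeval Const.mpeval_mult sum_distrib_left
      by (simp only: mult.left_commute)
  qed
  have carY: "subY q \<in> carrier big" and carZ: "subZ q \<in> carrier big" if "q \<in> carrier (poly_ring V)"
    for q :: "('v, 'k) mpoly" using that by (auto intro!: subst_poly_closed poly_ring_closed)
  \<comment> \<open>Multiplication by the orbit coordinate of \<open>v\<close> becomes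
    multiplication by its Y variable, up to one toric binomial for each exponent.\<close>
  have shift: "F (single (phi v) 1 * expand p) - Var (Y_var v) * F (expand p) \<in> ?L"
    if v: "v \<in> V" and p: "p \<in> carrier (poly_ring V)" for v p
  proof -
    have *: "F (single (phi v) 1 * single t (hasse t p)) -
        Var (Y_var v) * F (single t (hasse t p)) \<in> ?L" if t: "t \<in> keys (expand p)" for t
    proof -
      obtain m where m: "m \<in> monoms_in V" "gr m = t"
        using keys_expand[OF p, of t] t by (auto simp: in_keys_iff hasse_def)
      have m': "single v 1 + nf t \<in> monoms_in V" "gr (single v 1 + nf t) = phi v + t"
        using v nf[OF m] by (auto simp: monoms_in_def keys_add_nat gr_add simp del: One_nat_def)
      have "pmono (nf (phi v + t)) - pmono (single v 1 + nf t) \<in>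
          carrier (poly_ring V) \<inter> (vanishing 1 1 :: ('v, 'k) mpoly set)"
        using nf[OF m'] m' by (intro IntI binomial_vanishing poly_ring_closed) auto
      then have "subY (pmono (nf (phi v + t)) - pmono (single v 1 + nf t)) \<in> ?L"
        by (intro gen) (auto simp: join_gens_def)
      then have "subZ (hasse t p) * subY (pmono (nf (phi v + t)) - pmono (single v 1 + nf t)) \<in> ?L"
        by (rule L(4)) (intro carZ hasse_closed p)
      moreover have "subY (pmono (nf (phi v + t)) - pmono (single v 1 + nf t)) =
          (subY (pmono (nf (phi v + t))) - Var (Y_var v) * subY (pmono (nf t)) :: ('v xyz, 'k) mpoly)"
        unfolding pmono_add Var_pmono[symmetric]
        by (simp add: subst_poly_mpeval Const.mpeval_diff Const.mpeval_mult)
      ultimately have "subZ (hasse t p) * (subY (pmono (nf (phi v + t))) - Var (Y_var v) * subY (pmono (nf t))) \<in> ?L"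
        by (simp only:)
      moreover have "subZ (hasse t p) * (subY (pmono (nf (phi v + t))) - Var (Y_var v) * subY (pmono (nf t))) =
          F (single (phi v) 1 * single t (hasse t p)) -
          Var (Y_var v) * F (single t (hasse t p))"
        unfolding mult_single F_single mult_1 by (simp add: algebra_simps del: pmono_add)
      ultimately show ?thesis by (simp only:)
    qed
    have e: "expand p = (\<Sum>t\<in>keys (expand p). single t (hasse t p))"
      using poly_mapping_sum_singles[of "expand p"] by (simp add: hasse_def)
    have "F (single (phi v) 1 * expand p) - Var (Y_var v) * F (expand p) =
        (\<Sum>t\<in>keys (expand p). F (single (phi v) 1 * single t (hasse t p)) -
        Var (Y_var v) * F (single t (hasse t p)))"
      by (subst (1 2) e) (simp only: sum_distrib_left F_sum sum_subtractf)
    then show ?thesis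
      using ideal_poly_ring_sum[OF genideal_poly_ring(1)[OF join_gens_closed] *] by simp
  qed
  have F_closed: "F (expand p) \<in> carrier big" if p: "p \<in> carrier (poly_ring V)" for p
    unfolding F_def
  proof (rule poly_ring_sum)
    fix t assume t: "t \<in> keys (expand p)"
    then obtain m where m: "m \<in> monoms_in V" "gr m = t"
      using keys_expand[OF p, of t] by (auto simp: in_keys_iff hasse_def)
    show "subY (pmono (nf t)) * subZ (lookup (expand p) t) \<in> carrier big"
      using nf[OF m] hasse_closed[OF p, of t]
      by (intro poly_ring_closed(1) carY carZ) (auto simp: hasse_def intro: poly_ring_closed)
  qed
  \<comment> \<open>Induction on \<open>p\<close>: the linear generator splits an X variable into
    its Y and Z parts, which match the two summands of \<open>expand (Var v)\<close>.\<close>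
  have "subX p - F (expand p) \<in> ?L"
    using p(1)
  proof (induction rule: mpoly_induct)
    case (const c)
    \<comment> \<open>The chosen monomial of degree zero need not be 1, hence a binomial already for
      constants.\<close>
    have nf0: "nf 0 \<in> monoms_in V" "gr (nf 0) = 0" using nf[of 0 0] by (auto simp: monoms_in_def)
    then have "pmono 0 - pmono (nf 0) \<in> carrier (poly_ring V) \<inter> (vanishing 1 1 :: ('v, 'k) mpoly set)"
      by (intro IntI binomial_vanishing poly_ring_closed) (auto simp: monoms_in_def)
    then have "subY (pmono 0 - pmono (nf 0)) \<in> ?L" by (intro gen) (auto simp: join_gens_def)
    then have "Const c * subY (pmono 0 - pmono (nf 0)) \<in> ?L" by (rule L(4)) (rule poly_ring_closed)
    moreover have "subY (pmono 0 - pmono (nf 0)) = (1 - subY (pmono (nf 0)) :: ('v xyz, 'k) mpoly)"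
      by (simp add: subst_poly_mpeval Const.mpeval_diff)
    ultimately have "Const c * (1 - subY (pmono (nf 0))) \<in> ?L" by (simp only:)
    moreover have "subX (Const c) - F (expand (Const c)) = Const c * (1 - subY (pmono (nf 0)))"
      by (simp add: expand_simps F_single subst_poly_mpeval right_diff_distrib mult.commute)
    ultimately show ?case by (simp only:)
  next
    case (add p q)
    from L(3)[OF add.IH] show ?case
      by (simp add: expand_simps F_add subst_poly_mpeval Const.mpeval_add add_diff_add)
  next
    case (var v p)
    let ?x = "Var (X_var v) :: ('v xyz, 'k) mpoly" and ?y = "Var (Y_var v) :: ('v xyz, 'k) mpoly"
      and ?z = "Var (Z_var v) :: ('v xyz, 'k) mpoly"
    let ?s = "F (single (phi v) 1 * expand p)"
    have "?x * (subX p - F (expand p)) \<in> ?L"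
      using var by (intro L(4)) (auto intro: poly_ring_closed)
    moreover have "F (expand p) * (?x - ?y - ?z) \<in> ?L"
      using var.hyps by (intro L(4) gen F_closed) (auto simp: join_gens_def)
    moreover have "?s - ?y * F (expand p) \<in> ?L" using var.hyps by (intro shift)
    ultimately have "?x * (subX p - F (expand p)) + F (expand p) * (?x - ?y - ?z) - (?s - ?y * F (expand p)) \<in> ?L"
      by (rule L(5)[OF L(3)])
    moreover have "F (expand (Var v * p)) = ?z * F (expand p) + ?s"
      by (simp add: expand_simps distrib_right F_add F_scale) (simp add: subst_poly_mpeval)
    moreover have "subX (Var v * p) = ?x * subX p"
      by (simp add: subst_poly_mpeval Const.mpeval_mult)
    moreover have "?x * (subX p - F (expand p)) + F (expand p) * (?x - ?y - ?z) - (?s - ?y * F (expand p)) =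
        ?x * subX p - (?z * F (expand p) + ?s)"
      by (simp add: left_diff_distrib right_diff_distrib mult.commute)
    ultimately show ?case by (simp only:)
  qed
  moreover have "F (expand p) \<in> ?L"
    unfolding F_def
  proof (rule ideal_poly_ring_sum[OF genideal_poly_ring(1)[OF join_gens_closed]])
    fix t assume t: "t \<in> keys (expand p)"
    then obtain m where m: "m \<in> monoms_in V" "gr m = t"
      using keys_expand[OF p(1), of t] by (auto simp: in_keys_iff hasse_def)
    have "hasse t p \<in> carrier (poly_ring V) \<inter> vanishing r 1"
      using p hasse_closed by auto
    then have "subZ (hasse t p) \<in> ?L" by (intro gen) (auto simp: join_gens_def)
    then show "subY (pmono (nf t)) * subZ (lookup (expand p) t) \<in> ?L"
      unfolding hasse_def[symmetric] using nf[OF m] by (intro L(4) carY) (auto intro: poly_ring_closed)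
  qed
  ultimately show ?thesis using L(3) by fastforce
qed

end

lemma join_vanishing:
  "join_ideal V (carrier (poly_ring V) \<inter> vanishing 1 1) (carrier (poly_ring V) \<inter> vanishing r 1) =
    (carrier (poly_ring V) \<inter> vanishing (Suc r) 1 :: ('v, 'k::comm_ring_1) mpoly set)"
  unfolding join_ideal_vanishing using join_subset join_supset by blast

end

section \<open>Determinantal identities\<close>

text \<open>Border \<open>N\<close> by a first row \<open>(1, v)\<close> and a first column
  \<open>(1, - u)\<close>. Clearing that column gives the updated matrix, while expanding along the
  border gives \<open>det N\<close> and minors of size \<open>n - 1\<close>. The coefficients are
  left unspecified because the result is used for ideal membership.\<close>

lemma det_rank_one_update:
  fixes N :: "'a::idom mat" and u v :: "nat \<Rightarrow> 'a"
  assumes N: "N \<in> carrier_mat n n"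
  obtains c where "det (mat n n (\<lambda>(i, j). N $$ (i, j) + u i * v j)) =
    det N + (\<Sum>i<n. \<Sum>j<n. c i j * det (mat_delete N i j))"
proof -
  define B1 :: "'a mat" where "B1 = mat 1 n (\<lambda>(i, j). v j)"
  define B2 :: "'a mat" where "B2 = mat n 1 (\<lambda>(i, j). - u i)"
  define B where "B = four_block_mat (1\<^sub>m 1) B1 B2 N"
  have dim: "B1 \<in> carrier_mat 1 n" "B2 \<in> carrier_mat n 1" "B \<in> carrier_mat (Suc n) (Suc n)"
    using N by (auto simp: B1_def B2_def B_def)
  \<comment> \<open>The left factor adds \<open>u i\<close> times the bordering row to each row of
    the lower block.\<close>
  have "four_block_mat (1\<^sub>m 1) (0\<^sub>m 1 n) (- B2) (1\<^sub>m n) * B =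
      four_block_mat (1\<^sub>m 1 * 1\<^sub>m 1 + 0\<^sub>m 1 n * B2) (1\<^sub>m 1 * B1 + 0\<^sub>m 1 n * N)
        (- B2 * 1\<^sub>m 1 + 1\<^sub>m n * B2) (- B2 * B1 + 1\<^sub>m n * N)"
    unfolding B_def by (rule mult_four_block_mat) (use N dim in auto)
  also have "- B2 * 1\<^sub>m 1 + 1\<^sub>m n * B2 = 0\<^sub>m n 1"
    using dim by (intro eq_matI) auto
  also have "- B2 * B1 + 1\<^sub>m n * N = mat n n (\<lambda>(i, j). N $$ (i, j) + u i * v j)"
    using N by (intro eq_matI) (auto simp: B1_def B2_def scalar_prod_def)
  also have "1\<^sub>m 1 * 1\<^sub>m 1 + 0\<^sub>m 1 n * B2 = (1\<^sub>m 1 :: 'a mat)"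
    using dim by (intro eq_matI) auto
  also have "1\<^sub>m 1 * B1 + 0\<^sub>m 1 n * N = B1" using N dim by auto
  finally have LB: "four_block_mat (1\<^sub>m 1) (0\<^sub>m 1 n) (- B2) (1\<^sub>m n) * B =
      four_block_mat (1\<^sub>m 1) B1 (0\<^sub>m n 1) (mat n n (\<lambda>(i, j). N $$ (i, j) + u i * v j))" .
  have "det (four_block_mat (1\<^sub>m 1) (0\<^sub>m 1 n) (- B2) (1\<^sub>m n)) = (1 :: 'a)"
    using dim by (subst det_four_block_mat_upper_right_zero[of _ 1 _ n]) auto
  then have "det B = det (four_block_mat (1\<^sub>m 1) (0\<^sub>m 1 n) (- B2) (1\<^sub>m n) * B)"
    using dim by (subst det_mult[of _ "Suc n"]) auto
  also have "\<dots> = det (mat n n (\<lambda>(i, j). N $$ (i, j) + u i * v j))"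
    unfolding LB using dim by (subst det_four_block_mat_lower_left_zero[of _ 1 _ n]) auto
  finally have 1: "det (mat n n (\<lambda>(i, j). N $$ (i, j) + u i * v j)) = det B" ..
  define C where "C j = mat_delete B 0 (Suc j)" for j
  have C: "C j \<in> carrier_mat n n" if "j < n" for j
    using dim that by (auto simp: C_def mat_delete_def)
  have "mat_delete B 0 0 = N"
    using N dim by (intro eq_matI) (auto simp: mat_delete_def B_def)
  moreover have "B $$ (0, Suc j) = v j" "B $$ (0, 0) = 1" if "j < n" for j
    using N dim that by (auto simp: B_def B1_def)
  moreover have "B $$ (0, 0) = 1" using N dim by (simp add: B_def)
  ultimately have detB: "det B = det N + (\<Sum>j<n. v j * ((- 1) ^ Suc j * det (C j)))"
    unfolding laplace_expansion_row[OF dim(3) zero_less_Suc] sum.lessThan_Suc_shift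
    by (simp add: cofactor_def C_def)
  have detC: "det (C j) = (\<Sum>i<n. - u i * ((- 1) ^ i * det (mat_delete N i j)))" if j: "j < n" for j
  proof -
    have "mat_delete (C j) i 0 = mat_delete N i j" if "i < n" for i
      using N dim that j by (intro eq_matI) (auto simp: mat_delete_def B_def C_def)
    moreover have "C j $$ (i, 0) = - u i" if "i < n" for i
      using N dim that j by (auto simp: mat_delete_def B_def C_def B2_def)
    moreover have "0 < n" using j by simp
    ultimately show ?thesis
      unfolding laplace_expansion_column[OF C[OF j] \<open>0 < n\<close>] by (simp add: cofactor_def)
  qed
  have "det B = det N + (\<Sum>j<n. \<Sum>i<n. (v j * (- 1) ^ Suc j * (- u i) * (- 1) ^ i) * det (mat_delete N i j))"
  proof -
    have "(\<Sum>j<n. v j * ((- 1) ^ Suc j * det (C j))) =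
        (\<Sum>j<n. \<Sum>i<n. (v j * (- 1) ^ Suc j * (- u i) * (- 1) ^ i) * det (mat_delete N i j))"
      by (intro sum.cong refl, subst detC) (auto simp: sum_distrib_left mult.assoc intro!: sum.cong)
    then show ?thesis using detB by simp
  qed
  also have "(\<Sum>j<n. \<Sum>i<n. (v j * (- 1) ^ Suc j * (- u i) * (- 1) ^ i) * det (mat_delete N i j)) =
      (\<Sum>i<n. \<Sum>j<n. (v j * (- 1) ^ Suc j * (- u i) * (- 1) ^ i) * det (mat_delete N i j))"
    by (rule sum.swap)
  finally show thesis using 1 by (intro that[of "\<lambda>i j. v j * (- 1) ^ Suc j * (- u i) * (- 1) ^ i"]) simp
qed

text \<open>Block elimination on the right, with the adjugate in place of the inverse:
  \<open>?P\<close> has determinant \<open>det A ^ t\<close> and makes the product block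
  triangular.\<close>

lemma schur_complement:
  fixes A :: "'a::idom mat"
  assumes A: "A \<in> carrier_mat r r" and B: "B \<in> carrier_mat r t" and C: "C \<in> carrier_mat t r"
    and D: "D \<in> carrier_mat t t"
  shows "det A ^ t * det (four_block_mat A B C D) =
    det A * det (det A \<cdot>\<^sub>m D - C * (adj_mat A * B))"
proof -
  note adj = adj_mat[OF A]
  let ?P = "four_block_mat (1\<^sub>m r) (- (adj_mat A * B)) (0\<^sub>m t r) (det A \<cdot>\<^sub>m 1\<^sub>m t)"
  have AB: "adj_mat A * B \<in> carrier_mat r t" using adj B by simp
  have "four_block_mat A B C D * ?P =
      four_block_mat (A * 1\<^sub>m r + B * 0\<^sub>m t r) (A * - (adj_mat A * B) + B * (det A \<cdot>\<^sub>m 1\<^sub>m t))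
        (C * 1\<^sub>m r + D * 0\<^sub>m t r) (C * - (adj_mat A * B) + D * (det A \<cdot>\<^sub>m 1\<^sub>m t))"
    by (rule mult_four_block_mat[OF A B C D one_carrier_mat uminus_carrier_mat[OF AB] zero_carrier_mat
          smult_carrier_mat[OF one_carrier_mat]])
  also have "A * 1\<^sub>m r + B * 0\<^sub>m t r = A" using A B by simp
  also have "C * 1\<^sub>m r + D * 0\<^sub>m t r = C" using C D by simp
  also have "A * - (adj_mat A * B) + B * (det A \<cdot>\<^sub>m 1\<^sub>m t) = 0\<^sub>m r t"
  proof -
    have "A * (adj_mat A * B) = (A * adj_mat A) * B" by (rule assoc_mult_mat[OF A adj(1) B, symmetric])
    also have "\<dots> = det A \<cdot>\<^sub>m B"
      unfolding adj(2) using mult_smult_assoc_mat[OF one_carrier_mat B] B by simp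
    finally have "A * - (adj_mat A * B) = - (det A \<cdot>\<^sub>m B)"
      using A AB by (subst uminus_mult_right_mat) auto
    moreover have "B * (det A \<cdot>\<^sub>m 1\<^sub>m t) = det A \<cdot>\<^sub>m B"
      using B by (intro eq_matI) (auto simp: scalar_prod_def if_distrib[of "\<lambda>x. _ * x"] cong: if_cong)
    ultimately show ?thesis using B by (intro eq_matI) auto
  qed
  also have "C * - (adj_mat A * B) + D * (det A \<cdot>\<^sub>m 1\<^sub>m t) = det A \<cdot>\<^sub>m D - C * (adj_mat A * B)"
  proof -
    have "C * - (adj_mat A * B) = - (C * (adj_mat A * B))"
      using C AB by (subst uminus_mult_right_mat) auto
    moreover have "D * (det A \<cdot>\<^sub>m 1\<^sub>m t) = det A \<cdot>\<^sub>m D"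
      using D by (intro eq_matI) (auto simp: scalar_prod_def if_distrib[of "\<lambda>x. _ * x"] cong: if_cong)
    moreover have "C * (adj_mat A * B) \<in> carrier_mat t t" by (rule mult_carrier_mat[OF C AB])
    moreover have "- P + S = S - P" if "P \<in> carrier_mat t t" "S \<in> carrier_mat t t" for P S :: "'a mat"
      using that by (intro eq_matI) auto
    ultimately show ?thesis using D by simp
  qed
  finally have MP: "four_block_mat A B C D * ?P =
      four_block_mat A (0\<^sub>m r t) C (det A \<cdot>\<^sub>m D - C * (adj_mat A * B))" .
  have "det ?P = det A ^ t"
    using AB by (subst det_four_block_mat_lower_left_zero[of _ r _ t]) auto
  then have "det A ^ t * det (four_block_mat A B C D) = det (four_block_mat A B C D * ?P)"
    by (subst det_mult[of _ "r + t"]) (use assms AB in \<open>auto intro!: four_block_carrier_mat mult.commute\<close>)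
  also have "\<dots> = det A * det (det A \<cdot>\<^sub>m D - C * (adj_mat A * B))"
    unfolding MP
  proof (rule det_four_block_mat_upper_right_zero[OF A refl C])
    show "det A \<cdot>\<^sub>m D - C * (adj_mat A * B) \<in> carrier_mat t t"
      by (rule minus_carrier_mat[OF mult_carrier_mat[OF C AB]])
  qed
  finally show ?thesis .
qed

text \<open>Both sides carry extra powers of the pivot minor so that no division occurs.\<close>

lemma sylvester_identity:
  fixes a :: "nat \<Rightarrow> nat \<Rightarrow> 'a::idom" and r t :: nat
  defines "\<Delta> \<equiv> det (mat r r (\<lambda>(i, j). a i j))"
  shows "\<Delta> ^ (2 * t) * det (mat (r + t) (r + t) (\<lambda>(i, j). a i j)) =
    \<Delta> * det (mat t t (\<lambda>(i, j). \<Delta> * det (mat (Suc r) (Suc r)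
      (\<lambda>(k, l). a (if k < r then k else r + i) (if l < r then l else r + j)))))"
proof -
  define A where "A = mat r r (\<lambda>(i, j). a i j)"
  define E where "E t b = \<Delta> \<cdot>\<^sub>m mat t t (\<lambda>(i, j). b (r + i) (r + j)) -
      mat t r (\<lambda>(i, j). b (r + i) j) * (adj_mat A * mat r t (\<lambda>(i, j). b i (r + j)))" for t and b :: "nat \<Rightarrow> nat \<Rightarrow> 'a"
  have A: "A \<in> carrier_mat r r" and \<Delta>: "\<Delta> = det A" by (auto simp: A_def \<Delta>_def)
  note adj = adj_mat(1)[OF A]
  have schur: "\<Delta> ^ t * det (mat (r + t) (r + t) (\<lambda>(i, j). b i j)) = \<Delta> * det (E t b)"
    if "\<And>i j. i < r \<Longrightarrow> j < r \<Longrightarrow> b i j = a i j" for t b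
  proof -
    have "mat (r + t) (r + t) (\<lambda>(i, j). b i j) =
        four_block_mat A (mat r t (\<lambda>(i, j). b i (r + j))) (mat t r (\<lambda>(i, j). b (r + i) j))
          (mat t t (\<lambda>(i, j). b (r + i) (r + j)))"
      using that by (intro eq_matI) (auto simp: A_def)
    then show ?thesis using schur_complement[OF A, of "mat r t (\<lambda>(i, j). b i (r + j))" t] by (simp add: E_def \<Delta>)
  qed
  have E_dim: "E t b \<in> carrier_mat t t" for t b using adj by (auto simp: E_def)
  \<comment> \<open>A bordered minor is the case \<open>t = 1\<close> of the same elimination with
    the same pivot block, so up to the factor \<open>\<Delta>\<close> it is an entry of
    \<open>E t a\<close>.\<close>
  have entry: "\<Delta> * E t a $$ (i, j) = \<Delta> * det (mat (Suc r) (Suc r)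
      (\<lambda>(k, l). a (if k < r then k else r + i) (if l < r then l else r + j)))" if ij: "i < t" "j < t" for i j
  proof -
    let ?b = "\<lambda>k l. a (if k < r then k else r + i) (if l < r then l else r + j)"
    have "\<Delta> ^ 1 * det (mat (r + 1) (r + 1) (\<lambda>(k, l). ?b k l)) = \<Delta> * det (E 1 ?b)"
      by (rule schur) auto
    then have "\<Delta> * det (mat (Suc r) (Suc r) (\<lambda>(k, l). ?b k l)) = \<Delta> * det (E 1 ?b)"
      by (simp only: power_one_right Suc_eq_plus1)
    moreover have "E 1 ?b $$ (0, 0) = E t a $$ (i, j)"
      using ij adj unfolding E_def by (simp add: scalar_prod_def row_def col_def)
    moreover have "det (E 1 ?b) = E 1 ?b $$ (0, 0)" using det_single[OF E_dim[of 1]] E_dim[of 1 ?b] by simp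
    ultimately show ?thesis by (simp only:)
  qed
  \<comment> \<open>One \<open>\<Delta> ^ t\<close> pays for the elimination; the other is spread
    over the rows of \<open>E t a\<close>, so that \<open>entry\<close> applies to each
    entry.\<close>
  have "\<Delta> ^ (2 * t) * det (mat (r + t) (r + t) (\<lambda>(i, j). a i j)) =
      \<Delta> ^ t * (\<Delta> ^ t * det (mat (r + t) (r + t) (\<lambda>(i, j). a i j)))"
    by (simp add: power_add mult_2 mult.assoc)
  also have "\<dots> = \<Delta> * (\<Delta> ^ t * det (E t a))" by (subst schur) auto
  also have "\<Delta> ^ t * det (E t a) = det (\<Delta> \<cdot>\<^sub>m E t a)" using E_dim[of t a] by simp
  also have "\<Delta> \<cdot>\<^sub>m E t a = mat t t (\<lambda>(i, j). \<Delta> * det (mat (Suc r) (Suc r)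
      (\<lambda>(k, l). a (if k < r then k else r + i) (if l < r then l else r + j))))"
    using E_dim[of t a] by (intro eq_matI) (auto simp: entry)
  finally show ?thesis .
qed

section \<open>Minors of the block Hankel matrix\<close>

definition hvar :: "nat \<Rightarrow> nat \<Rightarrow> nat \<times> nat" where
  "hvar p q = (p div 2 + q div 2, p mod 2 + q mod 2)"

text \<open>The index maps are arbitrary, so that deleting a row and a column stays within this
  form; \<open>admissible\<close> singles out the submatrices of the middle Hankel matrix.\<close>

definition hmat :: "nat \<Rightarrow> (nat \<Rightarrow> nat) \<Rightarrow> (nat \<Rightarrow> nat) \<Rightarrow> ('k::comm_ring_1) hpoly mat" where
  "hmat n f g = mat n n (\<lambda>(i, j). Var (hvar (f i) (g j)))"

definition admissible :: "nat \<Rightarrow> nat \<Rightarrow> (nat \<Rightarrow> nat) \<Rightarrow> (nat \<Rightarrow> nat) \<Rightarrow> bool" where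
  "admissible d n f g \<longleftrightarrow> strict_mono_on {..<n} f \<and> strict_mono_on {..<n} g \<and>
    (\<forall>i<n. f i < 2 * (d div 2 + 1) \<and> g i < 2 * (d - d div 2 + 1))"

lemma pick_strict_mono_image:
  assumes "strict_mono_on {..<n} f" "i < n"
  shows "pick (f ` {..<n}) i = f i"
  using assms(2)
proof (induction i)
  case 0
  have "f 0 \<le> f j" if "j < n" for j
    using that strict_mono_on_leD[OF assms(1), of 0 j] 0 by auto
  then show ?case using 0 by (auto intro!: Least_equality)
next
  case (Suc i)
  have "f i < f (Suc i)" using Suc.prems by (intro strict_mono_onD[OF assms(1)]) auto
  moreover have "f (Suc i) \<le> f j" if "j < n" "f i < f j" for j
  proof -
    have "i < j"
    proof (rule ccontr)
      assume "\<not> i < j"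
      then have "f j \<le> f i" using that Suc.prems by (intro strict_mono_on_leD[OF assms(1)]) auto
      then show False using that by simp
    qed
    then show ?thesis using that Suc.prems by (intro strict_mono_on_leD[OF assms(1)]) auto
  qed
  ultimately show ?case using Suc by (auto intro!: Least_equality)
qed

lemma block_hankel_index:
  assumes "k \<le> d" "p < 2 * (k + 1)" "q < 2 * (d - k + 1)"
  shows "block_hankel d k $$ (p, q) = Var (hvar p q)"
proof -
  have "A_block i $$ (a, b) = Var (i, a + b)" if "a < 2" "b < 2" for i a b
  proof -
    have "a = 0 \<or> a = 1" "b = 0 \<or> b = 1" using that by auto
    then show ?thesis by (auto simp: A_block_def mat_of_rows_list_def numeral_2_eq_2)
  qed
  from this[of "p mod 2" "q mod 2"] show ?thesis using assms by (simp add: block_hankel_def hvar_def)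
qed

lemma square_submatrices_block_hankel:
  "square_submatrices n (block_hankel d (d div 2)) = {hmat n f g | f g. admissible d n f g}"
proof (intro equalityI subsetI)
  let ?k = "d div 2"
  fix N :: "'a hpoly mat"
  assume "N \<in> square_submatrices n (block_hankel d ?k)"
  then obtain I J where IJ: "N = submatrix (block_hankel d ?k) I J" "I \<subseteq> {..<2 * (?k + 1)}"
    "J \<subseteq> {..<2 * (d - ?k + 1)}" "card I = n" "card J = n"
    by (auto simp: square_submatrices_def block_hankel_def)
  have I: "pick I i \<in> I" "pick J i \<in> J" if "i < n" for i using IJ that by (auto intro: pick_in_set_le)
  have "strict_mono_on {..<n} (pick I)" "strict_mono_on {..<n} (pick J)"
    using IJ by (auto intro!: strict_mono_onI pick_mono)
  then have adm: "admissible d n (pick I) (pick J)"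
    using I IJ(2,3) by (fastforce simp: admissible_def)
  moreover have "N = hmat n (pick I) (pick J)"
  proof -
    have "{i. i < 2 * (?k + 1) \<and> i \<in> I} = I" "{j. j < 2 * (d - ?k + 1) \<and> j \<in> J} = J" using IJ by auto
    then have dims: "dim_row N = n" "dim_col N = n"
      unfolding IJ(1) dim_submatrix using IJ(4,5) by (auto simp: block_hankel_def)
    show ?thesis
    proof (rule eq_matI)
      fix i j assume "i < dim_row (hmat n (pick I) (pick J) :: 'a hpoly mat)"
        "j < dim_col (hmat n (pick I) (pick J) :: 'a hpoly mat)"
      then have ij: "i < n" "j < n" by (auto simp: hmat_def)
      have "N $$ (i, j) = block_hankel d ?k $$ (pick I i, pick J j)"
        using ij dims unfolding IJ(1) submatrix_def by (simp add: dim_submatrix)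
      also have "\<dots> = Var (hvar (pick I i) (pick J j))"
        using adm ij by (intro block_hankel_index) (auto simp: admissible_def)
      finally show "N $$ (i, j) = hmat n (pick I) (pick J) $$ (i, j)" using ij by (simp add: hmat_def)
    qed (use dims in \<open>auto simp: hmat_def\<close>)
  qed
  ultimately show "N \<in> {hmat n f g | f g. admissible d n f g}" by blast
next
  let ?k = "d div 2"
  fix N :: "'a hpoly mat"
  assume "N \<in> {hmat n f g | f g. admissible d n f g}"
  then obtain f g where N: "N = hmat n f g" and adm: "admissible d n f g" by blast
  let ?I = "f ` {..<n}" and ?J = "g ` {..<n}"
  have mono: "strict_mono_on {..<n} f" "strict_mono_on {..<n} g" using adm by (auto simp: admissible_def)
  have sub: "?I \<subseteq> {..<2 * (?k + 1)}" "?J \<subseteq> {..<2 * (d - ?k + 1)}" using adm by (auto simp: admissible_def)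
  have card: "card ?I = n" "card ?J = n"
    using mono by (simp_all add: card_image strict_mono_on_imp_inj_on)
  have "{i. i < 2 * (?k + 1) \<and> i \<in> ?I} = ?I" "{j. j < 2 * (d - ?k + 1) \<and> j \<in> ?J} = ?J"
    using sub by auto
  then have dims: "card {i. i < dim_row (block_hankel d ?k :: 'a hpoly mat) \<and> i \<in> ?I} = n"
    "card {j. j < dim_col (block_hankel d ?k :: 'a hpoly mat) \<and> j \<in> ?J} = n"
    using card by (simp_all add: block_hankel_def)
  have "N = submatrix (block_hankel d ?k) ?I ?J"
  proof (rule eq_matI)
    fix i j assume "i < dim_row (submatrix (block_hankel d ?k :: 'a hpoly mat) ?I ?J)"
      "j < dim_col (submatrix (block_hankel d ?k :: 'a hpoly mat) ?I ?J)"
    then have ij: "i < n" "j < n" using dims by (simp_all only: dim_submatrix)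
    have "submatrix (block_hankel d ?k) ?I ?J $$ (i, j) = (block_hankel d ?k $$ (f i, g j) :: 'a hpoly)"
      using ij dims mono by (subst submatrix_index) (simp_all only: pick_strict_mono_image)
    also have "\<dots> = Var (hvar (f i) (g j))"
      using adm ij by (intro block_hankel_index) (auto simp: admissible_def)
    finally show "N $$ (i, j) = submatrix (block_hankel d ?k) ?I ?J $$ (i, j)"
      using ij by (simp add: N hmat_def)
  qed (use dims in \<open>simp_all only: dim_submatrix N hmat_def dim_row_mat dim_col_mat\<close>)
  then show "N \<in> square_submatrices n (block_hankel d ?k)"
    using sub card unfolding square_submatrices_def by (auto simp: block_hankel_def)
qed

text \<open>The exponents of \<open>w t\<^sup>i v\<^sup>j\<close>, as finitely supported functions because these form an ordered monoid.\<close>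

definition hphi :: "nat \<times> nat \<Rightarrow> nat \<Rightarrow>\<^sub>0 nat" where
  "hphi v = single 0 1 + single 1 (fst v) + single 2 (snd v)"

interpretation hk: grading hphi .

text \<open>The exponent is a row part plus a column part: at an orbit point the Hankel matrix has
  rank one.\<close>

lemma hphi_hvar:
  "hphi (hvar p q) = (single 0 1 + single 1 (p div 2) + single 2 (p mod 2)) +
    (single 1 (q div 2) + single 2 (q mod 2))"
  by (simp add: hphi_def hvar_def single_add ac_simps)

lemma mat_delete_hmat:
  assumes "i < n" "j < n"
  obtains f' g' where "mat_delete (hmat n f g) i j = hmat (n - 1) f' g'"
  by (rule that[of "\<lambda>k. f (if k < i then k else Suc k)" "\<lambda>k. g (if k < j then k else Suc k)"])
    (use assms in \<open>auto simp: mat_delete_def hmat_def intro!: eq_matI\<close>)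

text \<open>Adding an orbit point is a rank one update, so each coefficient of the expansion
  combines the minor itself with minors of size \<open>n - 1\<close>. The latter vanish to order
  \<open>n - 1 - r = n - Suc r\<close> by induction, the former to no smaller an order.\<close>

lemma det_hmat_vanishing:
  "det (hmat n f g) \<in> (hk.vanishing r (n - r) :: ('k::field) hpoly set)"
proof (induction r arbitrary: n f g)
  case 0
  have "(\<Prod>i = 0..<n. hmat n f g $$ (i, p i)) \<in> (hk.vanishing 0 n :: 'k hpoly set)"
    if p: "p permutes {0..<n}" for p
  proof -
    have "(\<Prod>i\<in>A. Var (hvar (f i) (g (p i)))) \<in> (hk.vanishing 0 (card A) :: 'k hpoly set)"
      if "finite A" for A
      using that
    proof (induction A)
      case (insert i A)
      have "Var (hvar (f i) (g (p i))) \<in> (hk.vanishing 0 1 :: 'k hpoly set)"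
        by (simp add: Var_def)
      from hk.vanishing_mult[OF this insert.IH] show ?case using insert.hyps by (simp del: hk.vanishing.simps)
    qed simp
    from this[of "{0..<n}"] show ?thesis
      using permutes_in_image[OF p] by (simp add: hmat_def del: hk.vanishing.simps)
  qed
  then show ?case
    by (subst det_def'[of _ n])
      (auto simp: hmat_def simp del: hk.vanishing.simps intro!: hk.vanishing_sum hk.vanishing_mult_left)
next
  case (Suc r)
  define h where "h = (hk.expand :: 'k hpoly \<Rightarrow> _)"
  interpret h: comm_ring_hom h
    by standard (simp_all add: h_def hk.expand_simps)
  define c :: "'k hpoly \<Rightarrow> (nat \<Rightarrow>\<^sub>0 nat) \<Rightarrow>\<^sub>0 'k hpoly" where
    "c = single 0"
  interpret c: comm_ring_hom c
    by standard (simp_all add: c_def single_add mult_single)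
  define u :: "nat \<Rightarrow> (nat \<Rightarrow>\<^sub>0 nat) \<Rightarrow>\<^sub>0 'k hpoly" where
    "u i = single (single 0 1 + single 1 (f i div 2) +
      single 2 (f i mod 2)) 1" for i
  define v :: "nat \<Rightarrow> (nat \<Rightarrow>\<^sub>0 nat) \<Rightarrow>\<^sub>0 'k hpoly" where
    "v j = single (single 1 (g j div 2) + single 2 (g j mod 2)) 1" for j
  define N where "N = map_mat c (hmat n f g)"
  have N: "N \<in> carrier_mat n n" by (simp add: N_def hmat_def)
  have "map_mat h (hmat n f g) = mat n n (\<lambda>(i, j). N $$ (i, j) + u i * v j)"
    by (rule eq_matI) (auto simp: hmat_def N_def h_def hk.expand_simps c_def u_def v_def mult_single hphi_hvar)
  moreover obtain a where "det (mat n n (\<lambda>(i, j). N $$ (i, j) + u i * v j)) =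
      det N + (\<Sum>i<n. \<Sum>j<n. a i j * det (mat_delete N i j))"
    using det_rank_one_update[OF N] .
  ultimately have expand: "h (det (hmat n f g)) = det N + (\<Sum>i<n. \<Sum>j<n. a i j * det (mat_delete N i j))"
    by (simp add: h.hom_det[symmetric])
  have scale: "lookup (x * c q) t \<in> hk.vanishing r (n - Suc r)" if "q \<in> hk.vanishing r (n - Suc r)" for x q t
    using that by (simp add: c_def mult.commute[of x] lookup_single_0_times mult.commute[of q] hk.vanishing_mult_left)
  have "lookup (h (det (hmat n f g))) t \<in> hk.vanishing r (n - Suc r)" for t
    unfolding expand lookup_add lookup_sum
  proof (intro hk.vanishing_add hk.vanishing_sum)
    have "det (hmat n f g) \<in> (hk.vanishing r (n - Suc r) :: 'k hpoly set)"
      using Suc.IH[of n f g] by (rule hk.vanishing_antimono[rotated]) simp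
    from scale[OF this, of 1] show "lookup (det N) t \<in> hk.vanishing r (n - Suc r)"
      by (simp add: N_def c.hom_det)
    fix i j assume "i \<in> {..<n}" "j \<in> {..<n}"
    then have ij: "i < n" "j < n" by auto
    obtain f' g' where fg: "mat_delete (hmat n f g) i j = (hmat (n - 1) f' g' :: 'k hpoly mat)"
      using mat_delete_hmat[OF ij] .
    have "mat_delete N i j = map_mat c (mat_delete (hmat n f g) i j)"
      using ij by (intro eq_matI) (auto simp: mat_delete_def N_def hmat_def)
    then have "det (mat_delete N i j) = c (det (hmat (n - 1) f' g'))" by (simp add: fg c.hom_det)
    then show "lookup (a i j * det (mat_delete N i j)) t \<in> hk.vanishing r (n - Suc r)"
      using scale[OF Suc.IH[of "n - 1" f' g', simplified], of "a i j"] by simp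
  qed
  then show ?case by (simp add: hk.hasse_def h_def)
qed

section \<open>The poset of Hankel variables\<close>

text \<open>Every variable has a position in \<open>X\<^bsub>d div 2\<^esub>\<close> close to the diagonal. Two variables are
  comparable if both coordinates of their positions increase strictly, so that a chain is the
  diagonal of a submatrix.\<close>

definition row_pos :: "nat \<times> nat \<Rightarrow> nat" where
  "row_pos v = (if even (fst v) then fst v + of_bool (snd v = 2) else fst v - of_bool (snd v = 0))"

definition col_pos :: "nat \<times> nat \<Rightarrow> nat" where
  "col_pos v = 2 * fst v + snd v - row_pos v"

definition hless :: "nat \<times> nat \<Rightarrow> nat \<times> nat \<Rightarrow> bool" where
  "hless u v \<longleftrightarrow> row_pos u < row_pos v \<and> col_pos u < col_pos v"

lemma hless_irrefl: "\<not> hless u u" and hless_trans: "hless u v \<Longrightarrow> hless v w \<Longrightarrow> hless u w"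
  by (auto simp: hless_def)

lemma finite_hankel_vars: "finite (hankel_vars d)"
  by (simp add: hankel_vars_def)

lemma hankel_vars_cases:
  assumes "v \<in> hankel_vars d"
  obtains i where "i \<le> d" "v = (i, 0)" | i where "i \<le> d" "v = (i, 1)" | i where "i \<le> d" "v = (i, 2)"
proof -
  obtain i j where v: "v = (i, j)" "i \<le> d" "j \<le> 2" using assms by (auto simp: hankel_vars_def)
  then have "j = 0 \<or> j = 1 \<or> j = 2" by auto
  then show thesis using v that by auto
qed

lemma hvar_pos:
  assumes "v \<in> hankel_vars d"
  shows "hvar (row_pos v) (col_pos v) = v"
  using assms
proof (cases rule: hankel_vars_cases)
  case (1 i)
  then show ?thesis by (cases "even i") (auto simp: hvar_def row_pos_def col_pos_def elim!: evenE oddE)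
next
  case (2 i)
  then show ?thesis by (cases "even i") (auto simp: hvar_def row_pos_def col_pos_def elim!: evenE oddE)
next
  case (3 i)
  then show ?thesis by (cases "even i") (auto simp: hvar_def row_pos_def col_pos_def elim!: evenE oddE)
qed

lemma pos_bounds:
  assumes "v \<in> hankel_vars d"
  shows "row_pos v < 2 * (d div 2 + 1)" "col_pos v < 2 * (d - d div 2 + 1)"
proof -
  show "row_pos v < 2 * (d div 2 + 1)"
    using assms by (cases rule: hankel_vars_cases) (simp_all add: row_pos_def, presburger+)
  show "col_pos v < 2 * (d - d div 2 + 1)"
    using assms by (cases rule: hankel_vars_cases) (simp_all add: row_pos_def col_pos_def, presburger+)
qed

lemma hvar_in_hankel_vars:
  assumes "p < 2 * (d div 2 + 1)" "q < 2 * (d - d div 2 + 1)"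
  shows "hvar p q \<in> hankel_vars d"
proof -
  have "p div 2 \<le> d div 2" "q div 2 \<le> d - d div 2" "p mod 2 \<le> 1" "q mod 2 \<le> 1" using assms by auto
  moreover have "d div 2 \<le> d" by simp
  ultimately have "p div 2 + q div 2 \<le> d" "p mod 2 + q mod 2 \<le> 2" by linarith+
  then show ?thesis by (simp add: hvar_def hankel_vars_def)
qed

text \<open>This and the next two lemmas list comparabilities that confine an antichain to two
  consecutive levels and restrict which variables it uses there.\<close>

lemma hless_levels:
  assumes "i + 2 \<le> i'" "j \<le> 2" "j' \<le> 2"
  shows "hless (i, j) (i', j')"
proof -
  have "j = 0 \<or> j = 1 \<or> j = 2" "j' = 0 \<or> j' = 1 \<or> j' = 2" using assms by auto
  then show ?thesis
    using assms(1) by (elim disjE; simp add: hless_def row_pos_def col_pos_def; presburger)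
qed

lemma hless_same_level: "hless (i, 0) (i, 2)"
  by (auto simp: hless_def row_pos_def col_pos_def elim!: oddE)

lemma hless_next_level: "j \<le> 1 \<Longrightarrow> 1 \<le> j' \<Longrightarrow> j' \<le> 2 \<Longrightarrow> hless (i, j) (Suc i, j')"
  by (cases "even i") (auto simp: hless_def row_pos_def col_pos_def le_Suc_eq numeral_2_eq_2 elim!: evenE oddE)

section \<open>Straightening modulo the two-minors\<close>

definition antichain_on :: "(nat \<times> nat) set \<Rightarrow> bool" where
  "antichain_on A \<longleftrightarrow> (\<forall>u\<in>A. \<forall>v\<in>A. \<not> hless u v)"

text \<open>The variable at position \<open>(p, q)\<close> contributes \<open>(p + q)\<^sup>2 + 1\<close>: the sum of the squares drops when the
  diagonal of a two-minor is replaced by its antidiagonal, and the summand 1 leaves only finitely many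
  monomials of bounded energy.\<close>

definition energy :: "(nat \<times> nat) pmonom \<Rightarrow> nat" where
  "energy m = (\<Sum>v\<in>keys m. lookup m v * ((2 * fst v + snd v)\<^sup>2 + 1))"

lemma energy_superset:
  "finite S \<Longrightarrow> keys m \<subseteq> S \<Longrightarrow>
    energy m = (\<Sum>v\<in>S. lookup m v * ((2 * fst v + snd v)\<^sup>2 + 1))"
  unfolding energy_def by (rule sum.mono_neutral_left) (auto simp: in_keys_iff)

lemma energy_add: "energy (m + n) = energy m + energy n"
proof -
  let ?S = "keys m \<union> keys n"
  have "energy (m + n) = (\<Sum>v\<in>?S. lookup (m + n) v * ((2 * fst v + snd v)\<^sup>2 + 1))"
    by (intro energy_superset) (auto simp: keys_add_nat)
  then show ?thesis
    using energy_superset[of ?S m] energy_superset[of ?S n] by (simp add: lookup_add add_mult_distrib sum.distrib)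
qed

lemma energy_zero [simp]: "energy 0 = 0"
  by (simp add: energy_def)

lemma energy_sum: "energy (sum f A) = (\<Sum>x\<in>A. energy (f x))"
  by (induction A rule: infinite_finite_induct) (auto simp: energy_add)

lemma energy_hvar: "energy (single (hvar p q) 1) = (p + q)\<^sup>2 + 1"
proof -
  have "2 * (p div 2 + q div 2) + (p mod 2 + q mod 2) = p + q"
    by presburger
  then show ?thesis by (simp add: energy_def hvar_def)
qed

text \<open>The antidiagonal monomial of the two-minor whose diagonal consists of \<open>u\<close>
  and \<open>v\<close>.\<close>

definition flip :: "nat \<times> nat \<Rightarrow> nat \<times> nat \<Rightarrow> (nat \<times> nat) pmonom" where
  "flip u v = single (hvar (row_pos u) (col_pos v)) 1 + single (hvar (row_pos v) (col_pos u)) 1"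

lemma flip_monoms_in: "u \<in> hankel_vars d \<Longrightarrow> v \<in> hankel_vars d \<Longrightarrow> flip u v \<in> monoms_in (hankel_vars d)"
  using pos_bounds[of u d] pos_bounds[of v d]
  by (auto simp: flip_def monoms_in_def keys_add_nat intro!: hvar_in_hankel_vars)

lemma gr_flip:
  assumes "u \<in> hankel_vars d" "v \<in> hankel_vars d"
  shows "hk.gr (flip u v) = hk.gr (single u 1 + single v 1)"
  unfolding flip_def hk.gr_add hk.gr_single
  by (subst (2) hvar_pos[OF assms(1), symmetric], subst (3) hvar_pos[OF assms(2), symmetric])
    (simp add: hphi_hvar ac_simps)

lemma energy_flip:
  assumes "u \<in> hankel_vars d" "v \<in> hankel_vars d" "hless u v"
  shows "energy (flip u v) < energy (single u 1 + single v 1)"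
proof -
  obtain a b where ab: "row_pos v = row_pos u + a" "col_pos v = col_pos u + b" "0 < a" "0 < b"
    using assms(3) unfolding hless_def by (metis less_imp_add_positive)
  have e: "energy (single w 1) = (row_pos w + col_pos w)\<^sup>2 + 1" if "w \<in> hankel_vars d" for w
    using energy_hvar[of "row_pos w" "col_pos w"] hvar_pos[OF that] by simp
  \<comment> \<open>For corners at offsets \<open>a\<close> and \<open>b\<close> the two sums of
    squares differ by exactly \<open>2 * a * b\<close>.\<close>
  have "0 < 2 * a * b" using ab by simp
  then show ?thesis
    unfolding flip_def energy_add energy_hvar e[OF assms(1)] e[OF assms(2)] ab
    by (simp add: power2_eq_square algebra_simps)
qed

definition pos_pair :: "(nat \<times> nat \<Rightarrow> nat) \<Rightarrow> nat \<times> nat \<Rightarrow> nat \<times> nat \<Rightarrow> nat \<Rightarrow> nat" where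
  "pos_pair P u v i = (if i = 0 then P u else P v)"

lemma det_hmat_pair:
  assumes "u \<in> hankel_vars d" "v \<in> hankel_vars d"
  shows "det (hmat 2 (pos_pair row_pos u v) (pos_pair col_pos u v)) =
    pmono (single u 1 + single v 1) - (pmono (flip u v) :: ('k::field) hpoly)"
proof -
  have "det A = A $$ (0, 0) * A $$ (1, 1) - A $$ (0, 1) * A $$ (1, 0)" if "A \<in> carrier_mat 2 2"
    for A :: "'k hpoly mat"
  proof -
    have "mat_delete A 0 j \<in> carrier_mat 1 1" if "j < 2" for j using \<open>A \<in> _\<close> that by (simp add: mat_delete_def)
    from det_single[OF this]
    have "det (mat_delete A 0 0) = mat_delete A 0 0 $$ (0, 0)" "det (mat_delete A 0 1) = mat_delete A 0 1 $$ (0, 0)"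
      by simp_all
    moreover have "mat_delete A 0 0 $$ (0, 0) = A $$ (1, 1)" "mat_delete A 0 1 $$ (0, 0) = A $$ (1, 0)"
      using that by (simp_all add: mat_delete_def)
    ultimately have "det (mat_delete A 0 0) = A $$ (1, 1)" "det (mat_delete A 0 1) = A $$ (1, 0)"
      by (simp_all only:)
    then show ?thesis
      unfolding laplace_expansion_row[OF that zero_less_numeral] numeral_2_eq_2 sum.lessThan_Suc
      by (simp add: cofactor_def)
  qed
  from this[of "hmat 2 (pos_pair row_pos u v) (pos_pair col_pos u v)"] show ?thesis
    using hvar_pos[OF assms(1)] hvar_pos[OF assms(2)]
    by (simp add: hmat_def pos_pair_def flip_def pmono_add Var_pmono)
qed

lemma admissible_pair:
  assumes "u \<in> hankel_vars d" "v \<in> hankel_vars d" "hless u v"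
  shows "admissible d 2 (pos_pair row_pos u v) (pos_pair col_pos u v)"
  using assms pos_bounds[OF assms(1)] pos_bounds[OF assms(2)]
  by (auto simp: admissible_def pos_pair_def hless_def strict_mono_on_def)

lemma hmat_carrier:
  assumes "admissible d n f g"
  shows "det (hmat n f g) \<in> carrier (poly_ring (hankel_vars d) :: ('k::field) hpoly ring)"
proof -
  have "hmat n f g \<in> carrier_mat n n" by (simp add: hmat_def)
  moreover have "hmat n f g $$ (i, p i) \<in> carrier (poly_ring (hankel_vars d))"
    if "p permutes {0..<n}" "i < n" for i p
    using assms that permutes_in_image[OF that(1), of i]
    by (auto simp: hmat_def admissible_def intro!: poly_ring_closed(9) hvar_in_hankel_vars)
  moreover have "signof p \<in> carrier (poly_ring (hankel_vars d) :: 'k hpoly ring)" for p :: "nat \<Rightarrow> nat"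
    by (auto simp: sign_def intro: poly_ring_closed)
  ultimately show ?thesis
    by (subst det_def'[of _ n]) (auto intro!: poly_ring_sum poly_ring_closed(1) poly_ring_prod)
qed

lemma hankel_ideal_is_ideal: "ideal (hankel_ideal d) (poly_ring (hankel_vars d) :: ('k::field) hpoly ring)"
  and minor_in_hankel_ideal: "admissible d 2 f g \<Longrightarrow> det (hmat 2 f g) \<in> (hankel_ideal d :: 'k hpoly set)"
  and hankel_ideal_minimal: "ideal I (poly_ring (hankel_vars d)) \<Longrightarrow>
    (\<And>f g. admissible d 2 f g \<Longrightarrow> det (hmat 2 f g) \<in> (I :: 'k hpoly set)) \<Longrightarrow> hankel_ideal d \<subseteq> I"
proof -
  have sub: "det ` square_submatrices 2 (block_hankel d (d div 2)) \<subseteq>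
      carrier (poly_ring (hankel_vars d) :: 'k hpoly ring)"
    unfolding square_submatrices_block_hankel by (auto intro: hmat_carrier)
  note gen = genideal_poly_ring[OF sub, folded hankel_ideal_def]
  show "ideal (hankel_ideal d) (poly_ring (hankel_vars d) :: 'k hpoly ring)" by (rule gen)
  show "det (hmat 2 f g) \<in> (hankel_ideal d :: 'k hpoly set)" if "admissible d 2 f g"
    using gen(2) that unfolding square_submatrices_block_hankel by blast
  show "hankel_ideal d \<subseteq> I" if "ideal I (poly_ring (hankel_vars d))"
    "\<And>f g. admissible d 2 f g \<Longrightarrow> det (hmat 2 f g) \<in> (I :: 'k hpoly set)"
    using that by (intro gen(3)) (auto simp: square_submatrices_block_hankel)
qed

lemma straighten_step:
  assumes "m \<in> monoms_in (hankel_vars d)" "\<not> antichain_on (keys m)"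
  obtains u v k where "u \<in> hankel_vars d" "v \<in> hankel_vars d" "hless u v" "k \<in> monoms_in (hankel_vars d)"
    "m = single u 1 + single v 1 + k"
proof -
  obtain u v where uv: "u \<in> keys m" "v \<in> keys m" "hless u v"
    using assms(2) by (auto simp: antichain_on_def)
  have ne: "u \<noteq> v" using uv(3) hless_irrefl by metis
  define k where "k = m - (single u 1 + single v 1)"
  have m: "m = single u 1 + single v 1 + k"
  proof (rule poly_mapping_eqI)
    fix w
    show "lookup m w = lookup (single u 1 + single v 1 + k) w"
      using uv ne by (auto simp: k_def lookup_add lookup_minus lookup_single when_def in_keys_iff)
  qed
  moreover have "k \<in> monoms_in (hankel_vars d)"
    using assms(1) unfolding m by (simp add: monoms_in_def keys_add_nat)
  moreover have "u \<in> hankel_vars d" "v \<in> hankel_vars d" using uv assms(1) by (auto simp: monoms_in_def)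
  ultimately show thesis using that uv(3) by blast
qed

text \<open>While two variables of the monomial are comparable, exchange their product for the flip:
  this subtracts a multiple of a two-minor, keeps the degree in the grading and lowers the energy,
  so it ends at an antichain.\<close>

lemma straighten:
  assumes "m \<in> monoms_in (hankel_vars d)"
  obtains n where "n \<in> monoms_in (hankel_vars d)" "antichain_on (keys n)" "hk.gr n = hk.gr m"
    "pmono m - pmono n \<in> (hankel_ideal d :: ('k::field) hpoly set)"
proof -
  note I = ideal_poly_ringD[OF hankel_ideal_is_ideal[of d, where 'k = 'k]]
  have "\<exists>n. n \<in> monoms_in (hankel_vars d) \<and> antichain_on (keys n) \<and> hk.gr n = hk.gr m \<and>
    pmono m - pmono n \<in> (hankel_ideal d :: 'k hpoly set)"
    using assms
  proof (induction "energy m" arbitrary: m rule: less_induct)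
    case less
    show ?case
    proof (cases "antichain_on (keys m)")
      case True
      then show ?thesis using less.prems I(2) by (intro exI[of _ m]) simp
    next
      case False
      then obtain u v k where uv: "u \<in> hankel_vars d" "v \<in> hankel_vars d" "hless u v"
        and k: "k \<in> monoms_in (hankel_vars d)" and m: "m = single u 1 + single v 1 + k"
        using straighten_step less.prems by metis
      let ?m = "flip u v + k"
      have "energy ?m < energy m" using energy_flip[OF uv] by (simp add: m energy_add)
      moreover have "?m \<in> monoms_in (hankel_vars d)"
        using flip_monoms_in[OF uv(1,2)] k by (simp add: monoms_in_def keys_add_nat)
      ultimately obtain n where n: "n \<in> monoms_in (hankel_vars d)" "antichain_on (keys n)"
        "hk.gr n = hk.gr ?m" "pmono ?m - pmono n \<in> (hankel_ideal d :: 'k hpoly set)"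
        using less.hyps by blast
      have "pmono k * det (hmat 2 (pos_pair row_pos u v) (pos_pair col_pos u v)) \<in> (hankel_ideal d :: 'k hpoly set)"
        using k admissible_pair[OF uv] by (intro I(4) minor_in_hankel_ideal poly_ring_closed)
      then have "pmono k * (pmono (single u 1 + single v 1) - pmono (flip u v)) +
          (pmono ?m - pmono n) \<in> (hankel_ideal d :: 'k hpoly set)"
        unfolding det_hmat_pair[OF uv(1,2)] using n(4) by (rule I(3))
      then have "pmono m - pmono n \<in> (hankel_ideal d :: 'k hpoly set)"
        unfolding m pmono_add by (simp add: algebra_simps)
      moreover have "hk.gr n = hk.gr m"
        using n(3) gr_flip[OF uv(1,2)] by (simp add: m hk.gr_add)
      ultimately show ?thesis using n by blast
    qed
  qed
  then show thesis using that by blast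
qed

section \<open>Antichains within a fibre of the grading\<close>

lemma hphi_lookup:
  "lookup (hphi v) 0 = 1" "lookup (hphi v) 1 = fst v" "lookup (hphi v) 2 = snd v"
  by (simp_all add: hphi_def lookup_add lookup_single)

lemma lookup_gr:
  assumes "finite S" "keys m \<subseteq> S"
  shows "lookup (hk.gr m) k = (\<Sum>v\<in>S. lookup m v * lookup (hphi v) k)"
  unfolding hk.gr_superset[OF assms] by (simp add: lookup_sum del: sum_constant) simp

text \<open>Levels two apart are comparable, so only the lowest level \<open>b\<close> and
  \<open>Suc b\<close> occur. Level \<open>b\<close> does occur, so the mean level lies in the
  half-open interval from \<open>b\<close> to \<open>Suc b\<close>, and its integer part
  \<open>a\<close>, which depends only on the fibre, is \<open>b\<close>.\<close>

lemma antichain_two_levels: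
  assumes "m \<in> monoms_in (hankel_vars d)" "antichain_on (keys m)" "m \<noteq> 0"
  defines "a \<equiv> lookup (hk.gr m) 1 div lookup (hk.gr m) 0"
  shows "keys m \<subseteq> {a, Suc a} \<times> {0, 1, 2}"
proof -
  let ?K = "keys m"
  define b where "b = Min (fst ` ?K)"
  have K: "finite ?K" "?K \<noteq> {}" using assms(3) by auto
  then have "b \<in> fst ` ?K" unfolding b_def by (intro Min_in) auto
  then obtain v0 where v0: "v0 \<in> ?K" "fst v0 = b" by auto
  have b: "b \<le> fst v" if "v \<in> ?K" for v using that K by (auto simp: b_def)
  have snd: "snd v \<le> 2" if "v \<in> ?K" for v using that assms(1) by (auto simp: monoms_in_def hankel_vars_def)
  have le: "fst v \<le> Suc b" if v: "v \<in> ?K" for v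
  proof (rule ccontr)
    assume "\<not> ?thesis"
    then have "hless (b, snd v0) (fst v, snd v)" using snd v v0 by (intro hless_levels) auto
    then show False using assms(2) v v0 by (auto simp: antichain_on_def)
  qed
  let ?N = "\<Sum>v\<in>?K. lookup m v"
  have N: "lookup (hk.gr m) 0 = ?N" "lookup (hk.gr m) 1 = (\<Sum>v\<in>?K. lookup m v * fst v)"
    using lookup_gr[of ?K m] hphi_lookup by (simp_all del: One_nat_def)
  have "?N * b \<le> (\<Sum>v\<in>?K. lookup m v * fst v)"
    unfolding sum_distrib_right by (intro sum_mono mult_left_mono b) auto
  moreover have "(\<Sum>v\<in>?K. lookup m v * fst v) < (\<Sum>v\<in>?K. lookup m v * Suc b)"
  proof (rule sum_strict_mono_ex1)
    show "\<exists>v\<in>?K. lookup m v * fst v < lookup m v * Suc b"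
    proof (rule bexI[of _ v0])
      have "lookup m v0 > 0" using v0(1) by (simp add: in_keys_iff)
      then show "lookup m v0 * fst v0 < lookup m v0 * Suc b"
        using v0(2) by simp
    qed (rule v0(1))
    show "\<forall>v\<in>?K. lookup m v * fst v \<le> lookup m v * Suc b"
      using le by (intro ballI mult_le_mono2)
  qed (rule K(1))
  then have "(\<Sum>v\<in>?K. lookup m v * fst v) < ?N * Suc b" by (simp only: sum_distrib_right)
  ultimately have "a = b"
    unfolding a_def N by (intro div_nat_eqI) (auto simp: mult.commute)
  moreover have "v \<in> {b, Suc b} \<times> {0, 1, 2}" if "v \<in> ?K" for v
  proof -
    have "fst v = b \<or> fst v = Suc b" "snd v = 0 \<or> snd v = 1 \<or> snd v = 2"
      using b[OF that] le[OF that] snd[OF that] by linarith+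
    then show ?thesis by (cases v) auto
  qed
  ultimately show ?thesis by blast
qed

text \<open>The two lowest levels are read off from the degree and the level sum; the variables allowed in an
  antichain are then met one after another as the sum of the second indices grows.\<close>

lemma antichain_fibre_unique:
  assumes m: "m \<in> monoms_in (hankel_vars d)" "antichain_on (keys m)"
    and n: "n \<in> monoms_in (hankel_vars d)" "antichain_on (keys n)"
    and gr: "hk.gr m = hk.gr n"
  shows "m = n"
proof (cases "m = 0 \<or> n = 0")
  case True
  have "pmdegree m = pmdegree n"
    using lookup_gr[of "keys m" m 0] lookup_gr[of "keys n" n 0] gr
    by (simp add: hphi_lookup pmdegree_def)
  then show ?thesis using True pmdegree_eq_0_iff[of m] pmdegree_eq_0_iff[of n] by auto
next
  case False
  define a where "a = lookup (hk.gr m) 1 div lookup (hk.gr m) 0"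
  let ?S = "{a, Suc a} \<times> {0, 1, 2 :: nat}"
  have K: "keys m \<subseteq> ?S" "keys n \<subseteq> ?S"
    using antichain_two_levels[OF m] antichain_two_levels[OF n] False gr by (auto simp: a_def)
  have S: "?S = {(a, 0), (a, 1), (a, 2), (Suc a, 0), (Suc a, 1), (Suc a, 2)}" by auto
  let ?x = "\<lambda>j. lookup m (a, j)" and ?y = "\<lambda>j. lookup m (Suc a, j)"
  let ?x' = "\<lambda>j. lookup n (a, j)" and ?y' = "\<lambda>j. lookup n (Suc a, j)"
  have sums: "lookup (hk.gr k) t = (\<Sum>v\<in>?S. lookup k v * lookup (hphi v) t)"
    if "keys k \<subseteq> ?S" for k t
    using that by (intro lookup_gr) auto
  have e: "(\<Sum>v\<in>?S. lookup m v * lookup (hphi v) t) =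
      (\<Sum>v\<in>?S. lookup n v * lookup (hphi v) t)" for t
    using sums[OF K(1), of t] sums[OF K(2), of t] gr by simp
  have e0: "?x 0 + ?x 1 + ?x 2 + ?y 0 + ?y 1 + ?y 2 = ?x' 0 + ?x' 1 + ?x' 2 + ?y' 0 + ?y' 1 + ?y' 2"
    using e[of 0] unfolding S by (simp add: hphi_lookup)
  have "a * (?x 0 + ?x 1 + ?x 2 + ?y 0 + ?y 1 + ?y 2) + (?y 0 + ?y 1 + ?y 2) =
      a * (?x' 0 + ?x' 1 + ?x' 2 + ?y' 0 + ?y' 1 + ?y' 2) + (?y' 0 + ?y' 1 + ?y' 2)"
    using e[of 1] unfolding S hphi_lookup by (simp add: algebra_simps)
  then have e1: "?y 0 + ?y 1 + ?y 2 = ?y' 0 + ?y' 1 + ?y' 2" unfolding e0 by simp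
  have e2: "?x 1 + 2 * ?x 2 + ?y 1 + 2 * ?y 2 = ?x' 1 + 2 * ?x' 2 + ?y' 1 + 2 * ?y' 2"
    using e[of 2] unfolding S hphi_lookup by (simp add: algebra_simps)
  have zero: "lookup k u = 0 \<or> lookup k v = 0"
    if "antichain_on (keys k)" "hless u v" for k u v
    using that unfolding antichain_on_def by (metis in_keys_iff)
  have c: "?x 0 = 0 \<or> ?x 2 = 0" "?y 0 = 0 \<or> ?y 2 = 0" "?x 0 = 0 \<or> ?y 1 = 0" "?x 0 = 0 \<or> ?y 2 = 0"
      "?x 1 = 0 \<or> ?y 1 = 0" "?x 1 = 0 \<or> ?y 2 = 0"
    by (rule zero[OF m(2)], simp add: hless_same_level hless_next_level)+
  have c': "?x' 0 = 0 \<or> ?x' 2 = 0" "?y' 0 = 0 \<or> ?y' 2 = 0" "?x' 0 = 0 \<or> ?y' 1 = 0" "?x' 0 = 0 \<or> ?y' 2 = 0"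
      "?x' 1 = 0 \<or> ?y' 1 = 0" "?x' 1 = 0 \<or> ?y' 2 = 0"
    by (rule zero[OF n(2)], simp add: hless_same_level hless_next_level)+
  have "?x 0 + ?x 1 + ?x 2 = ?x' 0 + ?x' 1 + ?x' 2" using e0 e1 by linarith
  \<comment> \<open>The upper level contributes to the sum of second indices only once the lower
    level has reached its maximum, twice its number of variables. As the two monomials agree in this
    number and in the total, they agree in both shares.\<close>
  moreover have "?y 1 + 2 * ?y 2 = 0 \<or> ?x 0 = 0 \<and> ?x 1 = 0" "?y' 1 + 2 * ?y' 2 = 0 \<or> ?x' 0 = 0 \<and> ?x' 1 = 0"
    using c c' by auto
  ultimately have "?x 1 + 2 * ?x 2 = ?x' 1 + 2 * ?x' 2" "?y 1 + 2 * ?y 2 = ?y' 1 + 2 * ?y' 2"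
    using e2 by linarith+
  \<comment> \<open>Second indices 0 and 2 exclude each other on one level, so its size and its
    index sum determine all three multiplicities.\<close>
  moreover have level: "x0 = y0 \<and> x1 = y1 \<and> x2 = y2"
    if "x0 + x1 + x2 = y0 + y1 + y2" "x1 + 2 * x2 = y1 + 2 * y2" "x0 = 0 \<or> x2 = 0" "y0 = 0 \<or> y2 = 0"
    for x0 x1 x2 y0 y1 y2 :: nat
    using that by linarith
  ultimately have eqs: "?x 0 = ?x' 0 \<and> ?x 1 = ?x' 1 \<and> ?x 2 = ?x' 2" "?y 0 = ?y' 0 \<and> ?y 1 = ?y' 1 \<and> ?y 2 = ?y' 2"
    using c(1,2) c'(1,2) e0 e1 by (intro level; linarith)+
  show ?thesis
  proof (rule poly_mapping_eqI)
    fix v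
    show "lookup m v = lookup n v"
    proof (cases "v \<in> ?S")
      case True
      then show ?thesis unfolding S using eqs by auto
    next
      case False
      then have "v \<notin> keys m" "v \<notin> keys n" using K by auto
      then show ?thesis by (simp add: in_keys_iff)
    qed
  qed
qed

section \<open>The ideal of two-minors is toric\<close>

text \<open>Two-minors vanish on rank one matrices. Conversely, straightening replaces each monomial
  by the antichain monomial of its fibre; for an element of the toric ideal the coefficients over
  each fibre then add up to zero.\<close>

lemma hankel_ideal_eq:
  "hankel_ideal d = (carrier (poly_ring (hankel_vars d)) \<inter> hk.vanishing 1 1 :: ('k::field) hpoly set)"
proof (intro equalityI)
  show "hankel_ideal d \<subseteq> (carrier (poly_ring (hankel_vars d)) \<inter> hk.vanishing 1 1 :: 'k hpoly set)"
    using det_hmat_vanishing[of 2 _ _ 1]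
    by (intro hankel_ideal_minimal hk.vanishing_ideal) (auto intro: hmat_carrier simp del: hk.vanishing.simps)
next
  note I = ideal_poly_ringD[OF hankel_ideal_is_ideal[of d, where 'k = 'k]]
  show "carrier (poly_ring (hankel_vars d)) \<inter> hk.vanishing 1 1 \<subseteq> (hankel_ideal d :: 'k hpoly set)"
  proof
    fix p :: "'k hpoly"
    assume "p \<in> carrier (poly_ring (hankel_vars d)) \<inter> hk.vanishing 1 1"
    then have p: "p \<in> carrier (poly_ring (hankel_vars d))" "p \<in> hk.vanishing 1 1" by blast+
    define nf where "nf m = (SOME n. n \<in> monoms_in (hankel_vars d) \<and> antichain_on (keys n) \<and>
      hk.gr n = hk.gr m \<and> pmono m - pmono n \<in> (hankel_ideal d :: 'k hpoly set))" for m
    have nf: "nf m \<in> monoms_in (hankel_vars d)" "antichain_on (keys (nf m))" "hk.gr (nf m) = hk.gr m"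
      "pmono m - pmono (nf m) \<in> (hankel_ideal d :: 'k hpoly set)" if "m \<in> keys p" for m
    proof -
      have "m \<in> monoms_in (hankel_vars d)" using p(1) that by (auto simp: in_poly_ring)
      then have "\<exists>n. n \<in> monoms_in (hankel_vars d) \<and> antichain_on (keys n) \<and>
          hk.gr n = hk.gr m \<and> pmono m - pmono n \<in> (hankel_ideal d :: 'k hpoly set)"
        using straighten[of m d, where 'k = 'k] by metis
      from someI_ex[OF this] show "nf m \<in> monoms_in (hankel_vars d)" "antichain_on (keys (nf m))"
        "hk.gr (nf m) = hk.gr m" "pmono m - pmono (nf m) \<in> (hankel_ideal d :: 'k hpoly set)"
        unfolding nf_def by blast+
    qed
    define q where "q = (\<Sum>m\<in>keys p. Const (lookup p m) * pmono (nf m))"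
    have "p - q = (\<Sum>m\<in>keys p. Const (lookup p m) * (pmono m - pmono (nf m)))"
      unfolding q_def by (subst (1) mpoly_sum_monomials[of p]) (simp add: right_diff_distrib sum_subtractf)
    then have diff: "p - q \<in> hankel_ideal d"
      using nf(4) by (auto intro!: ideal_poly_ring_sum[OF hankel_ideal_is_ideal] I(4) poly_ring_closed)
    moreover have "q = 0"
    proof (rule poly_mapping_eqI)
      fix k
      have q: "lookup q k = (\<Sum>m\<in>keys p. lookup p m * of_bool (nf m = k))"
        unfolding q_def lookup_sum lookup_Const_times by (simp add: pmono_def lookup_single when_def of_bool_def)
      show "lookup q k = lookup 0 k"
      proof (cases "\<exists>m\<in>keys p. nf m = k")
        case False
        then show ?thesis unfolding q by auto
      next
        case True
        then obtain m0 where m0: "m0 \<in> keys p" "nf m0 = k" by blast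
        \<comment> \<open>By uniqueness in a fibre, the coefficient of \<open>q\<close> at
          \<open>k\<close> collects a whole fibre of \<open>p\<close>, which is a coefficient of the
          parametrized polynomial.\<close>
        have "nf m = k \<longleftrightarrow> hk.gr m = hk.gr k" if "m \<in> keys p" for m
          using antichain_fibre_unique[OF nf(1,2)[OF that] nf(1,2)[OF m0(1)]] nf(3)[OF that] m0(2) by auto
        then have "lookup q k = (\<Sum>m\<in>keys p. lookup p m * of_bool (hk.gr m = hk.gr k))"
          unfolding q by (intro sum.cong) auto
        also have "\<dots> = lookup (hk.hasse (hk.gr k) p) 0"
          by (subst hk.hasse_monomials) (simp add: lookup_sum lookup_Const_times hk.lookup_hasse_0 of_bool_def)
        also have "\<dots> = 0" using p(2) hk.vanishing_1_1_iff by blast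
        finally show ?thesis by simp
      qed
    qed
    ultimately show "p \<in> hankel_ideal d" by simp
  qed
qed

section \<open>Diagonal orders\<close>

definition diag_pmonom :: "nat \<Rightarrow> (nat \<Rightarrow> nat) \<Rightarrow> (nat \<Rightarrow> nat) \<Rightarrow> (nat \<times> nat) pmonom" where
  "diag_pmonom n f g = (\<Sum>i<n. single (hvar (f i) (g i)) 1)"

lemma pmono_sum: "pmono (\<Sum>i\<in>A. h i) = (\<Prod>i\<in>A. pmono (h i))"
  by (induction A rule: infinite_finite_induct) (auto simp: pmono_add)

lemma det_hmat_expand:
  "det (hmat n f g) = (\<Sum>p\<in>{p. p permutes {0..<n}}.
    (signof p * pmono (diag_pmonom n f (\<lambda>i. g (p i))) :: ('k::field) hpoly))"
proof -
  have "(\<Prod>i = 0..<n. hmat n f g $$ (i, p i)) = (pmono (diag_pmonom n f (\<lambda>i. g (p i))) :: 'k hpoly)"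
    if "p permutes {0..<n}" for p
    using permutes_in_image[OF that]
    by (simp add: diag_pmonom_def pmono_sum hmat_def Var_pmono atLeast0LessThan)
  then show ?thesis by (subst det_def'[of _ n]) (auto simp: hmat_def intro!: sum.cong)
qed

lemma keys_det_hmat:
  assumes "m \<in> keys (det (hmat n f g) :: ('k::field) hpoly)"
  obtains p where "p permutes {0..<n}" "m = diag_pmonom n f (\<lambda>i. g (p i))"
proof -
  have "\<exists>p\<in>{p. p permutes {0..<n}}.
      lookup (signof p * pmono (diag_pmonom n f (\<lambda>i. g (p i))) :: 'k hpoly) m \<noteq> 0"
    using assms unfolding det_hmat_expand in_keys_iff lookup_sum by (meson sum.neutral)
  then obtain p where p: "p permutes {0..<n}"
    "m \<in> keys (signof p * pmono (diag_pmonom n f (\<lambda>i. g (p i))) :: 'k hpoly)"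
    by (auto simp: in_keys_iff)
  then have "m = diag_pmonom n f (\<lambda>i. g (p i))" by (auto simp: sign_def split: if_splits)
  then show thesis using p(1) that by blast
qed

lemma pmdegree_sum: "pmdegree (sum h A) = (\<Sum>x\<in>A. pmdegree (h x))"
  by (induction A rule: infinite_finite_induct) (auto simp: pmdegree_add)

lemma pmdegree_det_hmat:
  "m \<in> keys (det (hmat n f g) :: ('k::field) hpoly) \<Longrightarrow> pmdegree m = n"
  by (erule keys_det_hmat) (simp add: diag_pmonom_def pmdegree_sum)

lemma finite_bounded_pmonoms:
  assumes "finite V"
  shows "finite {m \<in> monoms_in V. \<forall>v. lookup m v \<le> N}"
proof (rule finite_imageD)
  let ?F = "\<lambda>m. restrict (lookup m) V"
  let ?A = "{m \<in> monoms_in V. \<forall>v. lookup m v \<le> N}"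
  have "?F ` ?A \<subseteq> PiE V (\<lambda>_. {..N})" by auto
  then show "finite (?F ` ?A)" using finite_PiE[OF assms, of "\<lambda>_. {..N}"] finite_subset by blast
  show "inj_on ?F ?A"
  proof (rule inj_onI, rule poly_mapping_eqI)
    fix m n v assume mn: "m \<in> ?A" "n \<in> ?A" "?F m = ?F n"
    show "lookup m v = lookup n v"
    proof (cases "v \<in> V")
      case True
      then show ?thesis using fun_cong[OF mn(3), of v] by simp
    next
      case False
      then have "v \<notin> keys m" "v \<notin> keys n" using mn by (auto simp: monoms_in_def)
      then show ?thesis by (simp add: in_keys_iff)
    qed
  qed
qed

lemma lookup_le_pmdegree: "lookup m v \<le> pmdegree m"
  by (cases "v \<in> keys m")
    (auto simp: pmdegree_def in_keys_iff intro: member_le_sum)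

lemma pmdegree_le_energy: "pmdegree m \<le> energy m"
  unfolding pmdegree_def energy_def by (intro sum_mono) simp

text \<open>The degree is a coordinate of the grading, so fibres are finite and have a minimum in
  every term order.\<close>

lemma finite_fibre: "finite {n \<in> monoms_in (hankel_vars d). hk.gr n = hk.gr m}"
proof (rule finite_subset[OF _ finite_bounded_pmonoms[OF finite_hankel_vars, of d "pmdegree m"]])
  have deg: "pmdegree n = pmdegree m" if "hk.gr n = hk.gr m" for n
    using lookup_gr[of "keys m" m 0] lookup_gr[of "keys n" n 0] that
    by (simp add: hphi_lookup pmdegree_def)
  have "lookup n v \<le> pmdegree m" if "hk.gr n = hk.gr m" for n v
    using lookup_le_pmdegree[of n v] deg[OF that] by linarith
  then show "{n \<in> monoms_in (hankel_vars d). hk.gr n = hk.gr m} \<subseteq>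
      {n \<in> monoms_in (hankel_vars d). \<forall>v. lookup n v \<le> pmdegree m}"
    by (intro subsetI) simp
qed

text \<open>Common ground for the given diagonal orders and the concrete
  \<open>energy_order\<close>; the type argument fixes the field, on which a leading monomial could
  depend.\<close>

locale hankel_order = monomial_order "hankel_vars d" ord for d ord +
  fixes K :: "'k::field itself"
  assumes is_lm_diag: "admissible d n f g \<Longrightarrow>
    is_lm ord (det (hmat n f g) :: 'k hpoly) (diag_pmonom n f g)"
begin

lemma flip_smaller:
  assumes "u \<in> hankel_vars d" "v \<in> hankel_vars d" "hless u v"
  shows "(flip u v, single u 1 + single v 1) \<in> ord"
proof -
  let ?m = "single u 1 + single v 1" and ?n = "flip u v"
  have ne: "?m \<noteq> ?n" using energy_flip[OF assms] by auto
  have "diag_pmonom 2 (pos_pair row_pos u v) (pos_pair col_pos u v) = ?m"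
    using hvar_pos[OF assms(1)] hvar_pos[OF assms(2)]
    by (simp add: diag_pmonom_def pos_pair_def numeral_2_eq_2)
  then have lm: "is_lm ord (pmono ?m - pmono ?n :: 'k hpoly) ?m"
    using is_lm_diag[OF admissible_pair[OF assms]] det_hmat_pair[OF assms(1,2), where 'k = 'k] by simp
  have "lookup (pmono ?m - pmono ?n :: 'k hpoly) ?n \<noteq> 0"
    using ne by (simp add: lookup_minus pmono_def lookup_single)
  then show ?thesis using lm by (simp add: is_lm_def in_keys_iff)
qed

text \<open>A least monomial of a fibre is supported on an antichain, since otherwise a flip would
  give a smaller one in the same fibre. By \<open>antichain_fibre_unique\<close> it is the given
  \<open>m\<close>.\<close>

sublocale ordered_grading hphi "hankel_vars d" ord hless
proof
  show "finite (hankel_vars d)" by (rule finite_hankel_vars)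
  show "\<not> hless u u" for u by (rule hless_irrefl)
  show "hless u w" if "hless u v" "hless v w" for u v w using that by (rule hless_trans)
  fix A m n
  assume A: "A \<subseteq> hankel_vars d" "\<And>u v. u \<in> A \<Longrightarrow> v \<in> A \<Longrightarrow> \<not> hless u v" "m \<in> monoms_in A"
    and n: "n \<in> monoms_in (hankel_vars d)" "hk.gr n = hk.gr m"
  let ?F = "{n \<in> monoms_in (hankel_vars d). hk.gr n = hk.gr m}"
  have m: "m \<in> monoms_in (hankel_vars d)" "antichain_on (keys m)"
    using A unfolding monoms_in_def antichain_on_def by blast+
  then obtain k where k: "k \<in> ?F" "\<And>n. n \<in> ?F \<Longrightarrow> (k, n) \<in> ord"
    using finite_has_min[of ?F] finite_fibre[of d m] by blast
  have "antichain_on (keys k)"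
  proof (rule ccontr)
    assume "\<not> antichain_on (keys k)"
    then obtain u v l where uv: "u \<in> hankel_vars d" "v \<in> hankel_vars d" "hless u v" and l: "l \<in> monoms_in (hankel_vars d)"
      and kl: "k = single u 1 + single v 1 + l"
      using straighten_step k(1) by blast
    have uvm: "single u 1 + single v 1 \<in> monoms_in (hankel_vars d)"
      using uv by (auto simp: monoms_in_def keys_add_nat)
    have "(flip u v + l, k) \<in> ord"
      unfolding kl by (rule ord_add[OF flip_monoms_in[OF uv(1,2)] uvm l flip_smaller[OF uv]])
    moreover have "flip u v + l \<in> ?F"
      using k(1) flip_monoms_in[OF uv(1,2)] l gr_flip[OF uv(1,2)] monoms_in_add by (simp add: kl hk.gr_add)
    ultimately have "flip u v + l = k" using k(2) ord_antisym by blast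
    then show False using energy_flip[OF uv] by (simp add: kl)
  qed
  then have "k = m" using antichain_fibre_unique k(1) m by blast
  then show "(m, n) \<in> ord" using k(2) n by blast
qed

text \<open>The diagonal involves at most \<open>n\<close> variables, too few for a chain of length
  \<open>n + 1\<close>, yet nothing of the leading monomial lies outside them. This provides pivots
  outside the secant ideal.\<close>

lemma diag_minor_notin_vanishing:
  assumes "admissible d n f g"
  shows "(det (hmat n f g) :: 'k hpoly) \<notin> hk.vanishing n 1"
proof
  assume v: "(det (hmat n f g) :: 'k hpoly) \<in> hk.vanishing n 1"
  let ?X = "(\<lambda>i. hvar (f i) (g i)) ` {..<n}"
  have X: "?X \<subseteq> hankel_vars d" using assms by (auto simp: admissible_def intro!: hvar_in_hankel_vars)
  have "1 \<le> (\<Sum>v\<in>hankel_vars d - ?X. lookup (diag_pmonom n f g) v)"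
  proof (rule lm_vanishing[OF hmat_carrier[OF assms] v is_lm_diag[OF assms] X])
    fix c assume c: "set c \<subseteq> ?X" "sorted_wrt hless c"
    have "distinct c" using c(2) hless_irrefl by (induction c) auto
    then have "length c = card (set c)" by (simp add: distinct_card)
    also have "\<dots> \<le> card ?X" using c(1) by (intro card_mono) auto
    also have "\<dots> \<le> n" using card_image_le[of "{..<n}"] by fastforce
    finally show "length c \<le> n" .
  qed
  moreover have "(\<Sum>v\<in>hankel_vars d - ?X. lookup (diag_pmonom n f g) v) = 0"
  proof (rule sum.neutral, rule ballI)
    fix v assume "v \<in> hankel_vars d - ?X"
    then have "hvar (f i) (g i) \<noteq> v" if "i < n" for i using that by blast
    then show "lookup (diag_pmonom n f g) v = 0"
      by (simp add: diag_pmonom_def lookup_sum lookup_single)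
  qed
  ultimately show False by simp
qed

end

section \<open>Products of minors attached to chains\<close>

definition chain_minor :: "(nat \<times> nat) list \<Rightarrow> ('k::comm_ring_1) hpoly" where
  "chain_minor c = det (hmat (length c) (\<lambda>i. row_pos (c ! i)) (\<lambda>i. col_pos (c ! i)))"

definition list_pmonom :: "'v list \<Rightarrow> 'v pmonom" where
  "list_pmonom c = (\<Sum>v\<leftarrow>c. single v 1)"

lemma list_pmonom_simps [simp]:
  "list_pmonom [] = 0" "list_pmonom (v # c) = single v 1 + list_pmonom c"
  "list_pmonom (c @ c') = list_pmonom c + list_pmonom c'"
  by (simp_all add: list_pmonom_def)

lemma lookup_list_pmonom: "lookup (list_pmonom c) v = count_list c v"
  by (induction c) (auto simp: lookup_add lookup_single)

lemma chain_admissible: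
  assumes "sorted_wrt hless c" "set c \<subseteq> hankel_vars d"
  shows "admissible d (length c) (\<lambda>i. row_pos (c ! i)) (\<lambda>i. col_pos (c ! i))"
    "diag_pmonom (length c) (\<lambda>i. row_pos (c ! i)) (\<lambda>i. col_pos (c ! i)) = list_pmonom c"
proof -
  have v: "c ! i \<in> hankel_vars d" if "i < length c" for i using assms(2) that by auto
  have less: "hless (c ! i) (c ! j)" if "i < j" "j < length c" for i j
    using assms(1) that by (simp add: sorted_wrt_iff_nth_less)
  show "admissible d (length c) (\<lambda>i. row_pos (c ! i)) (\<lambda>i. col_pos (c ! i))"
    unfolding admissible_def
    using v pos_bounds less by (auto simp: hless_def intro!: strict_mono_onI)
  have "diag_pmonom (length c) (\<lambda>i. row_pos (c ! i)) (\<lambda>i. col_pos (c ! i)) =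
      (\<Sum>i<length c. single (c ! i) 1)"
    unfolding diag_pmonom_def using hvar_pos[OF v] by (intro sum.cong) auto
  also have "\<dots> = list_pmonom c"
    unfolding list_pmonom_def by (simp add: sum_list_sum_nth atLeast0LessThan)
  finally show "diag_pmonom (length c) (\<lambda>i. row_pos (c ! i)) (\<lambda>i. col_pos (c ! i)) = list_pmonom c" .
qed

text \<open>The condition \<open>r < length c\<close> makes the natural subtraction exact and every
  summand positive.\<close>

definition chain_family :: "nat \<Rightarrow> nat \<Rightarrow> nat \<Rightarrow> (nat \<times> nat) list list \<Rightarrow> bool" where
  "chain_family d r s cs \<longleftrightarrow> (\<forall>c\<in>set cs. sorted_wrt hless c \<and> set c \<subseteq> hankel_vars d \<and> r < length c) \<and>
    (\<Sum>c\<leftarrow>cs. length c - r) = s"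

lemma chain_family_Cons: "chain_family d r s (c # cs) \<longleftrightarrow> sorted_wrt hless c \<and> set c \<subseteq> hankel_vars d \<and> r < length c \<and>
    length c - r \<le> s \<and> chain_family d r (s - (length c - r)) cs"
  by (auto simp: chain_family_def)

lemma chain_minor_vanishing:
  "(chain_minor c :: ('k::field) hpoly) \<in> hk.vanishing r (length c - r)"
  unfolding chain_minor_def by (rule det_hmat_vanishing)

lemma chain_minor_carrier:
  "sorted_wrt hless c \<Longrightarrow> set c \<subseteq> hankel_vars d \<Longrightarrow>
    (chain_minor c :: ('k::field) hpoly) \<in> carrier (poly_ring (hankel_vars d))"
  unfolding chain_minor_def by (intro hmat_carrier chain_admissible)

lemma chain_family_vanishing:
  "chain_family d r s cs \<Longrightarrow> (\<Prod>c\<leftarrow>cs. chain_minor c :: ('k::field) hpoly) \<in>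
    carrier (poly_ring (hankel_vars d)) \<inter> hk.vanishing r s"
proof (induction cs arbitrary: s)
  case Nil
  then show ?case by (simp add: chain_family_def poly_ring_closed)
next
  case (Cons c cs)
  then have c: "sorted_wrt hless c" "set c \<subseteq> hankel_vars d" "length c - r \<le> s"
    "chain_family d r (s - (length c - r)) cs" unfolding chain_family_Cons by blast+
  note IH = Cons.IH[OF c(4)]
  have "chain_minor c * (\<Prod>c\<leftarrow>cs. chain_minor c :: 'k hpoly) \<in>
      hk.vanishing r ((length c - r) + (s - (length c - r)))"
    using IH by (intro hk.vanishing_mult chain_minor_vanishing) blast
  moreover have "chain_minor c * (\<Prod>c\<leftarrow>cs. chain_minor c :: 'k hpoly) \<in> carrier (poly_ring (hankel_vars d))"
    using IH by (intro poly_ring_closed chain_minor_carrier[OF c(1,2)]) blast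
  ultimately show ?case using c(3) by (simp only: le_add_diff_inverse list.map prod_list.Cons IntI)
qed

context hankel_order
begin

lemma is_lm_chain_minors:
  assumes "\<forall>c\<in>set cs. sorted_wrt hless c \<and> set c \<subseteq> hankel_vars d"
  shows "is_lm ord (\<Prod>c\<leftarrow>cs. chain_minor c :: 'k hpoly) (list_pmonom (concat cs)) \<and>
    (\<Prod>c\<leftarrow>cs. chain_minor c :: 'k hpoly) \<in> carrier (poly_ring (hankel_vars d))"
  using assms
proof (induction cs)
  case Nil
  have "0 \<in> monoms_in (hankel_vars d)" by (simp add: monoms_in_def)
  then show ?case using ord_refl by (auto simp: is_lm_def poly_ring_closed)
next
  case (Cons c cs)
  have "is_lm ord (chain_minor c :: 'k hpoly) (list_pmonom c)"
    using is_lm_diag[OF chain_admissible(1)[of c d]] chain_admissible(2)[of c d] Cons.prems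
    by (simp add: chain_minor_def)
  then show ?case
    using Cons chain_minor_carrier[of c d] by (auto intro: is_lm_mult poly_ring_closed)
qed

lemma vanishing_chain_family:
  fixes p :: "'k hpoly"
  assumes "p \<in> carrier (poly_ring (hankel_vars d))" "p \<in> hk.vanishing r s" "is_lm ord p m"
  obtains cs k where "chain_family d r s cs" "k \<in> monoms_in (hankel_vars d)" "m = k + list_pmonom (concat cs)"
    "is_lm ord (\<Prod>c\<leftarrow>cs. chain_minor c :: 'k hpoly) (list_pmonom (concat cs))"
proof -
  obtain cs where cs: "\<And>c. c \<in> set cs \<Longrightarrow> sorted_wrt hless c \<and> set c \<subseteq> hankel_vars d \<and> r < length c"
    "\<And>v. v \<in> hankel_vars d \<Longrightarrow> count_list (concat cs) v \<le> lookup m v" "(\<Sum>c\<leftarrow>cs. length c - r) = s"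
    using vanishing_lm_chains[OF assms] by metis
  have m: "m \<in> monoms_in (hankel_vars d)" using assms by (auto simp: is_lm_def in_poly_ring)
  have le: "count_list (concat cs) v \<le> lookup m v" for v
  proof (cases "v \<in> hankel_vars d")
    case False
    then have "v \<notin> set (concat cs)" using cs(1) by auto
    then show ?thesis by (simp add: count_list_0_iff)
  qed (rule cs(2))
  define k where "k = m - list_pmonom (concat cs)"
  have "m = k + list_pmonom (concat cs)"
    using le by (intro poly_mapping_eqI) (simp add: k_def lookup_add lookup_minus lookup_list_pmonom)
  moreover from this m have "k \<in> monoms_in (hankel_vars d)" by (simp add: monoms_in_add)
  moreover have "chain_family d r s cs" using cs(1,3) by (simp add: chain_family_def)
  ultimately show thesis using that is_lm_chain_minors[of cs] cs(1) by blast
qed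

text \<open>Division by products of minors: subtracting a multiple of such a product cancels the
  leading term and keeps the polynomial in \<open>vanishing r s\<close>. Termination is the
  finiteness of the initial segment below the leading monomial.\<close>

lemma vanishing_generated:
  fixes I :: "'k hpoly set"
  assumes fin: "\<And>m. finite {n \<in> monoms_in (hankel_vars d). (n, m) \<in> ord}"
    and I: "ideal I (poly_ring (hankel_vars d))"
    and gens: "\<And>cs. chain_family d r s cs \<Longrightarrow> (\<Prod>c\<leftarrow>cs. chain_minor c) \<in> I"
  shows "carrier (poly_ring (hankel_vars d)) \<inter> hk.vanishing r s \<subseteq> I"
proof -
  note I = ideal_poly_ringD[OF I]
  let ?V = "hankel_vars d"
  note H = ideal_poly_ringD[OF hk.vanishing_ideal[of ?V r s, where 'k = 'k]]
  have "p \<in> I" if p: "p \<in> carrier (poly_ring ?V) \<inter> hk.vanishing r s" "is_lm ord p m" for p :: "'k hpoly" and m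
    using that
  proof (induction "card {n \<in> monoms_in ?V. (n, m) \<in> ord}" arbitrary: p m rule: less_induct)
    case less
    then have p: "p \<in> carrier (poly_ring ?V)" "p \<in> hk.vanishing r s" by auto
    obtain cs k where cs: "chain_family d r s cs" "k \<in> monoms_in ?V" "m = k + list_pmonom (concat cs)"
      "is_lm ord (\<Prod>c\<leftarrow>cs. chain_minor c :: 'k hpoly) (list_pmonom (concat cs))"
      using vanishing_chain_family[OF p less.prems(2)] .
    define g :: "'k hpoly" where "g = pmono k * (\<Prod>c\<leftarrow>cs. chain_minor c)"
    have k: "pmono k \<in> carrier (poly_ring ?V :: 'k hpoly ring)" using cs(2) by (rule poly_ring_closed)
    note prod = chain_family_vanishing[OF cs(1), where 'k = 'k]
    have gI: "g \<in> I" and gH: "g \<in> carrier (poly_ring ?V) \<inter> hk.vanishing r s"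
      unfolding g_def by (rule I(4)[OF gens[OF cs(1)] k], rule H(4)[OF prod k])
    have "is_lm ord (pmono k :: 'k hpoly) k" using cs(2) ord_refl by (simp add: is_lm_def)
    then have lm: "is_lm ord g m"
      unfolding g_def cs(3) using k prod cs(4) by (intro is_lm_mult) auto
    define a where "a = lookup p m / lookup g m"
    define q where "q = p - Const a * g"
    have ga: "Const a * g \<in> I" "Const a * g \<in> carrier (poly_ring ?V) \<inter> hk.vanishing r s"
      by (rule I(4) H(4), rule gI gH, rule poly_ring_closed)+
    have qH: "q \<in> carrier (poly_ring ?V) \<inter> hk.vanishing r s"
      unfolding q_def using less.prems(1) ga(2) by (rule H(5))
    have qm: "lookup q m = 0"
      using lm by (simp add: q_def a_def lookup_minus lookup_Const_times is_lm_def in_keys_iff)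
    have qkeys: "(n, m) \<in> ord" if "n \<in> keys q" for n
    proof -
      have "n \<in> keys p \<or> n \<in> keys g"
        using that by (auto simp: q_def in_keys_iff lookup_minus lookup_Const_times)
      then show ?thesis using lm less.prems(2) by (auto simp: is_lm_def)
    qed
    have "q \<in> I"
    proof (cases "q = 0")
      case False
      then obtain n where n: "is_lm ord q n" "n \<in> monoms_in ?V" using is_lm_exists qH by blast
      have nm: "(n, m) \<in> ord" "n \<noteq> m" using n(1) qkeys qm by (auto simp: is_lm_def in_keys_iff)
      have m: "m \<in> monoms_in ?V" using p(1) less.prems(2) by (auto simp: is_lm_def in_poly_ring)
      have "{l \<in> monoms_in ?V. (l, n) \<in> ord} \<subset> {l \<in> monoms_in ?V. (l, m) \<in> ord}"
        using nm m ord_trans ord_antisym ord_refl by blast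
      then have "card {l \<in> monoms_in ?V. (l, n) \<in> ord} < card {l \<in> monoms_in ?V. (l, m) \<in> ord}"
        by (rule psubset_card_mono[OF fin])
      then show ?thesis using less.hyps qH n(1) by blast
    qed (use I(2) in simp)
    then have "q + Const a * g \<in> I" using ga(1) by (rule I(3))
    then show "p \<in> I" by (simp add: q_def)
  qed
  then show ?thesis using is_lm_exists I(2) by blast
qed

end

section \<open>Existence of a diagonal order\<close>

lemma permutes_no_inversion:
  fixes p :: "nat \<Rightarrow> nat"
  assumes p: "p permutes {0..<n}" and mono: "\<And>i j. i < j \<Longrightarrow> j < n \<Longrightarrow> p i \<le> p j"
  shows "p = id"
proof -
  have strict: "p i < p j" if "i < j" "j < n" for i j
    using mono[OF that] permutes_inj[OF p] that by (metis injD le_neq_implies_less nat_neq_iff)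
  have ge: "i \<le> p i" if "i < n" for i
    using that
  proof (induction i)
    case (Suc i)
    then show ?case using strict[of i "Suc i"] by simp
  qed simp
  have "(\<Sum>i\<in>{0..<n}. p i) = (\<Sum>i\<in>{0..<n}. i)"
    using sum.permute[OF p, of "\<lambda>i. i"] by (simp add: o_def)
  moreover have "(\<Sum>i\<in>{0..<n}. i) < (\<Sum>i\<in>{0..<n}. p i)" if "i < n" "p i \<noteq> i" for i
    using that ge by (intro sum_strict_mono_ex1) (auto intro!: bexI[of _ i] simp: le_neq_implies_less)
  ultimately have "p i = i" if "i < n" for i using that by (metis less_irrefl)
  moreover have "p i = i" if "\<not> i < n" for i using permutes_not_in[OF p, of i] that by simp
  ultimately show ?thesis by (intro ext) (auto simp: id_def)
qed

text \<open>In a maximizing permutation, undoing an inversion would increase the sum by a product of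
  two positive differences. So a maximizer has no inversion, and the identity is the only
  one.\<close>

lemma rearrangement_strict:
  fixes f g :: "nat \<Rightarrow> nat"
  assumes mono: "strict_mono_on {..<n} f" "strict_mono_on {..<n} g" and p: "p permutes {0..<n}" "p \<noteq> id"
  shows "(\<Sum>i<n. f i * g (p i)) < (\<Sum>i<n. f i * g i)"
proof -
  define S where "S p = (\<Sum>i<n. f i * g (p i))" for p
  let ?P = "{p. p permutes {0..<n}}"
  have fin: "finite ?P" by (simp add: finite_permutations)
  have "id \<in> ?P" by (simp add: permutes_id)
  have "Max (S ` ?P) \<in> S ` ?P" using fin \<open>id \<in> ?P\<close> by (intro Max_in) (simp, blast)
  then obtain q where q: "q \<in> ?P" "S q = Max (S ` ?P)" by auto
  have unique: "q = id" if q: "q \<in> ?P" and max: "\<And>p. p \<in> ?P \<Longrightarrow> S p \<le> S q" for q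
  proof (rule permutes_no_inversion)
    show "q permutes {0..<n}" using q by simp
    fix i j assume ij: "i < j" "j < n"
    show "q i \<le> q j"
    proof (rule ccontr)
      assume "\<not> ?thesis"
      then have inv: "q j < q i" by simp
      have qn: "q i < n" "q j < n" using permutes_in_image[of q "{0..<n}"] q ij by auto
      let ?q = "q \<circ> transpose i j"
      have "?q permutes {0..<n}" using q ij by (intro permutes_compose permutes_swap_id) auto
      then have le: "S ?q \<le> S q" by (intro max) simp
      have split: "S p = f i * g (p i) + (f j * g (p j) + (\<Sum>k\<in>{..<n} - {i} - {j}. f k * g (p k)))" for p
        unfolding S_def using ij by (subst sum.remove[of _ i], simp, simp, subst sum.remove[of _ j]) auto
      have "(\<Sum>k\<in>{..<n} - {i} - {j}. f k * g (?q k)) = (\<Sum>k\<in>{..<n} - {i} - {j}. f k * g (q k))"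
        by (intro sum.cong) (auto simp: transpose_def)
      then have "f i * g (q j) + f j * g (q i) \<le> f i * g (q i) + f j * g (q j)"
        using le split[of ?q] split[of q] by (simp add: transpose_def)
      moreover obtain a where a: "f j = f i + a" "0 < a"
        using strict_mono_onD[OF mono(1), of i j] ij by (metis less_imp_add_positive lessThan_iff less_trans)
      moreover obtain b where b: "g (q i) = g (q j) + b" "0 < b"
        using strict_mono_onD[OF mono(2), of "q j" "q i"] inv qn by (metis less_imp_add_positive lessThan_iff)
      moreover have "0 < a * b" using a b by simp
      ultimately show False by (simp add: algebra_simps)
    qed
  qed
  have max: "S p \<le> S q" if "p \<in> ?P" for p using that fin q by simp
  then have "q = id" using q unique by blast
  have "S p \<noteq> S id"
  proof
    assume "S p = S id"
    then have "p = id" using p max \<open>q = id\<close> by (intro unique) auto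
    then show False using p by simp
  qed
  moreover have "S p \<le> S id" using max p \<open>q = id\<close> by auto
  ultimately show ?thesis by (simp add: S_def)
qed

lemma energy_diag_pmonom: "energy (diag_pmonom n f g) = (\<Sum>i<n. (f i + g i)\<^sup>2 + 1)"
  by (simp add: diag_pmonom_def energy_sum energy_hvar del: One_nat_def)

text \<open>The sum of the squares of \<open>f i + g (p i)\<close> depends on \<open>p\<close> only
  through its mixed terms, to which the rearrangement inequality applies.\<close>

lemma energy_diag_max:
  assumes "admissible d n f g" "p permutes {0..<n}" "p \<noteq> id"
  shows "energy (diag_pmonom n f (\<lambda>i. g (p i))) < energy (diag_pmonom n f g)"
proof -
  have "p permutes {..<n}" using assms(2) by (simp add: atLeast0LessThan)
  then have "(\<Sum>i<n. (g (p i))\<^sup>2) = (\<Sum>i<n. (g i)\<^sup>2)"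
    using sum.permute[of p "{..<n}" "\<lambda>i. (g i)\<^sup>2"] by (simp add: o_def)
  moreover have "(\<Sum>i<n. f i * g (p i)) < (\<Sum>i<n. f i * g i)"
    using assms by (intro rearrangement_strict) (auto simp: admissible_def)
  moreover have "(\<Sum>i<n. (f i + h i)\<^sup>2 + 1) = (\<Sum>i<n. (f i)\<^sup>2) + (\<Sum>i<n. (h i)\<^sup>2) + 2 * (\<Sum>i<n. f i * h i) + n"
    for h :: "nat \<Rightarrow> nat"
    by (simp add: power2_sum sum.distrib sum_distrib_left mult.assoc sum_Suc)
  ultimately show ?thesis unfolding energy_diag_pmonom by simp
qed

text \<open>The linear order on the type of monomials only breaks ties.\<close>

definition energy_order :: "nat \<Rightarrow> (nat \<times> nat) pmonom rel" where
  "energy_order d = {(m, n). m \<in> monoms_in (hankel_vars d) \<and> n \<in> monoms_in (hankel_vars d) \<and>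
    (energy m < energy n \<or> energy m = energy n \<and> m \<le> n)}"

lemma energy_order_term_order: "term_order (hankel_vars d) (energy_order d)"
proof -
  have "linear_order_on (monoms_in (hankel_vars d)) (energy_order d)"
    unfolding linear_order_on_def partial_order_on_def preorder_on_def
    by (auto simp: energy_order_def refl_on_def trans_def antisym_def total_on_def)
  moreover have "(0, m) \<in> energy_order d" if "m \<in> monoms_in (hankel_vars d)" for m
  proof (cases "energy m = 0")
    case True
    then have "m = 0" using pmdegree_le_energy[of m] pmdegree_eq_0_iff[of m] by simp
    then show ?thesis by (simp add: energy_order_def monoms_in_def)
  qed (use that in \<open>auto simp: energy_order_def monoms_in_def\<close>)
  moreover have "(a + c, b + c) \<in> energy_order d"
    if "(a, b) \<in> energy_order d" "c \<in> monoms_in (hankel_vars d)" for a b c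
    using that by (auto simp: energy_order_def monoms_in_def keys_add_nat energy_add intro: add_right_mono)
  ultimately show ?thesis by (auto simp: term_order_def)
qed

lemma finite_energy_order: "finite {n \<in> monoms_in (hankel_vars d). (n, m) \<in> energy_order d}"
proof (rule finite_subset[OF _ finite_bounded_pmonoms[OF finite_hankel_vars, of d "energy m"]])
  have "lookup n v \<le> energy m" if "(n, m) \<in> energy_order d" for n v
  proof -
    have "energy n \<le> energy m" using that by (auto simp: energy_order_def)
    then show ?thesis using lookup_le_pmdegree[of n v] pmdegree_le_energy[of n] by linarith
  qed
  then show "{n \<in> monoms_in (hankel_vars d). (n, m) \<in> energy_order d} \<subseteq>
      {n \<in> monoms_in (hankel_vars d). \<forall>v. lookup n v \<le> energy m}"
    by blast
qed

text \<open>Only the identity permutation produces a term of top energy, so the diagonal monomial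
  cannot cancel and leads by energy alone.\<close>

lemma hankel_order_energy: "hankel_order TYPE('k::field) d (energy_order d)"
proof
  show "term_order (hankel_vars d) (energy_order d)" by (rule energy_order_term_order)
  fix n f g assume adm: "admissible d n f g"
  let ?m = "diag_pmonom n f g"
  have "lookup (det (hmat n f g) :: 'k hpoly) ?m =
      (\<Sum>p\<in>{p. p permutes {0..<n}}. lookup (signof p * pmono (diag_pmonom n f (\<lambda>i. g (p i)))) ?m)"
    by (simp add: det_hmat_expand lookup_sum)
  also have "\<dots> = (\<Sum>p\<in>{id}. lookup (signof p * pmono (diag_pmonom n f (\<lambda>i. g (p i)))) ?m)"
  proof (rule sum.mono_neutral_right)
    show "\<forall>p\<in>{p. p permutes {0..<n}} - {id}.
        lookup (signof p * pmono (diag_pmonom n f (\<lambda>i. g (p i))) :: 'k hpoly) ?m = 0"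
    proof
      fix p assume "p \<in> {p. p permutes {0..<n}} - {id}"
      then have "diag_pmonom n f (\<lambda>i. g (p i)) \<noteq> ?m" using energy_diag_max[OF adm, of p] by auto
      then show "lookup (signof p * pmono (diag_pmonom n f (\<lambda>i. g (p i))) :: 'k hpoly) ?m = 0"
        by (auto simp: sign_def pmono_def lookup_single)
    qed
  qed (auto simp: finite_permutations permutes_id)
  also have "\<dots> = 1" by (simp add: pmono_def)
  finally have key: "?m \<in> keys (det (hmat n f g) :: 'k hpoly)"
    by (simp add: in_keys_iff)
  have sub: "keys (det (hmat n f g) :: 'k hpoly) \<subseteq> monoms_in (hankel_vars d)"
    using hmat_carrier[OF adm, where 'k = 'k] by (simp add: in_poly_ring)
  have "(k, ?m) \<in> energy_order d" if k: "k \<in> keys (det (hmat n f g) :: 'k hpoly)" for k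
  proof -
    obtain p where p: "p permutes {0..<n}" "k = diag_pmonom n f (\<lambda>i. g (p i))" using keys_det_hmat[OF k] .
    have "k \<in> monoms_in (hankel_vars d)" "?m \<in> monoms_in (hankel_vars d)" using k key sub by auto
    moreover have "energy k < energy ?m \<or> k = ?m"
      using energy_diag_max[OF adm p(1)] p(2) by (cases "p = id") auto
    ultimately show ?thesis by (auto simp: energy_order_def)
  qed
  then show "is_lm (energy_order d) (det (hmat n f g) :: 'k hpoly) ?m"
    using key by (simp add: is_lm_def)
qed

section \<open>Symbolic powers of the secant ideals\<close>

context cring
begin

lemma ideal_power_ideal: "ideal J R \<Longrightarrow> ideal (J [^]\<^bsub>ideals_set R\<^esub> (n::nat)) R"
proof (induction n)
  case 0
  then show ?case using oneideal by (simp add: ideals_set_def)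
next
  case (Suc n)
  then show ?case
    using ideal_prod_is_ideal[of "J [^]\<^bsub>ideals_set R\<^esub> n" J] by (simp add: ideals_set_def)
qed

lemma ideal_power_add:
  assumes J: "ideal J R" and x: "x \<in> J [^]\<^bsub>ideals_set R\<^esub> (m::nat)" and y: "y \<in> J [^]\<^bsub>ideals_set R\<^esub> (n::nat)"
  shows "x \<otimes> y \<in> J [^]\<^bsub>ideals_set R\<^esub> (m + n)"
proof -
  interpret S: semiring "ideals_set R" by (rule ideals_set_is_semiring)
  have "J [^]\<^bsub>ideals_set R\<^esub> (m + n) = J [^]\<^bsub>ideals_set R\<^esub> m \<otimes>\<^bsub>ideals_set R\<^esub> J [^]\<^bsub>ideals_set R\<^esub> n"
    using J by (intro S.nat_pow_mult[symmetric]) (simp add: ideals_set_def)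
  then show ?thesis using ideal_prod.prod[OF x y] by (simp add: ideals_set_def)
qed

text \<open>A prime ideal is its own only minimal prime, so the localization inverts its complement
  and the symbolic power becomes a saturation.\<close>

lemma symbolic_power_prime:
  assumes J: "primeideal J R"
  shows "symbolic_power R J s = {f \<in> carrier R. \<exists>u\<in>carrier R - J. u \<otimes> f \<in> J [^]\<^bsub>ideals_set R\<^esub> s}"
proof -
  interpret J: primeideal J R by (rule J)
  have min: "minimal_primes R J = {J}" using J by (auto simp: minimal_primes_def)
  define S where "S = carrier R - J"
  define Js where "Js = J [^]\<^bsub>ideals_set R\<^esub> s"
  have Js: "ideal Js R" unfolding Js_def by (rule ideal_power_ideal[OF J.is_ideal])
  have S: "u \<in> carrier R" if "u \<in> S" for u using that by (simp add: S_def)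
  have S_mult: "u \<otimes> v \<in> S" if "u \<in> S" "v \<in> S" for u v
    using that J.I_prime by (auto simp: S_def)
  have S_one: "\<one> \<in> S" using J.one_imp_carrier J.I_notcarr by (auto simp: S_def)
  have "loc_frac R S f \<one> \<in> loc_ideal R S Js \<longleftrightarrow> (\<exists>u\<in>S. u \<otimes> f \<in> Js)" if f: "f \<in> carrier R" for f
  proof
    assume "loc_frac R S f \<one> \<in> loc_ideal R S Js"
    then obtain a u where a: "a \<in> Js" "u \<in> S" "loc_frac R S f \<one> = loc_frac R S a u"
      by (auto simp: loc_ideal_def)
    have "(f, \<one>) \<in> loc_frac R S f \<one>" using f S_one by (auto simp: loc_frac_def)
    then have "(f, \<one>) \<in> loc_frac R S a u" by (simp only: a(3))
    then obtain v where v: "v \<in> S" "v \<otimes> (\<one> \<otimes> a) = v \<otimes> (u \<otimes> f)"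
      unfolding loc_frac_def by auto
    have a': "a \<in> carrier R" using a(1) ideal.Icarr[OF Js] by blast
    have "v \<otimes> a \<in> Js" using ideal.I_l_closed[OF Js a(1)] S v(1) by blast
    then have "(v \<otimes> u) \<otimes> f \<in> Js" using v a a' S f by (simp add: m_assoc)
    then show "\<exists>u\<in>S. u \<otimes> f \<in> Js" using S_mult v a by blast
  next
    assume "\<exists>u\<in>S. u \<otimes> f \<in> Js"
    then obtain u where u: "u \<in> S" "u \<otimes> f \<in> Js" by blast
    \<comment> \<open>Membership criteria for the classes of \<open>f\<close> over
      \<open>\<one>\<close> and of \<open>u \<otimes> f\<close> over \<open>u\<close> agree, so the
      two fractions are equal.\<close>
    have "(\<exists>v\<in>S. v \<otimes> (w \<otimes> f) = v \<otimes> (\<one> \<otimes> b)) \<longleftrightarrow> (\<exists>v\<in>S. v \<otimes> (w \<otimes> (u \<otimes> f)) = v \<otimes> (u \<otimes> b))"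
      if "b \<in> carrier R" "w \<in> S" for b w
    proof -
      note c = f that(1) S[OF that(2)] S[OF u(1)]
      have shift: "v \<otimes> (w \<otimes> (u \<otimes> f)) = (v \<otimes> u) \<otimes> (w \<otimes> f)" "v \<otimes> (u \<otimes> b) = (v \<otimes> u) \<otimes> (\<one> \<otimes> b)"
        "v \<otimes> (w \<otimes> (u \<otimes> f)) = u \<otimes> (v \<otimes> (w \<otimes> f))" "v \<otimes> (u \<otimes> b) = u \<otimes> (v \<otimes> (\<one> \<otimes> b))"
        if "v \<in> S" for v using c S[OF that] by (simp_all add: m_ac)
      show ?thesis
      proof
        assume "\<exists>v\<in>S. v \<otimes> (w \<otimes> f) = v \<otimes> (\<one> \<otimes> b)"
        then obtain v where v: "v \<in> S" "v \<otimes> (w \<otimes> f) = v \<otimes> (\<one> \<otimes> b)" by blast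
        then have "v \<otimes> (w \<otimes> (u \<otimes> f)) = v \<otimes> (u \<otimes> b)" using shift(3,4)[OF v(1)] by simp
        then show "\<exists>v\<in>S. v \<otimes> (w \<otimes> (u \<otimes> f)) = v \<otimes> (u \<otimes> b)" using v(1) by blast
      next
        assume "\<exists>v\<in>S. v \<otimes> (w \<otimes> (u \<otimes> f)) = v \<otimes> (u \<otimes> b)"
        then obtain v where v: "v \<in> S" "v \<otimes> (w \<otimes> (u \<otimes> f)) = v \<otimes> (u \<otimes> b)" by blast
        then have "(v \<otimes> u) \<otimes> (w \<otimes> f) = (v \<otimes> u) \<otimes> (\<one> \<otimes> b)" using shift(1,2)[OF v(1)] by simp
        then show "\<exists>v\<in>S. v \<otimes> (w \<otimes> f) = v \<otimes> (\<one> \<otimes> b)" using S_mult[OF v(1) u(1)] by blast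
      qed
    qed
    then have "loc_frac R S f \<one> = loc_frac R S (u \<otimes> f) u" unfolding loc_frac_def by blast
    then show "loc_frac R S f \<one> \<in> loc_ideal R S Js" using u by (auto simp: loc_ideal_def)
  qed
  then show ?thesis by (auto simp: symbolic_power_def min Let_def S_def Js_def)
qed

end

definition hsecant :: "nat \<Rightarrow> nat \<Rightarrow> ('k::field) hpoly set" where
  "hsecant d r = carrier (poly_ring (hankel_vars d)) \<inter> hk.vanishing r 1"

lemma secant_hankel_ideal:
  "1 \<le> r \<Longrightarrow> secant_ideal (hankel_vars d) (hankel_ideal d) r = (hsecant d r :: ('k::field) hpoly set)"
proof (induction r rule: nat_induct_at_least)
  case base
  then show ?case by (simp add: secant_ideal_def hankel_ideal_eq hsecant_def)
next
  case (Suc r)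
  have "secant_ideal (hankel_vars d) (hankel_ideal d) (Suc r) =
      join_ideal (hankel_vars d) (hankel_ideal d) (hsecant d r :: 'k hpoly set)"
    using Suc by (cases r) (auto simp: secant_ideal_def)
  then show ?case unfolding hankel_ideal_eq hsecant_def hk.join_vanishing .
qed

text \<open>Primality is the case \<open>s = 1\<close> of \<open>vanishing_cancel\<close>.\<close>

lemma hsecant_prime: "primeideal (hsecant d r) (poly_ring (hankel_vars d) :: ('k::field) hpoly ring)"
proof (rule primeidealI)
  show "ideal (hsecant d r) (poly_ring (hankel_vars d) :: 'k hpoly ring)"
    unfolding hsecant_def by (rule hk.vanishing_ideal)
  show "cring (poly_ring (hankel_vars d) :: 'k hpoly ring)" by (rule cring_poly_ring)
  show "carrier (poly_ring (hankel_vars d)) \<noteq> (hsecant d r :: 'k hpoly set)"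
    using hk.one_notin_vanishing[of r] poly_ring_closed(5) unfolding hsecant_def by blast
  fix a b :: "'k hpoly"
  assume "a \<in> carrier (poly_ring (hankel_vars d))" "b \<in> carrier (poly_ring (hankel_vars d))"
    "a \<otimes>\<^bsub>poly_ring (hankel_vars d)\<^esub> b \<in> hsecant d r"
  then show "a \<in> hsecant d r \<or> b \<in> hsecant d r"
    using hk.vanishing_cancel[of a r b 1] by (auto simp: hsecant_def)
qed

context
  fixes d r :: nat and R :: "('k::field) hpoly ring" and J :: "'k hpoly set"
  defines "R \<equiv> poly_ring (hankel_vars d)" and "J \<equiv> hsecant d r"
begin

interpretation R: cring R unfolding R_def by (rule cring_poly_ring)
interpretation J: primeideal J R unfolding J_def R_def by (rule hsecant_prime)

lemma power_subset_vanishing: "J [^]\<^bsub>ideals_set R\<^esub> (s::nat) \<subseteq> carrier R \<inter> hk.vanishing r s"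
proof (induction s)
  case (Suc s)
  have "x \<in> carrier R \<inter> hk.vanishing r (Suc s)" if "x \<in> ideal_prod R (J [^]\<^bsub>ideals_set R\<^esub> s) J" for x
    using that
  proof (induction rule: ideal_prod.induct)
    case (prod i j)
    then have "i \<in> carrier R \<inter> hk.vanishing r s" "j \<in> carrier R \<inter> hk.vanishing r 1"
      using Suc by (auto simp: J_def hsecant_def R_def)
    then show ?case using hk.vanishing_mult[of i r s j 1] by (auto simp: R_def intro: poly_ring_closed)
  next
    case (sum a b)
    then show ?case by (auto simp: R_def intro: poly_ring_closed hk.vanishing_add)
  qed
  then show ?case by (auto simp: ideals_set_def)
qed (auto simp: ideals_set_def R_def)

text \<open>The symbolic power in the form of \<open>symbolic_power_prime\<close>, where sums and
  products are handled by multiplying denominators.\<close>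

definition saturation :: "nat \<Rightarrow> 'k hpoly set" where
  "saturation s = {f \<in> carrier R. \<exists>u\<in>carrier R - J. u * f \<in> J [^]\<^bsub>ideals_set R\<^esub> s}"

lemma power_ideal: "ideal (J [^]\<^bsub>ideals_set R\<^esub> (s::nat)) (poly_ring (hankel_vars d) :: 'k hpoly ring)"
  using R.ideal_power_ideal[OF J.is_ideal, of s] by (simp only: R_def)

lemma complement_mult: "u \<in> carrier R - J \<Longrightarrow> v \<in> carrier R - J \<Longrightarrow> u * v \<in> carrier R - J"
  using J.I_prime[of u v] by (auto simp: R_def intro: poly_ring_closed)

lemma complement_one: "1 \<in> carrier R - J"
  using hk.one_notin_vanishing[of r] by (simp add: R_def J_def hsecant_def poly_ring_closed)

lemma complement_power: "u \<in> carrier R - J \<Longrightarrow> u ^ n \<in> carrier R - J"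
proof (induction n)
  case (Suc n)
  then show ?case using complement_mult[of u "u ^ n"] by simp
qed (use complement_one in simp)

lemma saturation_mult:
  assumes "f \<in> saturation a" "g \<in> saturation b"
  shows "f * g \<in> saturation (a + b)"
proof -
  obtain u v where uv: "u \<in> carrier R - J" "v \<in> carrier R - J" "u * f \<in> J [^]\<^bsub>ideals_set R\<^esub> a" "v * g \<in> J [^]\<^bsub>ideals_set R\<^esub> b"
    using assms by (auto simp: saturation_def)
  have "(u * f) * (v * g) \<in> J [^]\<^bsub>ideals_set R\<^esub> (a + b)"
    using R.ideal_power_add[OF J.is_ideal uv(3,4)] by (simp add: R_def)
  then have "(u * v) * (f * g) \<in> J [^]\<^bsub>ideals_set R\<^esub> (a + b)" by (simp only: ac_simps)
  then show ?thesis
    using complement_mult[OF uv(1,2)] assms by (auto simp: saturation_def R_def intro: poly_ring_closed)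
qed

lemma saturation_ideal: "ideal (saturation s) (poly_ring (hankel_vars d) :: 'k hpoly ring)"
proof (rule ideal_poly_ringI)
  note P = ideal_poly_ringD[OF power_ideal[of s]]
  show "saturation s \<subseteq> carrier (poly_ring (hankel_vars d))" by (auto simp: saturation_def R_def)
  show "0 \<in> saturation s" using complement_one P(2) by (auto simp: saturation_def R_def intro: poly_ring_closed)
  show "p + q \<in> saturation s" if pq: "p \<in> saturation s" "q \<in> saturation s" for p q
  proof -
    obtain u v where uv: "u \<in> carrier R - J" "v \<in> carrier R - J" "u * p \<in> J [^]\<^bsub>ideals_set R\<^esub> s" "v * q \<in> J [^]\<^bsub>ideals_set R\<^esub> s"
      using pq by (auto simp: saturation_def)
    have "v * (u * p) + u * (v * q) \<in> J [^]\<^bsub>ideals_set R\<^esub> s"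
      by (rule P(3)[OF P(4)[OF uv(3)] P(4)[OF uv(4)]]) (use uv(1,2) in \<open>auto simp: R_def\<close>)
    then have "(u * v) * (p + q) \<in> J [^]\<^bsub>ideals_set R\<^esub> s" by (simp add: algebra_simps)
    then show ?thesis
      using complement_mult[OF uv(1,2)] pq by (auto simp: saturation_def R_def intro: poly_ring_closed)
  qed
  show "q * p \<in> saturation s" if pq: "p \<in> saturation s" "q \<in> carrier (poly_ring (hankel_vars d))" for p q
  proof -
    obtain u where u: "u \<in> carrier R - J" "u * p \<in> J [^]\<^bsub>ideals_set R\<^esub> s" using pq by (auto simp: saturation_def)
    have "q * (u * p) \<in> J [^]\<^bsub>ideals_set R\<^esub> s" using u(2) pq(2) by (rule P(4))
    then have "u * (q * p) \<in> J [^]\<^bsub>ideals_set R\<^esub> s" by (simp only: mult.left_commute)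
    then show ?thesis using u pq by (auto simp: saturation_def R_def intro: poly_ring_closed)
  qed
qed

lemma det_in_power:
  assumes "N \<in> carrier_mat t t" "\<And>i j. i < t \<Longrightarrow> j < t \<Longrightarrow> N $$ (i, j) \<in> J"
  shows "det N \<in> J [^]\<^bsub>ideals_set R\<^esub> (t::nat)"
proof -
  note P = ideal_poly_ringD[OF power_ideal[of t]]
  have "(\<Prod>i\<in>A. h i) \<in> J [^]\<^bsub>ideals_set R\<^esub> (card A)" if "finite A" "\<And>i. i \<in> A \<Longrightarrow> h i \<in> J" for A :: "nat set" and h
    using that
  proof (induction A)
    case empty
    then show ?case by (simp add: ideals_set_def R_def poly_ring_closed)
  next
    case (insert i A)
    then have "(\<Prod>i\<in>A. h i) * h i \<in> ideal_prod R (J [^]\<^bsub>ideals_set R\<^esub> card A) J"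
      using ideal_prod.prod[of "\<Prod>i\<in>A. h i" "J [^]\<^bsub>ideals_set R\<^esub> card A" "h i" J R] by (simp add: R_def)
    then show ?case using insert.hyps by (simp add: ideals_set_def mult.commute)
  qed
  from this[of "{0..<t}"]
  have "(\<Prod>i = 0..<t. N $$ (i, p i)) \<in> J [^]\<^bsub>ideals_set R\<^esub> t" if "p permutes {0..<t}" for p
    using assms(2) permutes_in_image[OF that] by simp
  moreover have "signof p \<in> carrier (poly_ring (hankel_vars d) :: 'k hpoly ring)" for p :: "nat \<Rightarrow> nat"
    by (auto simp: sign_def intro: poly_ring_closed)
  ultimately show ?thesis
    unfolding det_def'[OF assms(1)] by (intro ideal_poly_ring_sum[OF power_ideal] P(4)) auto
qed

text \<open>The pivot is the upper left minor of size \<open>r\<close>, which lies outside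
  \<open>J\<close>, while its bordered minors of size \<open>r + 1\<close> lie in \<open>J\<close>.
  Sylvester's identity turns a power of the pivot times the large minor into a multiple of a
  determinant of size \<open>t\<close> with entries in \<open>J\<close>.\<close>

lemma minor_in_saturation:
  assumes adm: "admissible d (r + t) f g"
  shows "det (hmat (r + t) f g) \<in> saturation t"
proof -
  define a :: "nat \<Rightarrow> nat \<Rightarrow> 'k hpoly" where "a i j = Var (hvar (f i) (g j))" for i j
  define \<Delta> where "\<Delta> = det (mat r r (\<lambda>(i, j). a i j))"
  interpret hankel_order d "energy_order d" "TYPE('k)" by (rule hankel_order_energy)
  have adm_r: "admissible d r f g" using adm by (auto simp: admissible_def strict_mono_on_def)
  have \<Delta>: "\<Delta> \<in> carrier R - J"
    using diag_minor_notin_vanishing[OF adm_r] hmat_carrier[OF adm_r, where 'k = 'k]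
    by (simp add: \<Delta>_def a_def hmat_def R_def J_def hsecant_def)
  let ?N = "mat t t (\<lambda>(i, j). \<Delta> * det (mat (Suc r) (Suc r)
      (\<lambda>(k, l). a (if k < r then k else r + i) (if l < r then l else r + j))))"
  have "\<Delta> * det (mat (Suc r) (Suc r) (\<lambda>(k, l). a (if k < r then k else r + i) (if l < r then l else r + j))) \<in> J"
    if ij: "i < t" "j < t" for i j
  proof -
    let ?f = "\<lambda>k. f (if k < r then k else r + i)" and ?g = "\<lambda>k. g (if k < r then k else r + j)"
    have "admissible d (Suc r) ?f ?g"
      using adm ij by (auto simp: admissible_def strict_mono_on_def)
    from hmat_carrier[OF this, where 'k = 'k] det_hmat_vanishing[of "Suc r" ?f ?g r, where 'k = 'k]
    have "det (hmat (Suc r) ?f ?g) \<in> J" by (simp add: J_def hsecant_def)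
    then show ?thesis using \<Delta> J.I_l_closed by (simp add: a_def hmat_def R_def)
  qed
  then have "det ?N \<in> J [^]\<^bsub>ideals_set R\<^esub> t" by (intro det_in_power) auto
  then have "\<Delta> * det ?N \<in> J [^]\<^bsub>ideals_set R\<^esub> t"
    using \<Delta> ideal_poly_ringD(4)[OF power_ideal] by (simp add: R_def)
  then have "\<Delta> ^ (2 * t) * det (hmat (r + t) f g) \<in> J [^]\<^bsub>ideals_set R\<^esub> t"
    using sylvester_identity[of r a t] by (simp add: \<Delta>_def a_def hmat_def)
  then show ?thesis
    using complement_power[OF \<Delta>] hmat_carrier[OF adm] by (auto simp: saturation_def R_def)
qed

text \<open>A multiplier outside \<open>J\<close> cannot raise the order of vanishing, which gives
  one inclusion. For the other, products of minors lie in the saturation and generate all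
  polynomials of that order.\<close>

lemma symbolic_power_hsecant: "symbolic_power R J s = carrier R \<inter> hk.vanishing r s"
proof -
  have "symbolic_power R J s = saturation s"
    using R.symbolic_power_prime[OF J.primeideal_axioms, of s] by (simp add: saturation_def R_def)
  moreover have "saturation s \<subseteq> carrier R \<inter> hk.vanishing r s"
    using power_subset_vanishing[of s] hk.vanishing_cancel[of _ r _ s]
    by (auto simp: saturation_def J_def hsecant_def R_def)
  moreover have "carrier R \<inter> hk.vanishing r s \<subseteq> saturation s"
    unfolding R_def
  proof (rule hankel_order.vanishing_generated[OF hankel_order_energy finite_energy_order saturation_ideal])
    fix cs assume "chain_family d r s cs"
    then show "(\<Prod>c\<leftarrow>cs. chain_minor c) \<in> saturation s"
    proof (induction cs arbitrary: s)
      case Nil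
      then show ?case
        using complement_one
        by (auto simp: chain_family_def saturation_def ideals_set_def intro!: bexI[of _ 1])
    next
      case (Cons c cs)
      then have c: "sorted_wrt hless c" "set c \<subseteq> hankel_vars d" "r < length c" "length c - r \<le> s"
        "chain_family d r (s - (length c - r)) cs" unfolding chain_family_Cons by blast+
      have "chain_minor c \<in> saturation (length c - r)"
        using minor_in_saturation[of "length c - r"] chain_admissible(1)[OF c(1,2)] c(3)
        by (simp add: chain_minor_def)
      from saturation_mult[OF this Cons.IH[OF c(5)]] show ?case using c(4) by simp
    qed
  qed
  ultimately show ?thesis by blast
qed

end

section \<open>Groebner bases and differential perfection\<close>

lemma minors_ge_block_hankel:
  "minors_ge k (block_hankel d (d div 2)) = {det (hmat n f g) | n f g. k \<le> n \<and> admissible d n f g}"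
  unfolding minors_ge_def square_submatrices_block_hankel by blast

lemma det_hmat_nonzero:
  assumes "admissible d n f g"
  shows "det (hmat n f g) \<noteq> (0 :: ('k::field) hpoly)"
proof -
  interpret hankel_order d "energy_order d" "TYPE('k)" by (rule hankel_order_energy)
  show ?thesis using is_lm_diag[OF assms] by (auto simp: is_lm_def)
qed

lemma total_degree_det_hmat:
  assumes "admissible d n f g"
  shows "total_degree (det (hmat n f g) :: ('k::field) hpoly) = n"
proof -
  let ?K = "keys (det (hmat n f g) :: 'k hpoly)"
  have "?K \<noteq> {}" using det_hmat_nonzero[OF assms, where 'k = 'k] by simp
  moreover have "pmdegree m = n" if "m \<in> ?K" for m using that by (rule pmdegree_det_hmat)
  ultimately have "pmdegree ` ?K = {n}" using image_constant_conv[of n ?K] by (simp cong: image_cong)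
  then show ?thesis by (simp add: total_degree_def pmdegree_def[symmetric])
qed

lemma diagonal_term_order_hankel_order:
  assumes "diagonal_term_order TYPE('k::field) d ord"
  shows "hankel_order TYPE('k) d ord"
proof -
  have to: "term_order (hankel_vars d) ord" using assms by (simp add: diagonal_term_order_def)
  interpret monomial_order "hankel_vars d" ord by standard (rule to)
  show ?thesis
  proof
    fix n f g assume adm: "admissible d n f g"
    let ?N = "hmat n f g :: 'k hpoly mat"
    show "is_lm ord (det ?N) (diag_pmonom n f g)"
    proof (cases "n = 0")
      \<comment> \<open>The diagonal condition speaks of minors of size at least one; the empty
        minor is 1 with monomial 0.\<close>
      case True
      then show ?thesis
        using ord_refl[of 0] by (simp add: is_lm_def hmat_def diag_pmonom_def monoms_in_def)
    next
      case False
      have "?N \<in> square_submatrices n (block_hankel d (d div 2))"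
        unfolding square_submatrices_block_hankel using adm by blast
      then have "lead_monom ord (det ?N) = prod_list (diag_mat ?N)"
        using assms False unfolding diagonal_term_order_def by (metis One_nat_def Suc_leI div_le_dividend neq0_conv)
      also have "\<dots> = pmono (diag_pmonom n f g)"
        by (simp add: prod_list_diag_prod hmat_def diag_pmonom_def pmono_sum Var_pmono atLeast0LessThan)
      finally have lead: "lead_monom ord (det ?N) = pmono (diag_pmonom n f g)" .
      obtain m where m: "is_lm ord (det ?N) m"
        using is_lm_exists[OF hmat_carrier[OF adm] det_hmat_nonzero[OF adm]] by blast
      then have "(pmono m :: 'k hpoly) = pmono (diag_pmonom n f g)"
        using lead lead_monom_eq by metis
      then have "m = diag_pmonom n f g" by (metis keys_pmono singleton_inject)
      then show ?thesis using m by simp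
    qed
  qed
qed

lemma finite_minors_ge: "finite (minors_ge k (M :: 'a::comm_ring_1 mat))"
proof -
  have "minors_ge k M \<subseteq> (\<lambda>(I, J). det (submatrix M I J)) ` (Pow {..<dim_row M} \<times> Pow {..<dim_col M})"
    by (force simp: minors_ge_def square_submatrices_def)
  then show ?thesis by (rule finite_subset) auto
qed

lemma minor_productsE:
  assumes "p \<in> (minor_products d r s :: ('k::field) hpoly set)"
  obtains l :: nat and f where "p = (\<Prod>i=1..l. f i)"
    "\<And>i. i \<in> {1..l} \<Longrightarrow> f i \<in> minors_ge (r + 1) (block_hankel d (d div 2))"
    "\<And>i. i \<in> {1..l} \<Longrightarrow> f i \<in> carrier (poly_ring (hankel_vars d))"
    "\<And>i. i \<in> {1..l} \<Longrightarrow> f i \<in> hk.vanishing r (total_degree (f i) - r)"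
    "\<And>i. i \<in> {1..l} \<Longrightarrow> r < total_degree (f i)"
    "(\<Sum>i=1..l. total_degree (f i) - r) = s"
proof -
  obtain l :: nat and f where p: "p = (\<Prod>i=1..l. f i)"
    and f: "\<And>i. i \<in> {1..l} \<Longrightarrow> f i \<in> minors_ge (r + 1) (block_hankel d (d div 2))"
    and sum: "(\<Sum>i=1..l. int (total_degree (f i)) - int r) = int s"
    using assms unfolding minor_products_def by blast
  have fi: "f i \<in> carrier (poly_ring (hankel_vars d)) \<and> f i \<in> hk.vanishing r (total_degree (f i) - r) \<and>
      r < total_degree (f i)" if i: "i \<in> {1..l}" for i
  proof -
    obtain n a b where n: "f i = det (hmat n a b)" "r + 1 \<le> n" "admissible d n a b"
      using f[OF i] unfolding minors_ge_block_hankel by blast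
    then have "total_degree (f i) = n" using total_degree_det_hmat by simp
    then show ?thesis using n hmat_carrier[OF n(3), where 'k = 'k] det_hmat_vanishing[of n a b r, where 'k = 'k] by simp
  qed
  have "int (\<Sum>i=1..l. total_degree (f i) - r) = (\<Sum>i=1..l. int (total_degree (f i)) - int r)"
    unfolding of_nat_sum using fi by (intro sum.cong refl of_nat_diff) (simp add: less_imp_le)
  then have "(\<Sum>i=1..l. total_degree (f i) - r) = s" using sum by linarith
  then show thesis using that[OF p f] fi by blast
qed

text \<open>Each factor contributes at least one to \<open>s\<close>, so there are at most
  \<open>s\<close> factors, taken from a finite set.\<close>

lemma finite_minor_products: "finite (minor_products d r s :: ('k::field) hpoly set)"
proof -
  let ?M = "minors_ge (r + 1) (block_hankel d (d div 2)) :: 'k hpoly set"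
  have "minor_products d r s \<subseteq> prod_list ` {xs. set xs \<subseteq> ?M \<and> length xs \<le> s}"
  proof
    fix p :: "'k hpoly" assume "p \<in> minor_products d r s"
    then obtain l :: nat and f where p: "p = (\<Prod>i=1..l. f i)" and f: "\<And>i. i \<in> {1..l} \<Longrightarrow> f i \<in> ?M"
      and deg: "\<And>i. i \<in> {1..l} \<Longrightarrow> r < total_degree (f i)"
      and sum: "(\<Sum>i=1..l. total_degree (f i) - r) = s"
      by (rule minor_productsE) blast
    have "(\<Sum>i=1..l. 1) \<le> (\<Sum>i=1..l. total_degree (f i) - r)" using deg by (intro sum_mono) (simp add: Suc_le_eq)
    then have "l \<le> s" using sum by simp
    moreover have "p = prod_list (map f [1..<Suc l])"
      unfolding p by (simp add: prod.distinct_set_conv_list[symmetric] atLeastLessThanSuc_atLeastAtMost del: upt_Suc)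
    ultimately show "p \<in> prod_list ` {xs. set xs \<subseteq> ?M \<and> length xs \<le> s}"
      using f by (intro image_eqI[of _ _ "map f [1..<Suc l]"]) (auto simp del: upt_Suc)
  qed
  moreover have "finite (prod_list ` {xs. set xs \<subseteq> ?M \<and> length xs \<le> s})"
    by (intro finite_imageI finite_lists_length_le finite_minors_ge)
  ultimately show ?thesis by (rule finite_subset)
qed

lemma minor_products_vanishing:
  "minor_products d r s \<subseteq> (carrier (poly_ring (hankel_vars d)) \<inter> hk.vanishing r s :: ('k::field) hpoly set)"
proof
  fix p :: "'k hpoly" assume "p \<in> minor_products d r s"
  then obtain l :: nat and f where p: "p = (\<Prod>i=1..l. f i)"
    and car: "\<And>i. i \<in> {1..l} \<Longrightarrow> f i \<in> carrier (poly_ring (hankel_vars d))"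
    and van: "\<And>i. i \<in> {1..l} \<Longrightarrow> f i \<in> hk.vanishing r (total_degree (f i) - r)"
    and sum: "(\<Sum>i=1..l. total_degree (f i) - r) = s"
    by (rule minor_productsE) blast
  have "(\<Prod>i\<in>A. f i) \<in> hk.vanishing r (\<Sum>i\<in>A. total_degree (f i) - r)" if "finite A" "A \<subseteq> {1..l}" for A
    using that
  proof (induction A)
    case (insert i A)
    then have "f i * prod f A \<in> hk.vanishing r (total_degree (f i) - r + (\<Sum>i\<in>A. total_degree (f i) - r))"
      by (intro hk.vanishing_mult van) auto
    then show ?case unfolding prod.insert[OF insert.hyps] sum.insert[OF insert.hyps] .
  qed simp
  from this[of "{1..l}"] show "p \<in> carrier (poly_ring (hankel_vars d)) \<inter> hk.vanishing r s"
    using car sum unfolding p by (auto intro: poly_ring_prod)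
qed

lemma chain_family_minor_product:
  assumes "chain_family d r s cs" "s \<ge> 1"
  shows "(\<Prod>c\<leftarrow>cs. chain_minor c) \<in> (minor_products d r s :: ('k::field) hpoly set)"
proof -
  \<comment> \<open>Lists are indexed from 0, the products of minors from 1.\<close>
  define f :: "nat \<Rightarrow> 'k hpoly" where "f i = chain_minor (cs ! (i - 1))" for i
  have cs: "sorted_wrt hless c" "set c \<subseteq> hankel_vars d" "r < length c" if "c \<in> set cs" for c
    using assms(1) that by (auto simp: chain_family_def)
  \<comment> \<open>The empty family has total 0, so \<open>s \<ge> 1\<close> yields the required
    factor.\<close>
  have "cs \<noteq> []" using assms by (auto simp: chain_family_def)
  then have len: "length cs \<ge> 1" by (cases cs) auto
  have minor: "chain_minor c \<in> (minors_ge (r + 1) (block_hankel d (d div 2)) :: 'k hpoly set)"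
    "total_degree (chain_minor c :: 'k hpoly) = length c" if "c \<in> set cs" for c
    using chain_admissible(1)[OF cs(1,2)[OF that]] cs(3)[OF that] total_degree_det_hmat
    unfolding minors_ge_block_hankel chain_minor_def by fastforce+
  have mem: "cs ! (i - 1) \<in> set cs" if "i \<in> {1..length cs}" for i
    using that by (intro nth_mem) auto
  have prod: "(\<Prod>c\<leftarrow>cs. chain_minor c) = (\<Prod>i=1..length cs. f i)"
    by (simp add: prod.list_conv_set_nth f_def prod.atLeast1_atMost_eq atLeast0LessThan)
  have "(\<Sum>i=1..length cs. int (total_degree (f i)) - int r) = (\<Sum>i=1..length cs. int (length (cs ! (i - 1)) - r))"
    using minor(2)[OF mem] cs(3)[OF mem] unfolding f_def by (intro sum.cong) (auto simp: of_nat_diff less_imp_le)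
  also have "\<dots> = int (\<Sum>i=1..length cs. length (cs ! (i - 1)) - r)" by simp
  also have "(\<Sum>i=1..length cs. length (cs ! (i - 1)) - r) = (\<Sum>c\<leftarrow>cs. length c - r)"
    by (simp add: sum_list_sum_nth sum.atLeast1_atMost_eq atLeast0LessThan)
  also have "\<dots> = s" using assms(1) by (simp add: chain_family_def)
  finally show ?thesis
    unfolding minor_products_def prod using len minor(1)[OF mem] by (intro CollectI exI[of _ "length cs"] exI[of _ f]) (simp add: f_def)
qed

text \<open>Only leading ideals are compared, so divisibility by the leading monomial of a chain
  product is enough and any diagonal order may be used.\<close>

lemma groebner_basis_minor_products:
  assumes "diagonal_term_order TYPE('k::field) d ord" "s \<ge> 1"
  shows "groebner_basis (hankel_vars d) ord (minor_products d r s)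
    (carrier (poly_ring (hankel_vars d)) \<inter> hk.vanishing r s :: 'k hpoly set)"
proof -
  interpret hankel_order d ord "TYPE('k)" by (rule diagonal_term_order_hankel_order[OF assms(1)])
  let ?R = "poly_ring (hankel_vars d) :: 'k hpoly ring"
  let ?G = "minor_products d r s :: 'k hpoly set"
  let ?I = "carrier ?R \<inter> hk.vanishing r s"
  have G: "?G \<subseteq> ?I" by (rule minor_products_vanishing)
  have car: "lead_monom ord ` (?I - {0}) \<subseteq> carrier ?R"
  proof
    fix x assume "x \<in> lead_monom ord ` (?I - {0})"
    then obtain p where p: "p \<in> carrier ?R" "p \<noteq> 0" "x = lead_monom ord p" by blast
    then obtain m where m: "is_lm ord p m" "m \<in> monoms_in (hankel_vars d)" using is_lm_exists by blast
    then show "x \<in> carrier ?R" using p(3) lead_monom_eq[OF m(1)] by (simp add: poly_ring_closed)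
  qed
  have sub: "lead_monom ord ` (?G - {0}) \<subseteq> lead_monom ord ` (?I - {0})" using G by blast
  note A = genideal_poly_ring[OF subset_trans[OF sub car]] and B = genideal_poly_ring[OF car]
  have "lead_monom ord ` (?I - {0}) \<subseteq> genideal ?R (lead_monom ord ` (?G - {0}))"
  proof
    fix x assume "x \<in> lead_monom ord ` (?I - {0})"
    then obtain p where p: "p \<in> carrier ?R" "p \<in> hk.vanishing r s" "p \<noteq> 0" "x = lead_monom ord p" by blast
    obtain m where m: "is_lm ord p m" using is_lm_exists[OF p(1,3)] by blast
    obtain cs k where cs: "chain_family d r s cs" "k \<in> monoms_in (hankel_vars d)" "m = k + list_pmonom (concat cs)"
      "is_lm ord (\<Prod>c\<leftarrow>cs. chain_minor c :: 'k hpoly) (list_pmonom (concat cs))"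
      using vanishing_chain_family[OF p(1,2) m] .
    let ?g = "\<Prod>c\<leftarrow>cs. chain_minor c :: 'k hpoly"
    have "?g \<in> ?G - {0}"
    proof
      show "?g \<in> ?G" by (rule chain_family_minor_product[OF cs(1) assms(2)])
      have "keys ?g \<noteq> {}" using cs(4) unfolding is_lm_def by blast
      then show "?g \<notin> {0}" by (metis keys_zero singletonD)
    qed
    then have "lead_monom ord ?g \<in> genideal ?R (lead_monom ord ` (?G - {0}))" using A(2) by blast
    then have "pmono k * lead_monom ord ?g \<in> genideal ?R (lead_monom ord ` (?G - {0}))"
      using ideal_poly_ringD(4)[OF A(1)] cs(2) by (auto intro: poly_ring_closed)
    moreover have "x = pmono k * lead_monom ord ?g"
      using lead_monom_eq[OF m] lead_monom_eq[OF cs(4)] by (simp add: p(4) cs(3) pmono_add)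
    ultimately show "x \<in> genideal ?R (lead_monom ord ` (?G - {0}))" by simp
  qed
  then have "genideal ?R (lead_monom ord ` (?I - {0})) \<subseteq> genideal ?R (lead_monom ord ` (?G - {0}))"
    using B(3)[OF A(1)] by blast
  moreover have "genideal ?R (lead_monom ord ` (?G - {0})) \<subseteq> genideal ?R (lead_monom ord ` (?I - {0}))"
    using A(3)[OF B(1)] sub B(2) by blast
  ultimately show ?thesis using finite_minor_products G by (auto simp: groebner_basis_def)
qed

section \<open>Finite sums of ideals\<close>

context cring
begin

lemma subset_set_add:
  assumes "ideal A R" "ideal B R"
  shows "A \<subseteq> A <+>\<^bsub>R\<^esub> B" "B \<subseteq> A <+>\<^bsub>R\<^esub> B"
proof -
  have z: "\<zero> \<in> A" "\<zero> \<in> B" using assms ideal.axioms(1) additive_subgroup.zero_closed by blast+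
  have "x \<in> A <+>\<^bsub>R\<^esub> B" if "x \<in> A" for x
  proof -
    have "x = x \<oplus> \<zero>" using that ideal.Icarr[OF assms(1)] by simp
    then show ?thesis using that z(2) unfolding set_add_def' by blast
  qed
  moreover have "x \<in> A <+>\<^bsub>R\<^esub> B" if "x \<in> B" for x
  proof -
    have "x = \<zero> \<oplus> x" using that ideal.Icarr[OF assms(2)] by simp
    then show ?thesis using that z(1) unfolding set_add_def' by blast
  qed
  ultimately show "A \<subseteq> A <+>\<^bsub>R\<^esub> B" "B \<subseteq> A <+>\<^bsub>R\<^esub> B" by blast+
qed

lemma set_add_subset:
  assumes "ideal C R" "A \<subseteq> C" "B \<subseteq> C"
  shows "A <+>\<^bsub>R\<^esub> B \<subseteq> C"
  using assms additive_subgroup.a_closed[OF ideal.axioms(1)[OF assms(1)]] unfolding set_add_def' by blast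

text \<open>Describes the finite sum as the least ideal containing its summands, so that later only
  inclusions have to be checked.\<close>

lemma ideal_finsum:
  assumes "finite A" "\<And>i. i \<in> A \<Longrightarrow> ideal (F i) R"
  shows "ideal (finsum (ideals_set R) F A) R" "\<And>i. i \<in> A \<Longrightarrow> F i \<subseteq> finsum (ideals_set R) F A"
    "\<And>C. ideal C R \<Longrightarrow> (\<And>i. i \<in> A \<Longrightarrow> F i \<subseteq> C) \<Longrightarrow> finsum (ideals_set R) F A \<subseteq> C"
proof -
  interpret S: semiring "ideals_set R" by (rule ideals_set_is_semiring)
  have "ideal (finsum (ideals_set R) F A) R \<and> (\<forall>i\<in>A. F i \<subseteq> finsum (ideals_set R) F A) \<and>
    (\<forall>C. ideal C R \<longrightarrow> (\<forall>i\<in>A. F i \<subseteq> C) \<longrightarrow> finsum (ideals_set R) F A \<subseteq> C)"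
    using assms
  proof (induction A)
    case empty
    have "\<zero> \<in> C" if "ideal C R" for C using that ideal.axioms(1) additive_subgroup.zero_closed by blast
    moreover have "finsum (ideals_set R) F {} = {\<zero>}" unfolding S.finsum_empty by (simp add: ideals_set_def)
    ultimately show ?case using zeroideal by simp
  next
    case (insert i A)
    have F: "F \<in> A \<rightarrow> carrier (ideals_set R)" "F i \<in> carrier (ideals_set R)" "ideal (F i) R"
      using insert.prems by (auto simp: ideals_set_def)
    have eq: "finsum (ideals_set R) F (insert i A) = F i <+>\<^bsub>R\<^esub> finsum (ideals_set R) F A"
      using S.finsum_insert[OF insert.hyps F(1,2)] by (simp add: ideals_set_def)
    have IH: "ideal (finsum (ideals_set R) F A) R" "\<forall>i\<in>A. F i \<subseteq> finsum (ideals_set R) F A"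
      "\<forall>C. ideal C R \<longrightarrow> (\<forall>i\<in>A. F i \<subseteq> C) \<longrightarrow> finsum (ideals_set R) F A \<subseteq> C"
      using insert.IH insert.prems by blast+
    note sub = subset_set_add[OF F(3) IH(1)]
    have "F j \<subseteq> F i <+>\<^bsub>R\<^esub> finsum (ideals_set R) F A" if "j \<in> insert i A" for j
      using that IH(2) sub by blast
    moreover have "F i <+>\<^bsub>R\<^esub> finsum (ideals_set R) F A \<subseteq> C" if "ideal C R" "\<forall>j\<in>insert i A. F j \<subseteq> C" for C
      using that IH(3) by (intro set_add_subset) auto
    ultimately show ?case unfolding eq using add_ideals[OF F(3) IH(1)] by blast
  qed
  then show "ideal (finsum (ideals_set R) F A) R" "\<And>i. i \<in> A \<Longrightarrow> F i \<subseteq> finsum (ideals_set R) F A"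
    "\<And>C. ideal C R \<Longrightarrow> (\<And>i. i \<in> A \<Longrightarrow> F i \<subseteq> C) \<Longrightarrow> finsum (ideals_set R) F A \<subseteq> C"
    by blast+
qed

end

text \<open>With symbolic powers and secant ideals both expressed by \<open>vanishing\<close>, each
  side is compared on products of minors: either the first factor already accounts for the whole
  order \<open>s\<close>, or the product splits into two factors of smaller positive order.\<close>

lemma hankel_diff_perfect: "diff_perfect (hankel_vars d) (hankel_ideal d :: ('k::field) hpoly set)"
proof -
  let ?R = "poly_ring (hankel_vars d) :: 'k hpoly ring"
  interpret R: cring ?R by (rule cring_poly_ring)
  define H where "H r s = carrier ?R \<inter> hk.vanishing r s" for r s
  have Hid: "ideal (H r s) ?R" for r s unfolding H_def by (rule hk.vanishing_ideal)
  have symb: "symbolic_power ?R (hsecant d r) s = H r s" for r s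
    unfolding H_def by (rule symbolic_power_hsecant)
  have "H r s = hsecant d (r + s - 1) \<oplus>\<^bsub>ideals_set ?R\<^esub>
      (\<Oplus>\<^bsub>ideals_set ?R\<^esub>i\<in>{1..s-1}. H r i \<otimes>\<^bsub>ideals_set ?R\<^esub> H r (s - i))" (is "_ = ?A \<oplus>\<^bsub>_\<^esub> ?B")
    if rs: "r \<ge> 1" "s \<ge> 1" for r s
  proof -
    let ?F = "\<lambda>i. H r i \<otimes>\<^bsub>ideals_set ?R\<^esub> H r (s - i)"
    have F: "?F i = ideal_prod ?R (H r i) (H r (s - i))" for i by (simp add: ideals_set_def)
    have Fid: "ideal (?F i) ?R" for i unfolding F by (rule R.ideal_prod_is_ideal[OF Hid Hid])
    note B = R.ideal_finsum[of "{1..s-1}" ?F, OF _ Fid]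
    have A: "?A = H (r + s - 1) 1" by (simp add: hsecant_def H_def)
    have Aid: "ideal ?A ?R" unfolding A by (rule Hid)
    have Bid: "ideal ?B ?R" by (rule B(1)) simp
    have "?A <+>\<^bsub>?R\<^esub> ?B = H r s"
    proof
      show "?A <+>\<^bsub>?R\<^esub> ?B \<subseteq> H r s"
      proof (rule R.set_add_subset[OF Hid])
        show "?A \<subseteq> H r s"
          unfolding A H_def
        proof (rule hankel_order.vanishing_generated[OF hankel_order_energy finite_energy_order Hid[unfolded H_def]])
          fix cs assume cs: "chain_family d (r + s - 1) 1 cs"
          then obtain c cs' where c: "cs = c # cs'" by (cases cs) (auto simp: chain_family_def)
          then have "sorted_wrt hless c" "set c \<subseteq> hankel_vars d" "r + s - 1 < length c" "chain_family d (r + s - 1) (1 - (length c - (r + s - 1))) cs'"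
            using cs by (auto simp: chain_family_Cons)
          moreover from this have "(\<Prod>c\<leftarrow>cs'. chain_minor c :: 'k hpoly) \<in> carrier ?R"
            using chain_family_vanishing by blast
          \<comment> \<open>A chain longer than \<open>r + s - 1\<close> has at least
            \<open>r + s\<close> elements, so its minor vanishes to order \<open>s\<close> at sums
            of \<open>r\<close> orbit points.\<close>
          ultimately have "(\<Prod>c\<leftarrow>cs'. chain_minor c) * chain_minor c \<in> H r s"
            using hk.vanishing_antimono[OF _ chain_minor_vanishing[of c r, where 'k = 'k], of s]
            by (intro ideal_poly_ringD(4)[OF Hid]) (auto simp: H_def intro: chain_minor_carrier)
          then show "(\<Prod>c\<leftarrow>cs. chain_minor c) \<in> carrier ?R \<inter> hk.vanishing r s"
            by (simp add: c H_def mult.commute)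
        qed
        show "?B \<subseteq> H r s"
        proof (rule B(3)[OF _ Hid])
          fix i assume i: "i \<in> {1..s-1}"
          have "x \<in> H r s" if "x \<in> ideal_prod ?R (H r i) (H r (s - i))" for x
            using that
          proof (induction rule: ideal_prod.induct)
            case (prod a b)
            then have "a * b \<in> hk.vanishing r (i + (s - i))" by (intro hk.vanishing_mult) (auto simp: H_def)
            then show ?case using prod i by (auto simp: H_def intro: poly_ring_closed)
          next
            case (sum a b)
            then show ?case using ideal_poly_ringD(3)[OF Hid] by simp
          qed
          then show "?F i \<subseteq> H r s" unfolding F by blast
        qed simp
      qed
      show "H r s \<subseteq> ?A <+>\<^bsub>?R\<^esub> ?B"
        unfolding H_def
      proof (rule hankel_order.vanishing_generated[OF hankel_order_energy finite_energy_order R.add_ideals[OF Aid Bid, unfolded H_def]])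
        fix cs assume cs: "chain_family d r s cs"
        obtain c cs' where c: "cs = c # cs'" using cs rs(2) by (cases cs) (auto simp: chain_family_def)
        define t where "t = length c - r"
        have c': "sorted_wrt hless c" "set c \<subseteq> hankel_vars d" "r < length c" "t \<le> s" "chain_family d r (s - t) cs'"
          using cs unfolding c t_def chain_family_Cons by blast+
        note rest = chain_family_vanishing[OF c'(5), where 'k = 'k]
        note car = chain_minor_carrier[OF c'(1,2), where 'k = 'k]
        \<comment> \<open>If \<open>t = s\<close>, the first minor has size \<open>r + s\<close> and
          lies in the secant ideal of index \<open>r + s - 1\<close>. Otherwise \<open>t\<close> is
          strictly between 0 and \<open>s\<close>, and separating the first minor exhibits an
          element of the \<open>t\<close>-th product of symbolic powers.\<close>
        have "(\<Prod>c\<leftarrow>cs. chain_minor c) \<in> ?A \<union> ?B"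
        proof (cases "t = s")
          case True
          then have "length c - (r + s - 1) = 1" using c'(3) rs by (auto simp: t_def)
          then have "chain_minor c \<in> ?A"
            using car chain_minor_vanishing[of c "r + s - 1", where 'k = 'k] unfolding A H_def by simp
          then have "(\<Prod>c\<leftarrow>cs'. chain_minor c) * chain_minor c \<in> ?A"
            using rest by (intro ideal_poly_ringD(4)[OF Aid]) auto
          then show ?thesis by (simp add: c mult.commute)
        next
          case False
          then have t: "t \<in> {1..s-1}" using c'(3,4) by (auto simp: t_def)
          have "chain_minor c \<in> H r t" "(\<Prod>c\<leftarrow>cs'. chain_minor c) \<in> H r (s - t)"
            using car rest chain_minor_vanishing[of c r, where 'k = 'k] by (auto simp: H_def t_def)
          then have "chain_minor c * (\<Prod>c\<leftarrow>cs'. chain_minor c) \<in> ?F t"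
            unfolding F using ideal_prod.prod[of "chain_minor c" "H r t" _ "H r (s - t)" ?R] by simp
          then show ?thesis using B(2)[OF _ t] by (auto simp: c)
        qed
        then show "(\<Prod>c\<leftarrow>cs. chain_minor c) \<in> hsecant d (r + s - 1) <+>\<^bsub>?R\<^esub>
            (\<Oplus>\<^bsub>ideals_set ?R\<^esub>i\<in>{1..s-1}. (carrier ?R \<inter> hk.vanishing r i) \<otimes>\<^bsub>ideals_set ?R\<^esub> (carrier ?R \<inter> hk.vanishing r (s - i)))"
          using R.subset_set_add[OF Aid Bid] unfolding H_def by blast
      qed
    qed
    then show ?thesis by (simp add: ideals_set_def)
  qed
  then show ?thesis
    unfolding diff_perfect_def r_diff_perfect_def Let_def
    by (simp add: secant_hankel_ideal symb)
qed

theorem corollary6p7: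
  fixes d :: nat
  assumes "d \<ge> 1"
  shows "diff_perfect (hankel_vars d)
           (hankel_ideal d :: (nat \<times> nat, 'k::alg_closed_field) mpoly set) \<and>
    (\<forall>r s ord. r \<ge> 1 \<longrightarrow> s \<ge> 1 \<longrightarrow> diagonal_term_order TYPE('k) d ord \<longrightarrow>
       groebner_basis (hankel_vars d) ord
         (minor_products d r s)
         (symbolic_power (poly_ring (hankel_vars d))
            (secant_ideal (hankel_vars d) (hankel_ideal d :: (nat \<times> nat, 'k) mpoly set) r) s))"
proof (intro conjI allI impI)
  show "diff_perfect (hankel_vars d) (hankel_ideal d :: (nat \<times> nat, 'k) mpoly set)"
    by (rule hankel_diff_perfect)
  fix r s :: nat and ord
  assume "r \<ge> 1" "s \<ge> 1" "diagonal_term_order TYPE('k) d ord"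
  then show "groebner_basis (hankel_vars d) ord (minor_products d r s)
      (symbolic_power (poly_ring (hankel_vars d))
        (secant_ideal (hankel_vars d) (hankel_ideal d :: (nat \<times> nat, 'k) mpoly set) r) s)"
    unfolding secant_hankel_ideal[OF \<open>r \<ge> 1\<close>] symbolic_power_hsecant
    by (intro groebner_basis_minor_products)
qed

end
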